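(* Let $R>1$ and $\Omega=\{x\in\mathbb{R}^3: 1\le |x|\le R\}$. Let $R^*>1$ be a number such that for every $R'\in(1,R^*]$ one has $\eta_{R'}(r)\ge \tfrac23$ for all $r\in[1,R']$, where $\eta_{R'}$ is defined in the context (such $R^*$ exists). Suppose \[ R<\min\left\{R_0:=\exp\left(\frac{4\pi^2}{23}\right),\ R^*\right\}. \] Then for every reduced temperature $t\ge 0$, the radial-hedgehog solution $\mathbf H$ is the unique global minimizer of the Landau–de Gennes energy $I$ in the admissible class $\mathcal A$.
   Context: Let $S_0$ be the space of real symmetric traceless $3\times3$ matrices, with $\mathbf A\cdot\mathbf B=A_{ij}B_{ij}$ and $|\mathbf Q|^2=Q_{ij}Q_{ij}$ (summation convention). Let $r=|x|$, $\hat x=x/r$. For $t\ge0$ put $h_+=\frac{3+\sqrt{9+8t}}{4}$. The (rescaled) Landau–de Gennes energy on $\Omega$ is \[ I[\mathbf Q]=\int_\Omega \frac12|\nabla\mathbf Q|^2+\frac t8\left(1-|\mathbf Q|^2\right)^2+\frac{h_+}{8}\left(1+3|\mathbf Q|^4-4\sqrt6\,\mathrm{tr}\,\mathbf Q^3\right)\,dV, \] with $|\nabla\mathbf Q|^2=Q_{ij,k}Q_{ij,k}$. The admissible class is $\mathcal A=\{\mathbf Q\in W^{1,2}(\Omega;S_0): \mathbf Q=\mathbf Q_b \text{ on } r=1 \text{ and } r=R\}$, where $\mathbf Q_b=\sqrt{3/2}\,(\hat x\otimes\hat x-\mathbf I/3)$. Let $h$ be a minimizer of \[ E[h]=\int_1^R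 \frac{r^2}{2}(h')^2+3h^2+r^2\left[\frac t8(1-h^2)^2+\frac{h_+}{8}(1+3h^4-4h^3)\right]dr \] over $\mathcal A_h=\{h\in L^2(1,R): h'\in L^2((1,R);r^2dr),\ h(1)=h(R)=1\}$. The radial-hedgehog solution is $\mathbf H(x)=\sqrt{3/2}\,h(|x|)\,(\hat x\otimes\hat x-\mathbf I/3)$. For $R'>1$, $\eta_{R'}(r)=\frac{1}{R'^5-1}\left[(R'^3-1)r^2+(R'^2-1)\left(\frac{R'}{r}\right)^3\right]$ for $r\in[1,R']$. *)

theory Defs
  imports "HOL-Analysis.Analysis"
begin

definition test_fn :: "'a::euclidean_space set \<Rightarrow> ('a \<Rightarrow> real) \<Rightarrow> ('a \<Rightarrow> 'a) \<Rightarrow> bool" where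
  "test_fn U \<phi> g \<longleftrightarrow>
     (\<forall>x. (\<phi> has_derivative (\<lambda>v. g x \<bullet> v)) (at x)) \<and> continuous_on UNIV g \<and>
     (\<exists>K. compact K \<and> K \<subseteq> U \<and> (\<forall>x. x \<notin> K \<longrightarrow> \<phi> x = 0))"

definition weak_grad :: "'a::euclidean_space set \<Rightarrow> ('a \<Rightarrow> real) \<Rightarrow> ('a \<Rightarrow> 'a) \<Rightarrow> bool" where
  "weak_grad U u G \<longleftrightarrow>
     (\<forall>K. compact K \<and> K \<subseteq> U \<longrightarrow> integrable (lebesgue_on K) u \<and> integrable (lebesgue_on K) G) \<and>
     (\<forall>\<phi> g. test_fn U \<phi> g \<longrightarrow> (\<forall>e\<in>Basis.
        integral\<^sup>L (lebesgue_on U) (\<lambda>x. u x * (g x \<bullet> e))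
          = - integral\<^sup>L (lebesgue_on U) (\<lambda>x. (G x \<bullet> e) * \<phi> x)))"

definition L2 :: "'a::euclidean_space set \<Rightarrow> ('a \<Rightarrow> real) \<Rightarrow> bool" where
  "L2 U f \<longleftrightarrow> f \<in> borel_measurable (lebesgue_on U) \<and> integrable (lebesgue_on U) (\<lambda>x. (f x)\<^sup>2)"

definition L2vec :: "'a::euclidean_space set \<Rightarrow> ('a \<Rightarrow> 'a) \<Rightarrow> bool" where
  "L2vec U G \<longleftrightarrow> G \<in> borel_measurable (lebesgue_on U) \<and> integrable (lebesgue_on U) (\<lambda>x. (norm (G x))\<^sup>2)"

definition W12 :: "'a::euclidean_space set \<Rightarrow> ('a \<Rightarrow> real) \<Rightarrow> ('a \<Rightarrow> 'a) \<Rightarrow> bool" where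
  "W12 U u G \<longleftrightarrow> L2 U u \<and> weak_grad U u G \<and> L2vec U G"

definition W0 :: "'a::euclidean_space set \<Rightarrow> ('a \<Rightarrow> real) \<Rightarrow> bool" where
  "W0 U u \<longleftrightarrow> (\<exists>G. W12 U u G \<and>
     (\<exists>\<phi> g. (\<forall>n::nat. test_fn U (\<phi> n) (g n)) \<and>
        (\<lambda>n. integral\<^sup>L (lebesgue_on U) (\<lambda>x. (\<phi> n x - u x)\<^sup>2)) \<longlonglongrightarrow> 0 \<and>
        (\<lambda>n. integral\<^sup>L (lebesgue_on U) (\<lambda>x. (norm (g n x - G x))\<^sup>2)) \<longlonglongrightarrow> 0))"

definition shell :: "real \<Rightarrow> (real^3) set" where
  "shell R = {x. 1 \<le> norm x \<and> norm x \<le> R}"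

definition shell_int :: "real \<Rightarrow> (real^3) set" where
  "shell_int R = {x. 1 < norm x \<and> norm x < R}"

definition hplus :: "real \<Rightarrow> real" where
  "hplus t = (3 + sqrt (9 + 8 * t)) / 4"

definition S0 :: "(real^3^3) set" where
  "S0 = {Q. transpose Q = Q \<and> trace Q = 0}"

definition fnorm2 :: "real^3^3 \<Rightarrow> real" where
  "fnorm2 Q = (\<Sum>i\<in>UNIV. \<Sum>j\<in>UNIV. (Q $ i $ j)\<^sup>2)"

text \<open>DQ x $ i $ j is the gradient of Q_ij at x, so (DQ x $ i $ j) $ k = Q_{ij,k}.\<close>
definition grad_norm2 :: "real^3^3^3 \<Rightarrow> real" where
  "grad_norm2 D = (\<Sum>i\<in>UNIV. \<Sum>j\<in>UNIV. (norm (D $ i $ j))\<^sup>2)"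

definition Qb :: "real^3 \<Rightarrow> real^3^3" where
  "Qb x = (\<chi> i j. sqrt (3/2) * (x $ i * x $ j / (norm x)\<^sup>2 - (if i = j then 1/3 else 0)))"

definition hedgehog :: "(real \<Rightarrow> real) \<Rightarrow> real^3 \<Rightarrow> real^3^3" where
  "hedgehog h x = (\<chi> i j. sqrt (3/2) * h (norm x) *
                     (x $ i * x $ j / (norm x)\<^sup>2 - (if i = j then 1/3 else 0)))"

definition LdG_density :: "real \<Rightarrow> real^3^3 \<Rightarrow> real^3^3^3 \<Rightarrow> real" where
  "LdG_density t Q D = grad_norm2 D / 2 + t / 8 * (1 - fnorm2 Q)\<^sup>2
      + hplus t / 8 * (1 + 3 * (fnorm2 Q)\<^sup>2 - 4 * sqrt 6 * trace (Q ** Q ** Q))"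

definition LdG :: "real \<Rightarrow> real \<Rightarrow> (real^3 \<Rightarrow> real^3^3) \<Rightarrow> (real^3 \<Rightarrow> real^3^3^3) \<Rightarrow> real" where
  "LdG R t Q D = integral\<^sup>L (lebesgue_on (shell R)) (\<lambda>x. LdG_density t (Q x) (D x))"

definition admissible :: "real \<Rightarrow> (real^3 \<Rightarrow> real^3^3) \<Rightarrow> (real^3 \<Rightarrow> real^3^3^3) \<Rightarrow> bool" where
  "admissible R Q D \<longleftrightarrow>
     (AE x in lebesgue_on (shell R). Q x \<in> S0) \<and>
     (\<forall>i j. W12 (shell_int R) (\<lambda>x. Q x $ i $ j) (\<lambda>x. D x $ i $ j)) \<and>
     (\<forall>i j. W0 (shell_int R) (\<lambda>x. Q x $ i $ j - Qb x $ i $ j))"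

text \<open>The 1D problem. h' is the weak derivative of h on (1,R); h is the continuous representative.\<close>
definition Ah :: "real \<Rightarrow> (real \<Rightarrow> real) \<Rightarrow> (real \<Rightarrow> real) \<Rightarrow> bool" where
  "Ah R h h' \<longleftrightarrow>
     continuous_on {1..R} h \<and> L2 {1<..<R} h \<and>
     weak_grad {1<..<R} h h' \<and>
     h' \<in> borel_measurable (lebesgue_on {1<..<R}) \<and>
     integrable (lebesgue_on {1<..<R}) (\<lambda>r. r\<^sup>2 * (h' r)\<^sup>2) \<and>
     h 1 = 1 \<and> h R = 1"

definition Eh :: "real \<Rightarrow> real \<Rightarrow> (real \<Rightarrow> real) \<Rightarrow> (real \<Rightarrow> real) \<Rightarrow> real" where
  "Eh R t h h' = integral\<^sup>L (lebesgue_on {1..R}) (\<lambda>r.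
      r\<^sup>2 / 2 * (h' r)\<^sup>2 + 3 * (h r)\<^sup>2
      + r\<^sup>2 * (t / 8 * (1 - (h r)\<^sup>2)\<^sup>2 + hplus t / 8 * (1 + 3 * (h r)^4 - 4 * (h r)^3)))"

definition eta :: "real \<Rightarrow> real \<Rightarrow> real" where
  "eta R' r = 1 / (R' ^ 5 - 1) * ((R' ^ 3 - 1) * r\<^sup>2 + (R'\<^sup>2 - 1) * (R' / r) ^ 3)"

end

theory Submission
  imports Defs
begin

text \<open>
  Write a competitor as \<open>Q = H + V\<close> with \<open>V\<close> in \<open>W\<^sub>0\<^sup>1\<^sup>,\<^sup>2\<close>, and let \<open>c\<close> be the coefficient for which the minimizer \<open>h\<close>
  satisfies \<open>h'' + 2 h' / r = (6 / r\<^sup>2 + c) h\<close>. Then \<open>\<Delta> H = c H\<close>, so the terms of the energy that are linear in \<open>V\<close>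
  cancel, and the energy gap is \<open>1/2 \<integral> \<bar>\<nabla> V\<bar>\<^sup>2 + c \<bar>V\<bar>\<^sup>2\<close> plus the integral of a pointwise remainder.

  Comparison with \<open>\<eta>\<close>, a solution of \<open>\<eta>'' + 2 \<eta>' / r = 6 \<eta> / r\<^sup>2\<close> with the same boundary values, gives
  \<open>2/3 \<le> \<eta> \<le> h \<le> 1\<close>. For such \<open>h\<close> the remainder is nonnegative: after a rotation taking \<open>x / \<bar>x\<bar>\<close> to the first
  basis vector, this is an inequality for polynomials in the entries of \<open>V\<close>. The quadratic form is coercive by a Hardy
  inequality with an explicit radial vector field, which exists for \<open>R < 9/4\<close>; the condition on \<open>\<eta>\<close> fails at radius \<open>9/4\<close>,
  so it forces this bound. The bulk energy of every competitor is finite because \<open>V \<in> L\<^sup>4\<close>, by Ladyzhenskaya's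
  inequality and Fatou's lemma.
\<close>

section \<open>A matrix inequality\<close>

text \<open>The obstacle is the sign of \<open>c\<close>: it is negative for
  \<open>0 < h < 1\<close>, so the form \<open>\<bar>\<nabla> V\<bar>^2 + c \<bar>V\<bar>^2\<close>
  is not nonnegative by inspection. The entries of \<open>H\<close> are radial multiples of harmonic
  quadratic polynomials, and their angular energy is the term \<open>6 / r^2\<close> in the equation
  for \<open>h\<close>. An entry of \<open>V\<close> is an arbitrary scalar function with zero
  boundary values and may be radial, so it has no such energy to offer. Using \<open>h\<close> as a
  ground state therefore leaves a deficit of \<open>6 / r^2\<close>, which has to be recovered from
  the thinness of the shell. The lower bound on \<open>h\<close> enters twice: in the pointwise
  remainder, and in a Riccati inequality where \<open>h^2\<close> ranges over the interval from 4/9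
  to 1. That inequality holds with room to spare, and the surplus bounds the \<open>L^2\<close>
  distance to \<open>H\<close> by the energy gap, which gives uniqueness. Energies are Bochner
  integrals, which are 0 for nonintegrable densities; two energies can be compared only after
  integrability is known for every competitor. Since \<open>V\<close> is only a limit of test
  functions, the identities and inequalities for test functions are carried over by density.\<close>

lemma nonneg_of_diff: "A - B = C \<Longrightarrow> 0 \<le> B \<Longrightarrow> 0 \<le> C \<Longrightarrow> 0 \<le> A" for A B C :: real
  by simp

text \<open>After minimising over \<open>w\<close>, the claim is \<open>h\<^sup>3 (\<nu> - 3)\<^sup>2 (3 h (\<nu> + 1)\<^sup>2 - 8 \<nu>) \<ge> 0\<close> with \<open>\<nu> = - m / h\<close>;
  this is where \<open>h \<ge> 2/3\<close> enters.\<close>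
lemma core_ineq:
  fixes h X y w m :: real
  assumes h: "h \<ge> 2/3" and y: "y = m - w" and X: "X \<ge> y^2 + w^2/3"
  shows "3*(X + 2*h*y - m)^2 + m^2*(6*h - 3 + 2*m) \<ge> 0"
proof (cases "6*h - 3 + 2*m \<ge> 0")
  case True then show ?thesis by (meson add_nonneg_nonneg mult_nonneg_nonneg zero_le_power2 zero_le_numeral)
next
  case False
  define mu where "mu = - m"
  have mu: "2*mu > 6*h - 3" using False mu_def by auto
  \<comment> \<open>\<open>L\<close> is the minimum over \<open>w\<close> of
    \<open>y^2 + w^2/3 + 2*h*y - m\<close> with \<open>y = m - w\<close>, attained at
    \<open>w = 3*(m+h)/4\<close>.\<close>
  define L where "L = mu^2/4 + (1 - h/2)*mu - 3*h^2/4"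
  have "X + 2*h*y - m - L \<ge> y^2 + w^2/3 + 2*h*y - m - L" using X by simp
  also have "y^2 + w^2/3 + 2*h*y - m - L = (4/3)*(w - (3/4)*(m+h))^2"
    unfolding y L_def mu_def by (simp add: power2_eq_square algebra_simps)
  finally have "0 \<le> X + 2*h*y - m - L" by (rule order_trans[rotated]) simp
  then have Z: "X + 2*h*y - m \<ge> L" by simp
  \<comment> \<open>This product equals \<open>16*L + 15 - 24*h\<close>, and \<open>24*h\<close> is
    at least 16. The sign of \<open>L\<close> is needed to square the inequality
    \<open>Z\<close>.\<close>
  have "(2*mu - (6*h-3))*(2*mu + 6*h - 3 + 8 - 4*h) \<ge> 0" using mu h by (intro mult_nonneg_nonneg) auto
  then have L: "L \<ge> 0" unfolding L_def using h by (simp add: power2_eq_square algebra_simps)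
  define nu where "nu = mu / h"
  have mm: "mu = h * nu" using h nu_def by simp
  have "3*h*(nu+1)^2 \<ge> 2*(nu+1)^2" using h by (intro mult_right_mono) auto
  also have "2*(nu+1)^2 - 8*nu = 2*(nu-1)^2" by (simp add: power2_eq_square algebra_simps)
  ultimately have "3*h*(nu+1)^2 - 8*nu \<ge> 0" by (smt (verit) zero_le_power2)
  then have "h^3*((nu-3)^2*(3*h*(nu+1)^2 - 8*nu)) \<ge> 0" using h by auto
  also have "h^3*((nu-3)^2*(3*h*(nu+1)^2 - 8*nu)) = 16*(3*L^2 - mu^2*(2*mu + 3 - 6*h))"
    unfolding L_def mm by (simp add: power2_eq_square power3_eq_cube field_simps)
  finally have "3*L^2 \<ge> mu^2*(2*mu + 3 - 6*h)" by simp
  moreover have "3*(X + 2*h*y - m)^2 \<ge> 3*L^2" using Z L by (simp add: power_mono)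
  ultimately show ?thesis unfolding mu_def by (simp add: algebra_simps)
qed

text \<open>The entries of the symmetric traceless matrix with rows \<open>(a, p, q)\<close>, \<open>(p, b, d)\<close>, \<open>(q, d, - a - b)\<close>;
  \<open>N\<close> is its squared norm and \<open>T\<close> the trace of its cube. In the proof, \<open>\<rho>\<close> is half the eigenvalue gap of the lower
  right block, so that Cauchy-Schwarz disposes of \<open>p\<close> and \<open>q\<close>.\<close>
lemma core_poly:
  fixes h a p q b d :: real
  assumes h: "h \<ge> 2/3"
  defines "N \<equiv> a^2 + 2*p^2 + 2*q^2 + b^2 + 2*d^2 + (a+b)^2"
  defines "T \<equiv> a^3 + b^3 - (a+b)^3 + 3*a*(p^2+q^2) + 3*b*(p^2+d^2) - 3*(a+b)*(q^2+d^2) + 6*p*q*d"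
  shows "108*h*N - 216*h*(a^2+p^2+q^2) + 3*(6*h*a + 6*N)^2 - 144*T \<ge> 0"
proof -
  define \<rho> where "\<rho> = sqrt ((b + a/2)^2 + d^2)"
  have r2: "\<rho>^2 = (b + a/2)^2 + d^2" unfolding \<rho>_def by simp
  have r0: "\<rho> \<ge> 0" unfolding \<rho>_def by simp
  \<comment> \<open>The left-hand side is the inner product of \<open>(p^2 - q^2, 2*p*q)\<close>, of
    length \<open>p^2 + q^2\<close>, with \<open>(b + a/2, d)\<close>, of length
    \<open>\<rho>\<close>.\<close>
  have cs: "(p^2 - q^2)*(b + a/2) + 2*p*q*d \<le> (p^2+q^2)*\<rho>"
  proof -
    have "((p^2 - q^2)*(b + a/2) + (2*p*q)*d)^2 \<le> ((p^2-q^2)^2 + (2*p*q)^2) * ((b + a/2)^2 + d^2)"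
    proof -
      have "((p^2-q^2)^2 + (2*p*q)^2) * ((b + a/2)^2 + d^2) - ((p^2 - q^2)*(b + a/2) + (2*p*q)*d)^2
         = ((p^2-q^2)*d - (2*p*q)*(b+a/2))^2" by (simp add: power2_eq_square algebra_simps)
      then show ?thesis by (smt (verit) zero_le_power2)
    qed
    also have "\<dots> = ((p^2+q^2)*\<rho>)^2" unfolding power_mult_distrib r2 by (simp add: power2_eq_square algebra_simps)
    finally show ?thesis using r0 by (smt (verit) abs_le_square_iff abs_of_nonneg mult_nonneg_nonneg zero_le_power2)
  qed
  \<comment> \<open>The lower right block has eigenvalues \<open>- a/2 + \<rho>\<close> and
    \<open>- a/2 - \<rho>\<close>; \<open>m\<close> is -6 times the smaller one.
    \<open>core_ineq\<close> is applied with \<open>y = 3*a\<close>, \<open>w = 6*\<rho>\<close> and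
    \<open>X = 6*N\<close>.\<close>
  define m where "m = 3*a + 6*\<rho>"
  have N: "N = 3/2*a^2 + 2*(p^2+q^2) + 2*\<rho>^2"
    unfolding N_def r2 by (simp add: power2_eq_square field_simps)
  have T: "T = 3/4*a^3 + 3/2*a*(p^2+q^2) + 3*((p^2 - q^2)*(b + a/2) + 2*p*q*d) - 3*a*\<rho>^2"
    unfolding T_def r2 by (simp add: power2_eq_square power3_eq_cube field_simps)
  have X: "6*N \<ge> (3*a)^2 + (6*\<rho>)^2/3"
  proof -
    have "6*N - ((3*a)^2 + (6*\<rho>)^2/3) = 12*(p^2+q^2)" unfolding N by (simp add: power2_eq_square field_simps)
    then show ?thesis by (smt (verit) zero_le_power2)
  qed
  have F: "3*(6*N + 2*h*(3*a) - m)^2 + m^2*(6*h - 3 + 2*m) \<ge> 0"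
    by (rule core_ineq[OF h _ X]) (simp add: m_def)
  have "108*h*N - 216*h*(a^2+p^2+q^2) + 3*(6*h*a + 6*N)^2 - 144*T
     - (3*(6*N + 2*h*(3*a) - m)^2 + m^2*(6*h - 3 + 2*m))
     = 432*((p^2+q^2)*\<rho> - ((p^2 - q^2)*(b + a/2) + 2*p*q*d))"
    unfolding N T m_def by (simp add: power2_eq_square power3_eq_cube algebra_simps)
  then show ?thesis by (rule nonneg_of_diff[OF _ F]) (use cs in simp)
qed

lemma sum3: "(\<Sum>i\<in>(UNIV::3 set). f i) = f 1 + f 2 + (f 3::'b::comm_monoid_add)"
  unfolding UNIV_3 by (simp add: add.assoc)

lemma transpose_eq_nth: "transpose V = V \<Longrightarrow> V $ i $ j = V $ j $ i"
  by (metis transpose_def vec_lambda_beta)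

lemma fnorm2_eq_trace: "transpose V = V \<Longrightarrow> fnorm2 V = trace (V ** V)"
  unfolding fnorm2_def trace_def matrix_matrix_mult_def
proof -
  assume "transpose V = V"
  then have "V $ i $ j = V $ j $ i" for i j by (rule transpose_eq_nth)
  then show "(\<Sum>i\<in>UNIV. \<Sum>j\<in>UNIV. (V $ i $ j)\<^sup>2) = (\<Sum>i\<in>UNIV. (\<chi> i j. \<Sum>k\<in>UNIV. V $ i $ k * V $ k $ j) $ i $ i)"
    by (simp add: power2_eq_square)
qed

text \<open>The scaling \<open>W = sqrt 6 * u\<close> removes the square roots: the squared norm
  becomes \<open>6 * N\<close>, the trace of the cube \<open>6 * sqrt 6 * T\<close>, and the claim
  turns into \<open>core_poly\<close>.\<close>

lemma axis_ineq:
  fixes h :: real and W :: "real^3^3"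
  assumes h: "h \<ge> 2/3" and W: "W \<in> S0"
  shows "18 * h * fnorm2 W - 36 * h * (norm (W *v axis 1 1))^2
    + 3 * (sqrt 6 * h * (W $ 1 $ 1) + fnorm2 W)^2 - 4 * sqrt 6 * trace (W ** W ** W) \<ge> 0"
proof -
  define s where "s = sqrt 6"
  have s: "s * s = 6" "s > 0" unfolding s_def by auto
  define u where "u i j = W $ i $ j / s" for i j
  have Wu: "W $ i $ j = s * u i j" for i j using s unfolding u_def by simp
  have "transpose W = W" "trace W = 0" using W unfolding S0_def by auto
  note W0 = this
  have sym: "W $ i $ j = W $ j $ i" for i j
    using W0(1) by (rule transpose_eq_nth)
  have tr: "W$1$1 + W$2$2 + W$3$3 = 0" using W0(2) by (simp add: trace_def sum3)
  have us: "u 2 1 = u 1 2" "u 3 1 = u 1 3" "u 3 2 = u 2 3" unfolding u_def using sym by auto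
  have u3: "u 3 3 = - u 1 1 - u 2 2" using tr s unfolding u_def by (simp add: field_simps)
  define N where "N = (u 1 1)^2 + 2 * (u 1 2)^2 + 2 * (u 1 3)^2 + (u 2 2)^2 + 2 * (u 2 3)^2 + (u 1 1 + u 2 2)^2"
  define T where "T = (u 1 1)^3 + (u 2 2)^3 - (u 1 1+u 2 2)^3 + 3 * u 1 1 * ((u 1 2)^2+(u 1 3)^2) + 3 * u 2 2 * ((u 1 2)^2+(u 2 3)^2) - 3 * (u 1 1+u 2 2) * ((u 1 3)^2+(u 2 3)^2) + 6 * u 1 2 * u 1 3 * u 2 3"
  have "108 * h * N - 216 * h * ((u 1 1)^2+(u 1 2)^2+(u 1 3)^2) + 3 * (6 * h * u 1 1 + 6 * N)^2 - 144 * T \<ge> 0"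
    unfolding N_def T_def by (rule core_poly[OF h])
  note main = this
  have fN: "fnorm2 W = 6 * N"
  proof -
    have "fnorm2 W = (s * s) * N" unfolding fnorm2_def sum3 Wu N_def us u3 by (simp add: power2_eq_square algebra_simps)
    then show ?thesis using s by simp
  qed
  have nn: "(norm (W *v axis 1 1))^2 = 6 * ((u 1 1)^2+(u 1 2)^2+(u 1 3)^2)"
  proof -
    have "(norm (W *v axis 1 1))^2 = (s * s) * ((u 1 1)^2+(u 1 2)^2+(u 1 3)^2)"
      unfolding power2_norm_eq_inner inner_vec_def matrix_vector_mult_def 
      by (simp add: sum3 axis_def Wu us power2_eq_square algebra_simps)
    then show ?thesis using s by simp
  qed
  have tt: "4 * sqrt 6 * trace (W ** W ** W) = 144 * T"
  proof -
    have "4 * sqrt 6 * trace (W ** W ** W) = 4 * (s * s) * (s * s) * T"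
      unfolding trace_def matrix_matrix_mult_def sum3 T_def
      by (simp add: sum3 Wu us u3 s_def[symmetric] power2_eq_square power3_eq_cube algebra_simps)
    then show ?thesis using s by simp
  qed
  have ww: "sqrt 6 * h * (W $ 1 $ 1) = 6 * h * u 1 1"
  proof -
    have "sqrt 6 * h * (W $ 1 $ 1) = (s * s) * h * u 1 1" unfolding Wu s_def by simp
    then show ?thesis using s by simp
  qed
  show ?thesis using main unfolding fN nn tt ww by (simp add: algebra_simps)
qed

text \<open>The left-hand side is the remainder that \<open>hplus t / 8\<close> multiplies in
  \<open>bulk_uniaxial_add\<close>. Each of its terms depends only on rotation invariants of the
  pair \<open>(V, n)\<close>.\<close>

lemma matrix_ineq:
  fixes h :: real and V :: "real^3^3"
  assumes h: "h \<ge> 2/3" and V: "V \<in> S0" and n: "norm n = 1"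
  shows "18 * h * fnorm2 V - 36 * h * (norm (V *v n))^2
    + 3 * (sqrt 6 * h * (n \<bullet> (V *v n)) + fnorm2 V)^2 - 4 * sqrt 6 * trace (V ** V ** V) \<ge> 0"
proof -
  obtain A :: "real^3^3" where A: "rotation_matrix A" and An: "A *v axis 1 1 = n"
    using rotation_matrix_exists_basis[of n 1] n by auto
  have o: "orthogonal_matrix A" using A rotation_matrix_def by auto
  then have o1: "transpose A ** A = mat 1" and o2: "A ** transpose A = mat 1"
    using orthogonal_matrix_def by auto
  have Vs: "transpose V = V" "trace V = 0" using V unfolding S0_def by auto
  define W where "W = transpose A ** V ** A"
  have red: "X ** A ** transpose A = X" for X :: "real^3^3"
    by (simp add: matrix_mul_assoc[symmetric] o2)
  have "transpose W = W" unfolding W_def by (simp add: matrix_transpose_mul Vs matrix_mul_assoc)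
  moreover have tr: "trace (transpose A ** X ** A) = trace X" for X
    by (subst trace_mul_sym) (simp add: matrix_mul_assoc o2)
  ultimately have WS: "W \<in> S0" unfolding S0_def W_def using Vs by simp
  have W2: "W ** W = transpose A ** (V ** V) ** A" unfolding W_def by (simp add: matrix_mul_assoc red)
  have W3: "W ** W ** W = transpose A ** (V ** V ** V) ** A" unfolding W2 unfolding W_def by (simp add: matrix_mul_assoc red)
  have f: "fnorm2 W = fnorm2 V" using fnorm2_eq_trace[OF Vs(1)] fnorm2_eq_trace[OF \<open>transpose W = W\<close>] W2 tr by simp
  have t3: "trace (W ** W ** W) = trace (V ** V ** V)" using W3 tr by simp
  have We: "W *v axis 1 1 = transpose A *v (V *v n)" unfolding W_def by (simp add: matrix_vector_mul_assoc[symmetric] An)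
  have "norm (transpose A *v y) = norm y" for y
  proof -
    have "(transpose A *v y) \<bullet> (transpose A *v y) = ((transpose A *v y) v* transpose A) \<bullet> y"
      by (rule dot_lmul_matrix[symmetric])
    also have "\<dots> = y \<bullet> y" unfolding vector_transpose_matrix by (simp only: matrix_vector_mul_assoc o2 matrix_vector_mul_lid)
    finally show ?thesis unfolding norm_eq_sqrt_inner by simp
  qed
  then have n1: "norm (W *v axis 1 1) = norm (V *v n)" using We by simp
  have "W $ 1 $ 1 = axis 1 1 \<bullet> (W *v axis 1 1)"
    by (simp add: matrix_vector_mult_def inner_vec_def sum3 axis_def)
  also have "\<dots> = (A *v axis 1 1) \<bullet> (V *v n)" unfolding We by (subst dot_lmul_matrix[symmetric]) (simp only: vector_transpose_matrix)
  finally have e: "W $ 1 $ 1 = n \<bullet> (V *v n)" unfolding An .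
  show ?thesis using axis_ineq[OF h WS] unfolding f t3 n1 e .
qed

section \<open>Test functions and weak gradients\<close>

text \<open>Test functions are only required to be continuously differentiable, so this square can
  serve as the building block of all cutoffs in place of an exponential bump.\<close>

lemma smooth_step_deriv: "((\<lambda>x::real. (max 0 x)^2) has_real_derivative 2 * max 0 x) (at x)"
proof -
  consider "x > 0" | "x < 0" | "x = 0" by linarith
  then show ?thesis
  proof cases
    case 1
    have "((\<lambda>x::real. x^2) has_real_derivative 2 * x) (at x)" by (auto intro!: derivative_eq_intros)
    then have "((\<lambda>x::real. (max 0 x)^2) has_real_derivative 2 * x) (at x)"
      by (rule has_field_derivative_transform_within_open[where S="{0<..}"]) (use 1 in auto)
    then show ?thesis using 1 by simp
  next
    case 2
    have "((\<lambda>x::real. 0) has_real_derivative 0) (at x)" by simp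
    then have "((\<lambda>x::real. (max 0 x)^2) has_real_derivative 0) (at x)"
      by (rule has_field_derivative_transform_within_open[where S="{..<0}"]) (use 2 in auto)
    then show ?thesis using 2 by simp
  next
    case 3
    have "((\<lambda>h. ((max 0 (0 + h))^2 - (max 0 0)^2) / h) \<longlongrightarrow> (0::real)) (at 0)"
    proof (rule Lim_null_comparison)
      show "((\<lambda>h::real. \<bar>h\<bar>) \<longlongrightarrow> 0) (at 0)" by (intro tendsto_rabs_zero tendsto_ident_at)
      show "\<forall>\<^sub>F h in at 0. norm (((max 0 (0 + h))^2 - (max 0 0)^2) / h) \<le> \<bar>h::real\<bar>"
        by (intro always_eventually allI) (auto simp: max_def power2_eq_square abs_if divide_simps)
    qed
    then show ?thesis using 3 by (simp add: DERIV_def)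
  qed
qed

text \<open>Off its support the function is zero on an open set, so one compact set serves both the
  function and its gradient.\<close>

lemma test_fn_grad_zero:
  assumes "test_fn U \<phi> g"
  obtains K where "compact K" "K \<subseteq> U" "\<And>x. x \<notin> K \<Longrightarrow> \<phi> x = 0" "\<And>x. x \<notin> K \<Longrightarrow> g x = 0"
proof -
  obtain K where K: "compact K" "K \<subseteq> U" "\<And>x. x \<notin> K \<Longrightarrow> \<phi> x = 0"
    and d: "\<And>x. (\<phi> has_derivative (\<lambda>v. g x \<bullet> v)) (at x)"
    using assms unfolding test_fn_def by auto
  have "g x = 0" if "x \<notin> K" for x
  proof -
    have "open (-K)" using K(1) compact_imp_closed by blast
    then have "((\<lambda>x. 0) has_derivative (\<lambda>v. g x \<bullet> v)) (at x)"
      by (rule has_derivative_transform_within_open[OF d]) (use that K(3) in auto)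
    then have "(\<lambda>v. g x \<bullet> v) = (\<lambda>v. 0)" by (rule has_derivative_unique) simp
    then have "g x \<bullet> g x = 0" by metis
    then show ?thesis by simp
  qed
  then show ?thesis using that K by blast
qed

lemma integrable_compact_support:
  fixes f :: "'a::euclidean_space \<Rightarrow> 'b::euclidean_space"
  assumes "continuous_on UNIV f" "compact K" "\<And>x. x \<notin> K \<Longrightarrow> f x = 0"
  shows "integrable lborel f"
proof -
  have "integrable lborel (\<lambda>x. indicator K x *\<^sub>R f x)"
    using borel_integrable_compact[OF assms(2)] continuous_on_subset[OF assms(1)] by (auto simp: set_integrable_def)
  moreover have "(\<lambda>x. indicator K x *\<^sub>R f x) = f" using assms(3) by (auto simp: indicator_def)
  ultimately show ?thesis by simp
qed

lemma continuous_on_zero_extension: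
  fixes f :: "'a::euclidean_space \<Rightarrow> 'b::real_normed_vector"
  assumes "continuous_on U f" "open U" "compact K" "K \<subseteq> U" "\<And>x. x \<notin> K \<Longrightarrow> f x = 0"
  shows "continuous_on UNIV f"
proof -
  have "continuous_on (-K) f" by (rule continuous_on_eq[of _ "\<lambda>x. 0"]) (use assms(5) in auto)
  then have "continuous_on (U \<union> -K) f"
    using assms by (intro continuous_on_open_Un) (auto simp: compact_imp_closed open_Compl)
  moreover have "U \<union> -K = UNIV" using assms by auto
  ultimately show ?thesis by simp
qed

lemma integral_lebesgue_on_support:
  fixes f :: "'a::euclidean_space \<Rightarrow> 'b::euclidean_space"
  assumes "f \<in> borel_measurable borel" "U \<in> sets lebesgue" "\<And>x. x \<notin> U \<Longrightarrow> f x = 0"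
  shows "integral\<^sup>L (lebesgue_on U) f = integral\<^sup>L lborel f"
    and "integrable (lebesgue_on U) f \<longleftrightarrow> integrable lborel f"
proof -
  have eq: "(\<lambda>x. indicator U x *\<^sub>R f x) = f" using assms(3) by (auto simp: indicator_def)
  show "integral\<^sup>L (lebesgue_on U) f = integral\<^sup>L lborel f"
    using assms(1,2) by (simp add: integral_restrict_space eq integral_completion)
  show "integrable (lebesgue_on U) f \<longleftrightarrow> integrable lborel f"
    using assms(1,2) by (simp add: integrable_restrict_space set_integrable_def eq integrable_completion)
qed

text \<open>Translation invariance makes the integral of every difference quotient vanish.\<close>
lemma integral_directional_derivative:
  fixes f D :: "'a::euclidean_space \<Rightarrow> real"
  assumes cf: "continuous_on UNIV f" and cD: "continuous_on UNIV D"
    and K: "compact K" "\<And>x. x \<notin> K \<Longrightarrow> f x = 0" "\<And>x. x \<notin> K \<Longrightarrow> D x = 0"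
    and der: "\<And>x. ((\<lambda>s. f (x + s *\<^sub>R e)) has_real_derivative D x) (at 0)"
  shows "integral\<^sup>L lborel D = 0"
proof -
  define h where "h n = 1 / real (Suc n)" for n
  have h: "0 < h n" "h n \<le> 1" for n unfolding h_def by (auto simp: field_simps)
  have h0: "h \<longlonglongrightarrow> 0" unfolding h_def using LIMSEQ_inverse_real_of_nat by (simp add: field_simps)
  define q where "q n x = (f (x + h n *\<^sub>R e) - f x) / h n" for n x
  have der': "((\<lambda>s. f (x + s *\<^sub>R e)) has_real_derivative D (x + s *\<^sub>R e)) (at s)" for x s
    using der[of "x + s *\<^sub>R e"] DERIV_shift[of "\<lambda>s. f (x + s *\<^sub>R e)" "D (x + s *\<^sub>R e)" 0 s]
    by (simp add: scaleR_add_left add.assoc add.commute add.left_commute)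
  have mf: "f \<in> borel_measurable borel" by (rule borel_measurable_continuous_onI[OF cf])
  have int_f: "integrable lborel f" by (rule integrable_compact_support[OF cf K(1,2)])
  \<comment> \<open>These are the points from which a step \<open>s *\<^sub>R e\<close> with
    \<open>0 \<le> s \<le> 1\<close> reaches \<open>K\<close>. Since \<open>h n \<le> 1\<close>,
    every difference quotient vanishes off this compact set, and the mean value theorem bounds it
    there: together they give the dominating function.\<close>
  define B where "B = (\<lambda>(x, s). x - s *\<^sub>R e) ` (K \<times> {0..1::real})"
  have cB: "compact B" unfolding B_def case_prod_unfold
    by (intro compact_continuous_image compact_Times K(1) compact_Icc continuous_intros)
  have KB: "K \<subseteq> B"
  proof
    fix x assume "x \<in> K" then show "x \<in> B" unfolding B_def by (intro image_eqI[of _ _ "(x,0)"]) auto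
  qed
  have DB: "D (x + s *\<^sub>R e) = 0" "f (x + s *\<^sub>R e) = 0" if "x \<notin> B" "0 \<le> s" "s \<le> 1" for x s
  proof -
    have "x + s *\<^sub>R e \<notin> K"
    proof
      assume "x + s *\<^sub>R e \<in> K" then have "x \<in> B" unfolding B_def using that by (intro image_eqI[of _ _ "(x + s *\<^sub>R e, s)"]) auto
      then show False using that by simp
    qed
    then show "D (x + s *\<^sub>R e) = 0" "f (x + s *\<^sub>R e) = 0" using K by auto
  qed
  obtain M where M: "\<And>x. \<bar>D x\<bar> \<le> M"
  proof -
    have "bounded (D ` K)" by (rule compact_imp_bounded[OF compact_continuous_image[OF continuous_on_subset[OF cD subset_UNIV] K(1)]])
    then obtain M where "\<forall>x\<in>K. \<bar>D x\<bar> \<le> M" unfolding bounded_iff by auto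
    then have "\<bar>D x\<bar> \<le> max M 0" for x using K(3)[of x] by (cases "x \<in> K") auto
    then show ?thesis using that by blast
  qed
  have qb: "norm (q n x) \<le> M * indicator B x" for n x
  proof (cases "x \<in> B")
    case True
    have "\<exists>z>0. z < h n \<and> f (x + h n *\<^sub>R e) - f (x + 0 *\<^sub>R e) = (h n - 0) * D (x + z *\<^sub>R e)"
      using h by (intro MVT2 der') auto
    then obtain z where "f (x + h n *\<^sub>R e) - f x = h n * D (x + z *\<^sub>R e)" by auto
    then have "q n x = D (x + z *\<^sub>R e)" unfolding q_def using h(1)[of n] by simp
    then show ?thesis using M True by simp
  next
    case False
    then have "q n x = 0" unfolding q_def using DB(2)[of x "h n"] DB(2)[of x 0] h(2)[of n] h(1)[of n] by simp
    then show ?thesis using False by simp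
  qed
  have q0: "integral\<^sup>L lborel (q n) = 0" for n
  proof -
    have i: "integrable lborel (\<lambda>x. f (x + h n *\<^sub>R e))"
      using int_f mf by (subst (asm) lborel_distr_plus[of "h n *\<^sub>R e", symmetric])
        (simp add: integrable_distr_eq add.commute)
    have "integral\<^sup>L lborel (\<lambda>x. f (x + h n *\<^sub>R e)) = integral\<^sup>L lborel f"
      using mf by (subst (2) lborel_distr_plus[of "h n *\<^sub>R e", symmetric])
        (simp add: integral_distr add.commute)
    then show ?thesis unfolding q_def using i int_f by simp
  qed
  have "(\<lambda>n. integral\<^sup>L lborel (q n)) \<longlonglongrightarrow> integral\<^sup>L lborel D"
  proof (rule integral_dominated_convergence)
    show "integrable lborel (\<lambda>x. M * indicator B x)"
      using emeasure_compact_finite[OF cB] cB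
      by (intro integrable_mult_right) (simp add: integrable_indicator_iff compact_imp_closed borel_closed)
    show "D \<in> borel_measurable lborel" using cD borel_measurable_continuous_onI by simp
    show "q n \<in> borel_measurable lborel" for n
      unfolding q_def using mf by measurable
    show "AE x in lborel. (\<lambda>n. q n x) \<longlonglongrightarrow> D x"
    proof (intro AE_I2)
      fix x
      have "((\<lambda>s. (f (x + (0 + s) *\<^sub>R e) - f (x + 0 *\<^sub>R e)) / s) \<longlongrightarrow> D x) (at 0)"
        using der[of x] unfolding DERIV_def by simp
      moreover have "filterlim h (at 0) sequentially"
        unfolding filterlim_at using h0 h(1) by (auto intro!: always_eventually simp: less_le)
      ultimately have "((\<lambda>n. (f (x + (0 + h n) *\<^sub>R e) - f (x + 0 *\<^sub>R e)) / h n) \<longlonglongrightarrow> D x)"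
        by (rule filterlim_compose)
      then show "(\<lambda>n. q n x) \<longlonglongrightarrow> D x" unfolding q_def by simp
    qed
    show "AE x in lborel. norm (q n x) \<le> M * indicator B x" for n using qb by simp
  qed
  then have "(\<lambda>n. 0) \<longlonglongrightarrow> integral\<^sup>L lborel D" unfolding q0 .
  then show ?thesis using LIMSEQ_unique tendsto_const by blast
qed

text \<open>This is \<open>test_fn\<close> without the support condition. Factors such as constants
  and coordinates have no compact support, so bumps are assembled here and their support is added at
  the end.\<close>

definition C1_fn :: "('a::euclidean_space \<Rightarrow> real) \<Rightarrow> ('a \<Rightarrow> 'a) \<Rightarrow> bool" where
  "C1_fn \<phi> g \<longleftrightarrow> (\<forall>x. (\<phi> has_derivative (\<lambda>v. g x \<bullet> v)) (at x)) \<and> continuous_on UNIV g"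

lemma test_fn_C1: "test_fn U \<phi> g \<longleftrightarrow> C1_fn \<phi> g \<and> (\<exists>K. compact K \<and> K \<subseteq> U \<and> (\<forall>x. x \<notin> K \<longrightarrow> \<phi> x = 0))"
  unfolding test_fn_def C1_fn_def by auto

lemma C1_fn_continuous: "C1_fn \<phi> g \<Longrightarrow> continuous_on UNIV \<phi>"
  unfolding C1_fn_def by (meson has_derivative_at_withinI has_derivative_continuous_on)

lemma C1_fn_const: "C1_fn (\<lambda>x. c) (\<lambda>x. 0)"
  unfolding C1_fn_def by (auto intro!: derivative_eq_intros)

lemma C1_fn_mult: "C1_fn \<phi> g \<Longrightarrow> C1_fn \<psi> k \<Longrightarrow> C1_fn (\<lambda>x. \<phi> x * \<psi> x) (\<lambda>x. \<phi> x *\<^sub>R k x + \<psi> x *\<^sub>R g x)"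
proof -
  assume 1: "C1_fn \<phi> g" and 2: "C1_fn \<psi> k"
  have "((\<lambda>x. \<phi> x * \<psi> x) has_derivative (\<lambda>v. (\<phi> x *\<^sub>R k x + \<psi> x *\<^sub>R g x) \<bullet> v)) (at x)" for x
    using has_derivative_mult[of \<phi> "\<lambda>v. g x \<bullet> v" x UNIV \<psi> "\<lambda>v. k x \<bullet> v"] 1 2
    unfolding C1_fn_def by (simp add: inner_add_left mult.commute)
  moreover have "continuous_on UNIV (\<lambda>x. \<phi> x *\<^sub>R k x + \<psi> x *\<^sub>R g x)"
    using 1 2 C1_fn_continuous unfolding C1_fn_def by (intro continuous_intros) auto
  ultimately show ?thesis unfolding C1_fn_def by blast
qed

lemma C1_fn_compose:
  assumes 1: "C1_fn \<phi> g" and F: "\<And>s. (F has_real_derivative F' s) (at s)" and c: "continuous_on UNIV F'"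
  shows "C1_fn (\<lambda>x. F (\<phi> x)) (\<lambda>x. F' (\<phi> x) *\<^sub>R g x)"
proof -
  have "((\<lambda>x. F (\<phi> x)) has_derivative (\<lambda>v. (F' (\<phi> x) *\<^sub>R g x) \<bullet> v)) (at x)" for x
    using has_derivative_compose[of \<phi> "\<lambda>v. g x \<bullet> v" x UNIV F "\<lambda>y. F' (\<phi> x) * y"] 1 F[of "\<phi> x"]
    unfolding C1_fn_def has_field_derivative_def by simp
  moreover have "continuous_on UNIV (\<lambda>x. F' (\<phi> x) *\<^sub>R g x)"
    using 1 C1_fn_continuous[OF 1] unfolding C1_fn_def
    by (intro continuous_intros continuous_on_compose2[OF c]) auto
  ultimately show ?thesis unfolding C1_fn_def by blast
qed

lemma C1_fn_prod:
  assumes "finite I" "\<And>i. i \<in> I \<Longrightarrow> \<exists>g. C1_fn (f i) g"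
  shows "\<exists>g. C1_fn (\<lambda>x. \<Prod>i\<in>I. f i x) g"
  using assms
proof (induction I rule: finite_induct)
  case empty then show ?case using C1_fn_const by auto
next
  case (insert i I)
  then obtain g k where "C1_fn (f i) g" "C1_fn (\<lambda>x. \<Prod>i\<in>I. f i x) k" by blast
  from C1_fn_mult[OF this] show ?case using insert by auto
qed

lemma C1_fn_affine: "C1_fn (\<lambda>x. x \<bullet> e - c) (\<lambda>x. e)" "C1_fn (\<lambda>x. c - x \<bullet> e) (\<lambda>x. - e)"
  unfolding C1_fn_def by (auto intro!: derivative_eq_intros simp: inner_commute)

lemma C1_fn_box:
  fixes a b :: "'a::euclidean_space"
  shows "\<exists>\<phi> g. C1_fn \<phi> g \<and> (\<forall>x. x \<in> box a b \<longrightarrow> \<phi> x \<noteq> 0) \<and> (\<forall>x. x \<notin> box a b \<longrightarrow> \<phi> x = 0)"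
proof -
  define s :: "real \<Rightarrow> real" where "s x = (max 0 x)^2" for x
  define \<phi> where "\<phi> x = (\<Prod>e\<in>Basis. s (x \<bullet> e - a \<bullet> e) * s (b \<bullet> e - x \<bullet> e))" for x
  have cm: "continuous_on UNIV (\<lambda>s::real. 2 * max 0 s)" by (intro continuous_intros)
  have "\<exists>g. C1_fn (\<lambda>x. s (x \<bullet> e - a \<bullet> e) * s (b \<bullet> e - x \<bullet> e)) g" for e
    using C1_fn_mult[OF C1_fn_compose[OF C1_fn_affine(1)[where e=e and c="a \<bullet> e"] smooth_step_deriv cm]
        C1_fn_compose[OF C1_fn_affine(2)[where e=e and c="b \<bullet> e"] smooth_step_deriv cm]]
    unfolding s_def by blast
  then have "\<exists>g. C1_fn \<phi> g" unfolding \<phi>_def by (intro C1_fn_prod) auto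
  moreover have "\<phi> x \<noteq> 0" if "x \<in> box a b" for x
    using that unfolding \<phi>_def s_def by (auto simp: mem_box max_def)
  moreover have "\<phi> x = 0" if "x \<notin> box a b" for x
    using that unfolding \<phi>_def s_def by (force simp: mem_box max_def)
  ultimately show ?thesis by blast
qed

lemma lebesgue_on_zero_extension:
  fixes f :: "'a::euclidean_space \<Rightarrow> real"
  assumes "open U" "continuous_on U f" "compact K" "K \<subseteq> U" "\<And>x. x \<in> U \<Longrightarrow> x \<notin> K \<Longrightarrow> f x = 0"
  shows "continuous_on UNIV (\<lambda>x. if x \<in> U then f x else 0)"
    and "integrable (lebesgue_on U) f"
    and "integral\<^sup>L (lebesgue_on U) f = integral\<^sup>L lborel (\<lambda>x. if x \<in> U then f x else 0)"
proof -
  let ?F = "\<lambda>x. if x \<in> U then f x else 0"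
  show c: "continuous_on UNIV ?F"
    using assms by (intro continuous_on_zero_extension[of U _ K] continuous_on_eq[OF assms(2)]) auto
  have m: "?F \<in> borel_measurable borel" by (rule borel_measurable_continuous_onI[OF c])
  have U: "U \<in> sets lebesgue" using assms(1) by auto
  have "integrable lborel ?F" using assms by (intro integrable_compact_support[OF c assms(3)]) auto
  then have "integrable (lebesgue_on U) ?F" using integral_lebesgue_on_support(2)[OF m U] by simp
  then show "integrable (lebesgue_on U) f" using Bochner_Integration.integrable_cong[of "lebesgue_on U" "lebesgue_on U" f ?F] by simp
  have "integral\<^sup>L (lebesgue_on U) f = integral\<^sup>L (lebesgue_on U) ?F"
    by (rule Bochner_Integration.integral_cong) auto
  then show "integral\<^sup>L (lebesgue_on U) f = integral\<^sup>L lborel ?F" using integral_lebesgue_on_support(1)[OF m U] by simp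
qed

lemma integrable_mult_test:
  fixes f :: "'a::euclidean_space \<Rightarrow> real"
  assumes "open U" "continuous_on U f" "test_fn U \<phi> g"
  shows "integrable (lebesgue_on U) (\<lambda>x. f x * \<phi> x)" "integrable (lebesgue_on U) (\<lambda>x. f x * (g x \<bullet> e))"
proof -
  obtain K where K: "compact K" "K \<subseteq> U" "\<And>x. x \<notin> K \<Longrightarrow> \<phi> x = 0" "\<And>x. x \<notin> K \<Longrightarrow> g x = 0"
    using test_fn_grad_zero[OF assms(3)] by blast
  have c: "continuous_on U \<phi>" "continuous_on U g"
    using assms(3) C1_fn_continuous continuous_on_subset unfolding test_fn_C1 C1_fn_def by blast+
  show "integrable (lebesgue_on U) (\<lambda>x. f x * \<phi> x)" "integrable (lebesgue_on U) (\<lambda>x. f x * (g x \<bullet> e))"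
    using K c assms by (auto intro!: lebesgue_on_zero_extension(2)[of U _ K] continuous_intros)
qed

lemma gradient_directional:
  assumes "(u has_derivative (\<lambda>v. G \<bullet> v)) (at x)"
  shows "((\<lambda>s. u (x + s *\<^sub>R e)) has_real_derivative G \<bullet> e) (at 0)"
proof -
  have "(u has_derivative (\<lambda>v. G \<bullet> v)) (at (x + 0 *\<^sub>R e))" using assms by simp
  moreover have "((\<lambda>s. x + s *\<^sub>R e) has_derivative (\<lambda>s. s *\<^sub>R e)) (at 0)" by (auto intro!: derivative_eq_intros)
  ultimately have "((\<lambda>s. u (x + s *\<^sub>R e)) has_derivative (\<lambda>s. G \<bullet> (s *\<^sub>R e))) (at 0)"
    by (rule has_derivative_compose[rotated])
  moreover have "(\<lambda>s. G \<bullet> (s *\<^sub>R e)) = (*) (G \<bullet> e)" by (auto simp: fun_eq_iff)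
  ultimately show ?thesis unfolding has_field_derivative_def by simp
qed

text \<open>The zero extension of \<open>f \<phi>\<close> is continuously differentiable along
  \<open>e\<close> on the whole space, so the integral of its directional derivative vanishes. The
  function \<open>f\<close> may be unbounded near the boundary of \<open>U\<close>, since only its
  values on the support of \<open>\<phi>\<close> matter.\<close>

lemma integration_by_parts_test_fn:
  fixes f :: "'a::euclidean_space \<Rightarrow> real"
  assumes U: "open U" and t: "test_fn U \<phi> g" and cf: "continuous_on U f" and cD: "continuous_on U D"
    and der: "\<And>x. x \<in> U \<Longrightarrow> ((\<lambda>s. f (x + s *\<^sub>R e)) has_real_derivative D x) (at 0)"
  shows "integral\<^sup>L (lebesgue_on U) (\<lambda>x. f x * (g x \<bullet> e)) = - integral\<^sup>L (lebesgue_on U) (\<lambda>x. D x * \<phi> x)"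
proof -
  obtain K where K: "compact K" "K \<subseteq> U" "\<And>x. x \<notin> K \<Longrightarrow> \<phi> x = 0" "\<And>x. x \<notin> K \<Longrightarrow> g x = 0"
    using test_fn_grad_zero[OF t] by blast
  have c: "continuous_on U \<phi>" "continuous_on U g"
    using t C1_fn_continuous continuous_on_subset unfolding test_fn_C1 C1_fn_def by blast+
  define F where "F x = (if x \<in> U then f x * \<phi> x else 0)" for x
  define E where "E x = (if x \<in> U then f x * (g x \<bullet> e) + D x * \<phi> x else 0)" for x
  have cF: "continuous_on UNIV F" unfolding F_def
    using K c U cf by (intro lebesgue_on_zero_extension(1)[of U _ K] continuous_intros) auto
  have cE: "continuous_on UNIV E" unfolding E_def
    using K c U cf cD by (intro lebesgue_on_zero_extension(1)[of U _ K] continuous_intros) auto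
  have dF: "((\<lambda>s. F (x + s *\<^sub>R e)) has_real_derivative E x) (at 0)" for x
  proof (cases "x \<in> U")
    case True
    have "((\<lambda>s. \<phi> (x + s *\<^sub>R e)) has_real_derivative (g x \<bullet> e)) (at 0)"
      using t unfolding test_fn_def by (intro gradient_directional) blast
    from DERIV_mult[OF der[OF True] this]
    have "((\<lambda>s. f (x + s *\<^sub>R e) * \<phi> (x + s *\<^sub>R e)) has_real_derivative E x) (at 0)"
      unfolding E_def using True by (simp add: algebra_simps)
    moreover have "open ((\<lambda>s. x + s *\<^sub>R e) -` U)" by (intro open_vimage U continuous_intros)
    ultimately show ?thesis
      by (rule has_field_derivative_transform_within_open) (use True in \<open>auto simp: F_def\<close>)
  next
    case False
    have oK: "open ((\<lambda>s. x + s *\<^sub>R e) -` (- K))" using K(1)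
      by (intro open_vimage continuous_intros) (simp add: compact_imp_closed open_Compl)
    have d0: "((\<lambda>s. 0) has_real_derivative E x) (at 0)" using False by (simp add: E_def)
    show ?thesis
      by (rule has_field_derivative_transform_within_open[OF d0 oK]) (use False K in \<open>auto simp: F_def\<close>)
  qed
  have "integral\<^sup>L lborel E = 0"
    by (rule integral_directional_derivative[OF cF cE K(1) _ _ dF]) (use K in \<open>auto simp: F_def E_def\<close>)
  moreover have "integral\<^sup>L lborel E = integral\<^sup>L (lebesgue_on U) (\<lambda>x. f x * (g x \<bullet> e) + D x * \<phi> x)"
    unfolding E_def using K c U cf cD by (intro lebesgue_on_zero_extension(3)[of U _ K, symmetric] continuous_intros) auto
  ultimately show ?thesis
    using integrable_mult_test[OF U cf t] integrable_mult_test[OF U cD t] by simp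
qed

section \<open>The fundamental lemma of the calculus of variations\<close>

text \<open>Indicators of open boxes are pointwise limits of the test functions
  \<open>n \<phi>\<^sup>2 / (1 + n \<phi>\<^sup>2)\<close>, where \<open>\<phi>\<close> is a product of one-dimensional quadratic splines.\<close>
lemma integral_box_eq_0:
  fixes f :: "'a::euclidean_space \<Rightarrow> real"
  assumes U: "open U" and ab: "cbox a b \<subseteq> U" and int: "integrable (lebesgue_on (cbox a b)) f"
    and t: "\<And>\<phi> g. test_fn U \<phi> g \<Longrightarrow> integral\<^sup>L (lebesgue_on U) (\<lambda>x. f x * \<phi> x) = 0"
  shows "integral\<^sup>L lebesgue (\<lambda>x. indicator (box a b) x * f x) = 0"
proof -
  obtain \<phi> g where \<phi>: "C1_fn \<phi> g" and p: "\<And>x. x \<in> box a b \<Longrightarrow> \<phi> x \<noteq> 0" and z: "\<And>x. x \<notin> box a b \<Longrightarrow> \<phi> x = 0"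
    using C1_fn_box[of a b] by blast
  define F where "F n s = real n * s^2 / (1 + real n * s^2)" for n and s :: real
  have nz: "1 + real n * s^2 \<noteq> 0" for n s by (smt (verit) mult_nonneg_nonneg of_nat_0_le_iff zero_le_power2)
  have F01: "\<bar>F n s\<bar> \<le> 1" for n s unfolding F_def by (auto simp: divide_le_eq_1 add_pos_nonneg)
  have dF: "(F n has_real_derivative (2 * real n * s / (1 + real n * s^2)^2)) (at s)" for n s
    unfolding F_def[abs_def] using nz[of n s]
    by (auto intro!: derivative_eq_intros simp: field_simps power2_eq_square)
  have cF: "continuous_on UNIV (\<lambda>s. 2 * real n * s / (1 + real n * s^2)^2)" for n
    using nz by (intro continuous_intros) auto
  have "test_fn U (\<lambda>x. F n (\<phi> x)) (\<lambda>x. (2 * real n * \<phi> x / (1 + real n * (\<phi> x)^2)^2) *\<^sub>R g x)" for n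
    unfolding test_fn_C1 using C1_fn_compose[OF \<phi> dF cF] ab z box_subset_cbox[of a b]
    by (intro conjI exI[of _ "cbox a b"]) (auto simp: F_def)
  from t[OF this] have t0: "integral\<^sup>L (lebesgue_on U) (\<lambda>x. f x * F n (\<phi> x)) = 0" for n .
  have eq: "integral\<^sup>L (lebesgue_on U) (\<lambda>x. f x * F n (\<phi> x)) = integral\<^sup>L (lebesgue_on (cbox a b)) (\<lambda>x. f x * F n (\<phi> x))" for n
  proof -
    have e: "indicator U x *\<^sub>R (f x * F n (\<phi> x)) = indicator (cbox a b) x *\<^sub>R (f x * F n (\<phi> x))" for x
      using subsetD[OF ab, of x] subsetD[OF box_subset_cbox[of a b], of x] z[of x]
      by (cases "x \<in> box a b") (auto simp: F_def)
    have r: "integral\<^sup>L (lebesgue_on A) (\<lambda>x. f x * F n (\<phi> x)) = integral\<^sup>L lebesgue (\<lambda>x. indicator A x *\<^sub>R (f x * F n (\<phi> x)))"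
      if "A \<in> sets lebesgue" for A using that by (intro integral_restrict_space) simp
    have "U \<in> sets lebesgue" "cbox a b \<in> sets lebesgue" using U by auto
    then show ?thesis by (simp only: r e)
  qed
  have "(\<lambda>n. integral\<^sup>L (lebesgue_on (cbox a b)) (\<lambda>x. f x * F n (\<phi> x))) \<longlonglongrightarrow>
     integral\<^sup>L (lebesgue_on (cbox a b)) (\<lambda>x. f x * indicator (box a b) x)"
  proof (rule integral_dominated_convergence[where w="\<lambda>x. norm (f x)"])
    have m: "(\<lambda>x. F n (\<phi> x)) \<in> borel_measurable (lebesgue_on (cbox a b))" for n
    proof -
      have c: "continuous_on UNIV (\<lambda>x. F n (\<phi> x))" using C1_fn_compose[OF \<phi> dF cF] C1_fn_continuous by blast
      show ?thesis
        by (rule continuous_imp_measurable_on_sets_lebesgue[OF continuous_on_subset[OF c subset_UNIV]]) simp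
    qed
    then show "(\<lambda>x. f x * F n (\<phi> x)) \<in> borel_measurable (lebesgue_on (cbox a b))" for n
      using int by (intro borel_measurable_times) auto
    show "(\<lambda>x. f x * indicator (box a b) x) \<in> borel_measurable (lebesgue_on (cbox a b))"
      using int by (intro borel_measurable_times) (auto intro!: borel_measurable_indicator simp: sets_restrict_space_iff subsetD[OF box_subset_cbox])
    show "integrable (lebesgue_on (cbox a b)) (\<lambda>x. norm (f x))" using int by simp
    show "AE x in lebesgue_on (cbox a b). norm (f x * F n (\<phi> x)) \<le> norm (f x)" for n
      by (intro AE_I2) (simp add: abs_mult mult_left_le F01)
    show "AE x in lebesgue_on (cbox a b). (\<lambda>n. f x * F n (\<phi> x)) \<longlonglongrightarrow> f x * indicator (box a b) x"
    proof (intro AE_I2 tendsto_intros)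
      fix x
      show "(\<lambda>n. F n (\<phi> x)) \<longlonglongrightarrow> indicator (box a b) x"
      proof (cases "x \<in> box a b")
        case True
        define q where "q = (\<phi> x)^2"
        have q: "q > 0" using p[OF True] unfolding q_def by simp
        have "(\<lambda>n. 1 - 1 / (1 + real n * q)) \<longlonglongrightarrow> 1 - 0"
          using q by (intro tendsto_intros tendsto_divide_0[OF tendsto_const] filterlim_at_top_imp_at_infinity
            filterlim_tendsto_add_at_top[OF tendsto_const] filterlim_at_top_mult_tendsto_pos[OF tendsto_const _ filterlim_real_sequentially])
        moreover have "1 - 1 / (1 + real n * q) = F n (\<phi> x)" for n
          unfolding F_def q_def[symmetric] using nz[of n "\<phi> x"] by (simp add: q_def field_simps)
        ultimately show ?thesis using True by simp
      qed (use z in \<open>simp add: F_def\<close>)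
    qed
  qed
  then have "integral\<^sup>L (lebesgue_on (cbox a b)) (\<lambda>x. f x * indicator (box a b) x) = 0"
    unfolding eq[symmetric] t0 using LIMSEQ_unique tendsto_const by blast
  moreover have "integral\<^sup>L (lebesgue_on (cbox a b)) (\<lambda>x. f x * indicator (box a b) x) = integral\<^sup>L lebesgue (\<lambda>x. indicator (box a b) x * f x)"
    using box_subset_cbox[of a b] by (subst integral_restrict_space) (auto intro!: Bochner_Integration.integral_cong simp: indicator_def)
  ultimately show ?thesis by simp
qed

text \<open>Boxes are stable under intersection and generate the Borel sets, and the sets over which
  the integral vanishes form a Dynkin system; the hypothesis on the whole space provides
  complements. The Borel representative \<open>g\<close> is needed because this induction reaches
  Borel sets only.\<close>

lemma AE_eq_0_if_box_integrals_0:
  fixes f :: "'a::euclidean_space \<Rightarrow> real"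
  assumes int: "integrable lebesgue f" and UN: "integral\<^sup>L lebesgue f = 0"
    and b: "\<And>a b. integral\<^sup>L lebesgue (\<lambda>x. indicator (box a b) x * f x) = 0"
  shows "AE x in lebesgue. f x = 0"
proof -
  obtain g where gm[measurable]: "g \<in> borel_measurable lborel" and fg: "AE x in lborel. f x = g x"
    using completion_ex_borel_measurable_real[of f lborel] int by auto
  have fg': "AE x in lebesgue. f x = g x" by (rule AE_completion[OF fg])
  have gl: "g \<in> borel_measurable lebesgue" using gm by (simp add: measurable_completion)
  have "integrable lebesgue g" using integrable_cong_AE[of f lebesgue g] int fg' gl by auto
  then have gi: "integrable lborel g" using integrable_completion[OF gm] by simp
  have e: "integral\<^sup>L lborel (\<lambda>x. indicator A x *\<^sub>R g x) = integral\<^sup>L lebesgue (\<lambda>x. indicator A x * f x)" if "A \<in> sets borel" for A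
  proof -
    have [measurable]: "A \<in> sets lborel" using that by simp
    have "(\<lambda>x. indicator A x *\<^sub>R g x) \<in> borel_measurable lborel" by measurable
    note integral_completion[OF this, symmetric]
    also have "integral\<^sup>L lebesgue (\<lambda>x. indicator A x *\<^sub>R g x) = integral\<^sup>L lebesgue (\<lambda>x. indicator A x * f x)"
      using fg' gl int that by (intro integral_cong_AE) (auto intro!: borel_measurable_times borel_measurable_indicator)
    finally show ?thesis .
  qed
  have "integral\<^sup>L lborel (\<lambda>x. indicator A x *\<^sub>R g x) = 0" if "A \<in> sets borel" for A
  proof -
    let ?E = "range (\<lambda>(a, b). box a b::'a set)"
    have "Int_stable ?E" by (auto simp: Int_stable_def box_Int_box)
    moreover have "?E \<subseteq> Pow UNIV" by simp
    moreover have "A \<in> sigma_sets UNIV ?E" using that unfolding borel_eq_box by simp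
    ultimately show ?thesis
    proof (induction rule: sigma_sets_induct_disjoint)
      case (basic A) then show ?case using e[of A] b by auto
    next
      case empty then show ?case by simp
    next
      case (compl A)
      have A: "A \<in> sets borel" using compl(1) unfolding borel_eq_box by simp
      have "integral\<^sup>L lborel (\<lambda>x. indicator (UNIV - A) x *\<^sub>R g x) = integral\<^sup>L lborel (\<lambda>x. indicator UNIV x *\<^sub>R g x - indicator A x *\<^sub>R g x)"
        by (intro Bochner_Integration.integral_cong) (auto simp: indicator_def)
      also have "\<dots> = integral\<^sup>L lborel (\<lambda>x. indicator UNIV x *\<^sub>R g x) - integral\<^sup>L lborel (\<lambda>x. indicator A x *\<^sub>R g x)"
        using A gi by (intro Bochner_Integration.integral_diff integrable_mult_indicator) auto
      also have "\<dots> = 0" using compl(2) e[of UNIV] UN by simp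
      finally show ?case .
    next
      case (union F)
      have F: "F i \<in> sets lborel" for i
      proof -
        have "F i \<in> sigma_sets UNIV ?E" using union(2) by blast
        then show ?thesis unfolding sets_lborel borel_eq_box by simp
      qed
      have "set_lebesgue_integral lborel (\<Union>i. F i) g = (\<Sum>i. set_lebesgue_integral lborel (F i) g)"
        using F union(1) gi unfolding disjoint_family_on_def
        by (intro lebesgue_integral_countable_add) (auto simp: set_integrable_def simp del: real_scaleR_def intro!: Bochner_Integration.integrable_mult_indicator)
      then show ?case unfolding set_lebesgue_integral_def using union(3) by simp
    qed
  qed
  then have g0: "AE x in lborel. g x = 0"
    using gi by (intro density_unique_real) (auto simp: set_lebesgue_integral_def)
  show ?thesis using AE_completion[OF g0] fg' by auto
qed

text \<open>\<open>U\<close> is a countable union of closed boxes, and on each of them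
  \<open>f\<close> is integrable. Restricted to one open box, \<open>f\<close> has zero integral
  over every other box, because the intersection of two boxes is again a box; the boundaries are
  null sets.\<close>

lemma fundamental_lemma_test_fn:
  fixes f :: "'a::euclidean_space \<Rightarrow> real"
  assumes U: "open U" and int: "\<And>K. compact K \<Longrightarrow> K \<subseteq> U \<Longrightarrow> integrable (lebesgue_on K) f"
    and t: "\<And>\<phi> g. test_fn U \<phi> g \<Longrightarrow> integral\<^sup>L (lebesgue_on U) (\<lambda>x. f x * \<phi> x) = 0"
  shows "AE x in lebesgue_on U. f x = 0"
proof -
  obtain \<D> where D: "countable \<D>" "\<And>X. X \<in> \<D> \<Longrightarrow> X \<subseteq> U" "\<And>X. X \<in> \<D> \<Longrightarrow> \<exists>a b. X = cbox a b" "\<Union>\<D> = U"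
    using open_countable_Union_open_cbox[OF U] by (metis Pow_iff subsetD)
  have "AE x in lebesgue. x \<in> X \<longrightarrow> f x = 0" if X: "X \<in> \<D>" for X
  proof -
    obtain a b where ab: "X = cbox a b" "cbox a b \<subseteq> U" using D X by blast
    have i: "integrable (lebesgue_on (cbox a b)) f" using int ab by auto
    have il: "integrable lebesgue (\<lambda>x. indicator (box a b) x * f x)"
    proof -
      have "integrable lebesgue (\<lambda>x. indicator (box a b) x *\<^sub>R (indicator (cbox a b) x *\<^sub>R f x))"
        using i by (intro Bochner_Integration.integrable_mult_indicator[of "box a b"]) (simp_all add: integrable_restrict_space)
      moreover have "indicator (box a b) x *\<^sub>R (indicator (cbox a b) x *\<^sub>R f x) = indicator (box a b) x * f x" for x
        using box_subset_cbox[of a b] by (auto simp: indicator_def)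
      ultimately show ?thesis by (simp only:)
    qed
    have "AE x in lebesgue. indicator (box a b) x * f x = 0"
    proof (rule AE_eq_0_if_box_integrals_0[OF il])
      show "integral\<^sup>L lebesgue (\<lambda>x. indicator (box a b) x * f x) = 0"
        by (rule integral_box_eq_0[OF U ab(2) i t])
      fix c d :: 'a
      obtain p q where pq: "box c d \<inter> box a b = box p q" using box_Int_box by blast
      show "integral\<^sup>L lebesgue (\<lambda>x. indicator (box c d) x * (indicator (box a b) x * f x)) = 0"
      proof (cases "box p q = {}")
        case True
        have e: "indicator (box c d) x * (indicator (box a b) x * f x) = 0" for x
          using True pq by (auto simp: indicator_def)
        show ?thesis unfolding e by simp
      next
        case False
        \<comment> \<open>\<open>integral_box_eq_0\<close> asks for the closed box to lie in
          \<open>U\<close>, so closures are taken. The closure of an open box is the closed box only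
          if the open box is nonempty, hence the case distinction.\<close>
        have s: "box p q \<subseteq> box a b" using pq by auto
        then have sub: "cbox p q \<subseteq> cbox a b"
          using False closure_mono[OF s] closure_box[of p q] closure_box[of a b] by (cases "box a b = {}") auto
        have "integrable (lebesgue_on (cbox p q)) f" using int sub ab by auto
        then have z: "integral\<^sup>L lebesgue (\<lambda>x. indicator (box p q) x * f x) = 0"
          using sub ab by (intro integral_box_eq_0[OF U _ _ t]) auto
        have e: "indicator (box c d) x * (indicator (box a b) x * f x) = indicator (box p q) x * f x" for x
          unfolding pq[symmetric] by (auto simp: indicator_def)
        show ?thesis unfolding e by (rule z)
      qed
    qed
    moreover have "AE x in lebesgue. x \<notin> cbox a b - box a b"
      using negligible_frontier_interval[of a b] unfolding negligible_iff_null_sets by (rule AE_not_in)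
    ultimately show ?thesis unfolding ab(1) by eventually_elim (auto simp: indicator_def)
  qed
  then have "AE x in lebesgue. \<forall>X\<in>\<D>. x \<in> X \<longrightarrow> f x = 0" unfolding AE_ball_countable[OF D(1)] by blast
  then have "AE x in lebesgue. x \<in> U \<longrightarrow> f x = 0" by eventually_elim (use D(4) in auto)
  then show ?thesis using U by (simp add: AE_restrict_space_iff)
qed

text \<open>By completeness of the measure, two functions equal almost everywhere are both
  measurable or both not; in the second case both integrals are 0 by convention. Hence no
  measurability has to be assumed.\<close>

lemma AE_eq_integral_lebesgue:
  fixes F G :: "'a::euclidean_space \<Rightarrow> real"
  assumes "AE x in lebesgue. F x = G x"
  shows "integral\<^sup>L lebesgue F = integral\<^sup>L lebesgue G" "integrable lebesgue F \<longleftrightarrow> integrable lebesgue G"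
proof -
  have sym: "AE x in lebesgue. G x = F x" using assms by eventually_elim simp
  have "integral\<^sup>L lebesgue F = integral\<^sup>L lebesgue G \<and> (integrable lebesgue F \<longleftrightarrow> integrable lebesgue G)"
  proof (cases "F \<in> borel_measurable lebesgue")
    case True
    then have "G \<in> borel_measurable lebesgue" using assms by (rule borel_measurable_AE)
    then show ?thesis using True assms integral_cong_AE integrable_cong_AE by blast
  next
    case False
    then have "G \<notin> borel_measurable lebesgue" using borel_measurable_AE sym by blast
    then have "\<not> integrable lebesgue F" "\<not> integrable lebesgue G" using False by auto
    then show ?thesis by (simp add: not_integrable_integral_eq)
  qed
  then show "integral\<^sup>L lebesgue F = integral\<^sup>L lebesgue G" "integrable lebesgue F \<longleftrightarrow> integrable lebesgue G" by auto
qed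

lemma AE_lebesgue_on_eq_integral:
  fixes f g :: "'a::euclidean_space \<Rightarrow> real"
  assumes S: "S \<in> sets lebesgue" and ae: "AE x in lebesgue_on S. f x = g x"
  shows "integral\<^sup>L (lebesgue_on S) f = integral\<^sup>L (lebesgue_on S) g"
    "integrable (lebesgue_on S) f \<longleftrightarrow> integrable (lebesgue_on S) g"
proof -
  have "AE x in lebesgue. x \<in> S \<longrightarrow> f x = g x" using ae S by (simp add: AE_restrict_space_iff)
  then have "AE x in lebesgue. indicator S x *\<^sub>R f x = indicator S x *\<^sub>R g x"
    by eventually_elim (auto simp: indicator_def)
  from AE_eq_integral_lebesgue[OF this] S
  show "integral\<^sup>L (lebesgue_on S) f = integral\<^sup>L (lebesgue_on S) g"
    "integrable (lebesgue_on S) f \<longleftrightarrow> integrable (lebesgue_on S) g"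
    by (simp_all add: integral_restrict_space integrable_restrict_space)
qed

text \<open>The energies are integrals over the closed shell and the closed interval, weak gradients
  live on the open ones; this lemma moves between the two.\<close>

lemma lebesgue_on_negligible_diff:
  fixes f :: "'a::euclidean_space \<Rightarrow> real"
  assumes S: "S \<in> sets lebesgue" "T \<in> sets lebesgue" "S \<subseteq> T" and N: "negligible (T - S)"
  shows "integral\<^sup>L (lebesgue_on T) f = integral\<^sup>L (lebesgue_on S) f"
    "integrable (lebesgue_on T) f \<longleftrightarrow> integrable (lebesgue_on S) f"
    "(AE x in lebesgue_on T. P x) \<longleftrightarrow> (AE x in lebesgue_on S. P x)"
proof -
  have N: "AE x in lebesgue. x \<notin> T - S" using N unfolding negligible_iff_null_sets by (rule AE_not_in)
  then have "AE x in lebesgue. indicator T x *\<^sub>R f x = indicator S x *\<^sub>R f x"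
    by eventually_elim (use S in \<open>auto simp: indicator_def\<close>)
  from AE_eq_integral_lebesgue[OF this] S
  show "integral\<^sup>L (lebesgue_on T) f = integral\<^sup>L (lebesgue_on S) f"
    "integrable (lebesgue_on T) f \<longleftrightarrow> integrable (lebesgue_on S) f"
    by (simp_all add: integral_restrict_space integrable_restrict_space)
  have "AE x in lebesgue. (x \<in> T \<longrightarrow> P x) \<longleftrightarrow> (x \<in> S \<longrightarrow> P x)"
    using N by eventually_elim (use S in auto)
  then have "(AE x in lebesgue. x \<in> T \<longrightarrow> P x) \<longleftrightarrow> (AE x in lebesgue. x \<in> S \<longrightarrow> P x)" by (rule eventually_subst)
  then show "(AE x in lebesgue_on T. P x) \<longleftrightarrow> (AE x in lebesgue_on S. P x)"
    using S by (simp add: AE_restrict_space_iff)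
qed

lemma integrable_mult_bounded:
  fixes f g :: "'a \<Rightarrow> real"
  assumes f: "integrable M f" and g: "g \<in> borel_measurable M" and B: "AE x in M. \<bar>g x\<bar> \<le> B"
  shows "integrable M (\<lambda>x. f x * g x)" "integrable M (\<lambda>x. g x * f x)"
proof -
  show "integrable M (\<lambda>x. f x * g x)"
  proof (rule Bochner_Integration.integrable_bound)
    show "integrable M (\<lambda>x. B * f x)" using f by simp
    show "(\<lambda>x. f x * g x) \<in> borel_measurable M" using f g by (intro borel_measurable_times) auto
    show "AE x in M. norm (f x * g x) \<le> norm (B * f x)"
    proof (use B in eventually_elim)
      fix x assume "\<bar>g x\<bar> \<le> B"
      then have "\<bar>f x\<bar> * \<bar>g x\<bar> \<le> \<bar>f x\<bar> * \<bar>B\<bar>" by (intro mult_left_mono) auto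
      then show "norm (f x * g x) \<le> norm (B * f x)" by (simp add: abs_mult mult.commute)
    qed
  qed
  then show "integrable M (\<lambda>x. g x * f x)" by (simp add: mult.commute)
qed

lemma integrable_mult_L2:
  fixes f g :: "'a \<Rightarrow> real"
  assumes "f \<in> borel_measurable M" "g \<in> borel_measurable M" "integrable M (\<lambda>x. (f x)\<^sup>2)" "integrable M (\<lambda>x. (g x)\<^sup>2)"
  shows "integrable M (\<lambda>x. f x * g x)"
proof (rule Bochner_Integration.integrable_bound)
  show "integrable M (\<lambda>x. (f x)\<^sup>2 + (g x)\<^sup>2)" using assms by simp
  show "(\<lambda>x. f x * g x) \<in> borel_measurable M" using assms by simp
  have "\<bar>a * b\<bar> \<le> a\<^sup>2 + b\<^sup>2" for a b :: real
  proof -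
    have "2 * (\<bar>a\<bar> * \<bar>b\<bar>) \<le> a\<^sup>2 + b\<^sup>2" using zero_le_power2[of "\<bar>a\<bar> - \<bar>b\<bar>"] unfolding power2_diff by simp
    moreover have "0 \<le> \<bar>a\<bar> * \<bar>b\<bar>" by simp
    ultimately show ?thesis unfolding abs_mult by linarith
  qed
  then show "AE x in M. norm (f x * g x) \<le> norm ((f x)\<^sup>2 + (g x)\<^sup>2)" by simp
qed

lemma integrable_continuous_compact:
  fixes f :: "'a::euclidean_space \<Rightarrow> 'b::euclidean_space"
  assumes "compact K" "continuous_on K f" shows "integrable (lebesgue_on K) f"
proof -
  have "integrable lborel (\<lambda>x. indicator K x *\<^sub>R f x)"
    using borel_integrable_compact[OF assms] by (simp add: set_integrable_def)
  then have "integrable lebesgue (\<lambda>x. indicator K x *\<^sub>R f x)"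
    using integrable_completion borel_measurable_integrable by blast
  then show ?thesis using assms by (simp add: integrable_restrict_space lmeasurable_compact fmeasurableD)
qed

section \<open>Calculus of weak gradients\<close>

lemma weak_grad_C1:
  fixes u :: "'a::euclidean_space \<Rightarrow> real"
  assumes U: "open U" and d: "\<And>x. x \<in> U \<Longrightarrow> (u has_derivative (\<lambda>v. G x \<bullet> v)) (at x)" and cG: "continuous_on U G"
  shows "weak_grad U u G"
proof -
  have cu: "continuous_on U u"
    using d by (meson differentiableI differentiable_imp_continuous_within continuous_at_imp_continuous_on)
  have "integrable (lebesgue_on K) u" "integrable (lebesgue_on K) G" if "compact K" "K \<subseteq> U" for K
    using that cu cG by (auto intro: integrable_continuous_compact continuous_on_subset)
  moreover have "integral\<^sup>L (lebesgue_on U) (\<lambda>x. u x * (g x \<bullet> e)) = - integral\<^sup>L (lebesgue_on U) (\<lambda>x. (G x \<bullet> e) * \<phi> x)"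
    if "test_fn U \<phi> g" for \<phi> g and e :: 'a
  proof (rule integration_by_parts_test_fn[OF U that cu])
    show "continuous_on U (\<lambda>x. G x \<bullet> e)" by (intro continuous_intros cG)
    show "((\<lambda>s. u (x + s *\<^sub>R e)) has_real_derivative G x \<bullet> e) (at 0)" if "x \<in> U" for x
      by (rule gradient_directional[OF d[OF that]])
  qed
  ultimately show ?thesis unfolding weak_grad_def by blast
qed

lemma weak_grad_integrable:
  fixes u :: "'a::euclidean_space \<Rightarrow> real"
  assumes U: "open U" and w: "weak_grad U u G" and t: "test_fn U \<phi> g"
  shows "integrable (lebesgue_on U) (\<lambda>x. u x * (g x \<bullet> e))" "integrable (lebesgue_on U) (\<lambda>x. (G x \<bullet> e) * \<phi> x)"
proof -
  obtain K where K: "compact K" "K \<subseteq> U" "\<And>x. x \<notin> K \<Longrightarrow> \<phi> x = 0" "\<And>x. x \<notin> K \<Longrightarrow> g x = 0"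
    using test_fn_grad_zero[OF t] by blast
  have i: "integrable (lebesgue_on K) u" "integrable (lebesgue_on K) (\<lambda>x. G x \<bullet> e)"
    using w K unfolding weak_grad_def by auto
  have Ks: "K \<in> sets lebesgue" using K by (simp add: lmeasurable_compact fmeasurableD)
  have *: "integrable (lebesgue_on U) (\<lambda>x. f x * \<psi> x)"
    if f: "integrable (lebesgue_on K) f" and c: "continuous_on UNIV \<psi>" and z: "\<And>x. x \<notin> K \<Longrightarrow> \<psi> x = 0" for f \<psi> :: "'a \<Rightarrow> real"
  proof -
    have "bounded (\<psi> ` K)" by (rule compact_imp_bounded[OF compact_continuous_image[OF continuous_on_subset[OF c subset_UNIV] K(1)]])
    then obtain B where B: "\<And>x. x \<in> K \<Longrightarrow> \<bar>\<psi> x\<bar> \<le> B" unfolding bounded_iff by auto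
    have "\<psi> \<in> borel_measurable (lebesgue_on K)"
      by (rule continuous_imp_measurable_on_sets_lebesgue[OF continuous_on_subset[OF c subset_UNIV] Ks])
    from integrable_mult_bounded(1)[OF f this, of B] have "integrable (lebesgue_on K) (\<lambda>x. f x * \<psi> x)"
      using B by (simp add: AE_restrict_space_iff Ks)
    then have 1: "integrable lebesgue (\<lambda>x. indicator K x *\<^sub>R (f x * \<psi> x))" using Ks by (simp add: integrable_restrict_space)
    have "indicator K x *\<^sub>R (f x * \<psi> x) = indicator U x *\<^sub>R (f x * \<psi> x)" for x
      using z[of x] subsetD[OF K(2), of x] by (cases "x \<in> K") auto
    with 1 have "integrable lebesgue (\<lambda>x. indicator U x *\<^sub>R (f x * \<psi> x))" by (simp only:)
    then show ?thesis using U by (subst integrable_restrict_space) auto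
  qed
  have c: "continuous_on UNIV \<phi>" "continuous_on UNIV (\<lambda>x. g x \<bullet> e)"
    using t C1_fn_continuous unfolding test_fn_C1 C1_fn_def by (auto intro!: continuous_intros)
  show "integrable (lebesgue_on U) (\<lambda>x. u x * (g x \<bullet> e))" "integrable (lebesgue_on U) (\<lambda>x. (G x \<bullet> e) * \<phi> x)"
    using *[OF i(1) c(2)] *[OF i(2) c(1)] K by auto
qed

lemma weak_grad_add_scale:
  fixes u v :: "'a::euclidean_space \<Rightarrow> real"
  assumes U: "open U" and u: "weak_grad U u G" and v: "weak_grad U v H"
  shows "weak_grad U (\<lambda>x. u x + c * v x) (\<lambda>x. G x + c *\<^sub>R H x)"
proof -
  have "integral\<^sup>L (lebesgue_on U) (\<lambda>x. (u x + c * v x) * (g x \<bullet> e)) = - integral\<^sup>L (lebesgue_on U) (\<lambda>x. ((G x + c *\<^sub>R H x) \<bullet> e) * \<phi> x)"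
    if t: "test_fn U \<phi> g" and e: "e \<in> Basis" for \<phi> g e
  proof -
    note i = weak_grad_integrable[OF U u t, of e] weak_grad_integrable[OF U v t, of e]
    have "integral\<^sup>L (lebesgue_on U) (\<lambda>x. (u x + c * v x) * (g x \<bullet> e)) = integral\<^sup>L (lebesgue_on U) (\<lambda>x. u x * (g x \<bullet> e) + c * (v x * (g x \<bullet> e)))"
      by (rule Bochner_Integration.integral_cong) (simp_all add: distrib_right)
    also have "\<dots> = integral\<^sup>L (lebesgue_on U) (\<lambda>x. u x * (g x \<bullet> e)) + c * integral\<^sup>L (lebesgue_on U) (\<lambda>x. v x * (g x \<bullet> e))"
      using i by simp
    also have "\<dots> = - (integral\<^sup>L (lebesgue_on U) (\<lambda>x. (G x \<bullet> e) * \<phi> x) + c * integral\<^sup>L (lebesgue_on U) (\<lambda>x. (H x \<bullet> e) * \<phi> x))"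
      using u v t e unfolding weak_grad_def by simp
    also have "\<dots> = - integral\<^sup>L (lebesgue_on U) (\<lambda>x. (G x \<bullet> e) * \<phi> x + c * ((H x \<bullet> e) * \<phi> x))"
      using i by simp
    also have "\<dots> = - integral\<^sup>L (lebesgue_on U) (\<lambda>x. ((G x + c *\<^sub>R H x) \<bullet> e) * \<phi> x)"
      by (intro arg_cong[where f=uminus] Bochner_Integration.integral_cong) (simp_all add: inner_add_left distrib_right)
    finally show ?thesis .
  qed
  then show ?thesis using u v unfolding weak_grad_def by auto
qed

text \<open>\<open>W0\<close> asserts the existence of a gradient of its own; uniqueness identifies
  it with the gradient that a competitor carries explicitly.\<close>

lemma weak_grad_unique:
  fixes u :: "'a::euclidean_space \<Rightarrow> real"
  assumes U: "open U" and u: "weak_grad U u G" and v: "weak_grad U u H"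
  shows "AE x in lebesgue_on U. G x = H x"
proof -
  have "AE x in lebesgue_on U. (G x - H x) \<bullet> e = 0" if e: "e \<in> Basis" for e
  proof (rule fundamental_lemma_test_fn[OF U])
    fix K assume "compact K" "K \<subseteq> U"
    then show "integrable (lebesgue_on K) (\<lambda>x. (G x - H x) \<bullet> e)" using u v unfolding weak_grad_def by auto
  next
    fix \<phi> g assume t: "test_fn U \<phi> g"
    have "integral\<^sup>L (lebesgue_on U) (\<lambda>x. (G x \<bullet> e) * \<phi> x) = integral\<^sup>L (lebesgue_on U) (\<lambda>x. (H x \<bullet> e) * \<phi> x)"
    proof -
      have "integral\<^sup>L (lebesgue_on U) (\<lambda>x. u x * (g x \<bullet> e)) = - integral\<^sup>L (lebesgue_on U) (\<lambda>x. (G x \<bullet> e) * \<phi> x)"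
        using u t e unfolding weak_grad_def by blast
      moreover have "integral\<^sup>L (lebesgue_on U) (\<lambda>x. u x * (g x \<bullet> e)) = - integral\<^sup>L (lebesgue_on U) (\<lambda>x. (H x \<bullet> e) * \<phi> x)"
        using v t e unfolding weak_grad_def by blast
      ultimately show ?thesis by simp
    qed
    then show "integral\<^sup>L (lebesgue_on U) (\<lambda>x. (G x - H x) \<bullet> e * \<phi> x) = 0"
      using weak_grad_integrable(2)[OF U u t, of e] weak_grad_integrable(2)[OF U v t, of e]
      by (simp add: inner_diff_left left_diff_distrib)
  qed
  then have "AE x in lebesgue_on U. \<forall>e\<in>Basis. (G x - H x) \<bullet> e = 0"
    by (intro AE_finite_allI) auto
  then show ?thesis by eventually_elim (simp add: euclidean_eq_iff[of _ "_::'a"] inner_diff_left)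
qed

section \<open>Cutoffs and integration by parts on an interval\<close>

lemma C1_fn_real: "C1_fn f f' \<longleftrightarrow> (\<forall>x. (f has_real_derivative f' x) (at x)) \<and> continuous_on UNIV f'"
proof -
  have "(\<lambda>v. f' x \<bullet> v) = (*) (f' x)" for x :: real by (auto simp: fun_eq_iff)
  then show ?thesis unfolding C1_fn_def has_field_derivative_def by simp
qed

lemma continuous_antiderivative_real:
  fixes f :: "real \<Rightarrow> real" assumes "continuous_on UNIV f"
  obtains F where "\<And>x. (F has_real_derivative f x) (at x)"
proof -
  have "\<exists>F. \<forall>x :: real. -\<infinity> < ereal x \<longrightarrow> ereal x < \<infinity> \<longrightarrow> (F has_vector_derivative f x) (at x)"
    by (rule einterval_antiderivative) (use assms in \<open>auto simp: continuous_on_eq_continuous_at\<close>)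
  then show ?thesis using that by (auto simp: has_real_derivative_iff_has_vector_derivative)
qed

text \<open>A continuously differentiable step from 0 to 1 with the hat function \<open>tent\<close>
  as derivative. The rise takes place between 1 and 3 and not from 0 on: the part where it is still
  0 keeps the support of \<open>cutoff\<close> compactly inside the open interval.\<close>

definition spline :: "real \<Rightarrow> real" where
  "spline y = ((max 0 (y-1))\<^sup>2 - 2 * (max 0 (y-2))\<^sup>2 + (max 0 (y-3))\<^sup>2) / 2"

definition tent :: "real \<Rightarrow> real" where
  "tent y = max 0 (y-1) - 2 * max 0 (y-2) + max 0 (y-3)"

lemma spline_deriv: "(spline has_real_derivative tent y) (at y)"
proof -
  have *: "((\<lambda>x. (max 0 (x-c))\<^sup>2) has_real_derivative 2 * max 0 (y-c)) (at y)" for c :: real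
  proof -
    have "((\<lambda>x. x - c) has_real_derivative 1) (at y)" by (auto intro!: derivative_eq_intros)
    from DERIV_chain2[OF smooth_step_deriv this] show ?thesis by simp
  qed
  show ?thesis unfolding spline_def[abs_def] tent_def
    by (rule DERIV_cong[OF DERIV_cdivide[OF DERIV_add[OF DERIV_diff[OF * DERIV_cmult[OF *]] *]]]) simp
qed

lemma tent_bounds: "0 \<le> tent y" "tent y \<le> 1" "y \<le> 1 \<Longrightarrow> tent y = 0" "y \<ge> 3 \<Longrightarrow> tent y = 0"
  unfolding tent_def by (auto simp: max_def)

lemma spline_bounds: "0 \<le> spline y" "spline y \<le> 1" "y \<le> 1 \<Longrightarrow> spline y = 0" "y \<ge> 3 \<Longrightarrow> spline y = 1"
proof -
  consider "y \<le> 1" | "1 < y" "y \<le> 2" | "2 < y" "y \<le> 3" | "3 < y" by linarith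
  then have "0 \<le> spline y \<and> spline y \<le> 1"
  proof cases
    case 2
    have "(y-1)\<^sup>2 \<le> 1" using 2 by (simp add: power_le_one)
    then show ?thesis using 2 by (simp add: spline_def max_def)
  next
    case 3
    have "(3-y)\<^sup>2 \<le> 1" using 3 by (simp add: power_le_one)
    moreover have "spline y = 1 - (3-y)\<^sup>2 / 2" using 3 by (simp add: spline_def max_def power2_eq_square field_simps)
    ultimately show ?thesis using zero_le_power2[of "3-y"] by linarith
  next
    case 4 then have "spline y = 1" by (simp add: spline_def max_def power2_eq_square field_simps)
    then show ?thesis by simp
  qed (simp add: spline_def max_def)
  then show "0 \<le> spline y" "spline y \<le> 1" by auto
  show "y \<le> 1 \<Longrightarrow> spline y = 0" by (simp add: spline_def max_def)
  show "y \<ge> 3 \<Longrightarrow> spline y = 1" by (simp add: spline_def max_def power2_eq_square field_simps)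
qed

lemma continuous_on_tent: "continuous_on UNIV tent"
  unfolding tent_def[abs_def] by (intro continuous_intros)

lemma continuous_on_spline: "continuous_on UNIV spline"
  unfolding spline_def[abs_def] by (intro continuous_intros) auto

definition cutoff :: "real \<Rightarrow> real \<Rightarrow> nat \<Rightarrow> real \<Rightarrow> real" where
  "cutoff a b n x = spline (real n * (x - a)) * spline (real n * (b - x))"

definition cutoff' :: "real \<Rightarrow> real \<Rightarrow> nat \<Rightarrow> real \<Rightarrow> real" where
  "cutoff' a b n x = real n * (tent (real n * (x - a)) * spline (real n * (b - x)) - spline (real n * (x - a)) * tent (real n * (b - x)))"

lemma cutoff_C1: "C1_fn (cutoff a b n) (cutoff' a b n)"
proof -
  have 1: "((\<lambda>x. spline (real n * (x - a))) has_real_derivative real n * tent (real n * (x - a))) (at x)" for x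
    by (rule DERIV_cong[OF DERIV_chain2[OF spline_deriv, where g="\<lambda>x. real n * (x - a)" and Db="real n"]])
      (auto intro!: derivative_eq_intros)
  have 2: "((\<lambda>x. spline (real n * (b - x))) has_real_derivative - (real n * tent (real n * (b - x)))) (at x)" for x
    by (rule DERIV_cong[OF DERIV_chain2[OF spline_deriv, where g="\<lambda>x. real n * (b - x)" and Db="- real n"]])
      (auto intro!: derivative_eq_intros)
  have "(cutoff a b n has_real_derivative cutoff' a b n x) (at x)" for x
    unfolding cutoff_def[abs_def] cutoff'_def
    by (rule DERIV_cong[OF DERIV_mult[OF 1 2]]) (simp add: algebra_simps)
  moreover have "continuous_on UNIV (cutoff' a b n)"
    unfolding cutoff'_def[abs_def]
    by (intro continuous_intros continuous_on_compose2[OF continuous_on_tent] continuous_on_compose2[OF continuous_on_spline]) auto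
  ultimately show ?thesis unfolding C1_fn_real by auto
qed

lemma cutoff_bounds: "0 \<le> cutoff a b n x" "cutoff a b n x \<le> 1"
  unfolding cutoff_def using spline_bounds by (auto intro: mult_le_one)

lemma cutoff_support:
  assumes "n > 0" "x \<notin> {a + 1 / real n .. b - 1 / real n}" shows "cutoff a b n x = 0"
proof -
  have "real n * (x - a) \<le> 1 \<or> real n * (b - x) \<le> 1"
    using assms by (auto simp: field_simps not_le)
  then show ?thesis unfolding cutoff_def using spline_bounds(3) by auto
qed

lemma cutoff'_bound:
  assumes "n > 0" "a < x" "x < b"
  shows "\<bar>cutoff' a b n x\<bar> \<le> real n * (indicator {a..a + 3 / real n} x + indicator {b - 3 / real n..b} x)"
proof -
  have 1: "\<bar>tent (real n * (x - a)) * spline (real n * (b - x))\<bar> \<le> indicator {a..a + 3 / real n} x"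
  proof (cases "x \<le> a + 3 / real n")
    case True then show ?thesis using assms tent_bounds(1,2) spline_bounds(1,2) by (auto simp: abs_mult intro: mult_le_one)
  next
    case False then have "real n * (x - a) \<ge> 3" using assms by (simp add: field_simps)
    then show ?thesis using tent_bounds(4) by simp
  qed
  have 2: "\<bar>spline (real n * (x - a)) * tent (real n * (b - x))\<bar> \<le> indicator {b - 3 / real n..b} x"
  proof (cases "b - 3 / real n \<le> x")
    case True then show ?thesis using assms tent_bounds(1,2) spline_bounds(1,2) by (auto simp: abs_mult intro: mult_le_one)
  next
    case False then have "real n * (b - x) \<ge> 3" using assms by (simp add: field_simps)
    then show ?thesis using tent_bounds(4) by simp
  qed
  show ?thesis unfolding cutoff'_def abs_mult using 1 2 by (intro mult_mono) auto
qed

lemma cutoff_tendsto: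
  assumes "a < x" "x < b" shows "(\<lambda>n. cutoff a b n x) \<longlonglongrightarrow> 1"
proof -
  obtain N where N: "real N > 3 / (x - a)" "real N > 3 / (b - x)"
    using reals_Archimedean2[of "max (3 / (x - a)) (3 / (b - x))"] by auto
  have "\<forall>\<^sub>F n in sequentially. cutoff a b n x = 1"
  proof (rule eventually_sequentiallyI[of N])
    fix n assume "N \<le> n"
    then have "real n > 3 / (x - a)" "real n > 3 / (b - x)" using N by linarith+
    then have "real n * (x - a) \<ge> 3" "real n * (b - x) \<ge> 3" using assms by (simp_all add: field_simps)
    then show "cutoff a b n x = 1" unfolding cutoff_def using spline_bounds(4) by simp
  qed
  then show ?thesis by (rule tendsto_eventually)
qed

lemma integrable_continuous_interval:
  fixes f :: "real \<Rightarrow> real" assumes "continuous_on {a..b} f" shows "integrable (lebesgue_on {a<..<b}) f"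
proof -
  have "negligible ({a..b} - {a<..<b})"
    by (rule negligible_subset[of "{a,b}"]) auto
  moreover have "{a<..<b} \<subseteq> {a..b}" by auto
  ultimately show ?thesis using continuous_imp_integrable_real[OF assms] lebesgue_on_negligible_diff(2)[of "{a<..<b}" "{a..b}" f] by simp
qed

text \<open>The derivative of the cutoff is of size \<open>n\<close> on two layers of width
  \<open>3 / n\<close>, so its total mass stays bounded, while \<open>w\<close> tends to 0 on these
  layers.\<close>

lemma integral_cutoff'_tendsto_0:
  assumes ab: "a < b" and cw: "continuous_on {a..b} w" and w: "w a = 0" "w b = (0::real)"
  shows "(\<lambda>n. integral\<^sup>L (lebesgue_on {a<..<b}) (\<lambda>x. w x * cutoff' a b n x)) \<longlonglongrightarrow> 0"
proof (rule LIMSEQ_I)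
  let ?M = "lebesgue_on {a<..<b}"
  fix r :: real assume r: "0 < r"
  \<comment> \<open>The final bound is \<open>6 * e\<close>: each of the two layers contributes
    \<open>n * (3 / n)\<close>.\<close>
  define e where "e = r / 7"
  have e: "e > 0" using r e_def by simp
  obtain d1 where d1: "d1 > 0" "\<And>x. x \<in> {a..b} \<Longrightarrow> dist x a < d1 \<Longrightarrow> dist (w x) (w a) < e"
    using cw ab e unfolding continuous_on_iff by (metis atLeastAtMost_iff less_eq_real_def order_refl)
  obtain d2 where d2: "d2 > 0" "\<And>x. x \<in> {a..b} \<Longrightarrow> dist x b < d2 \<Longrightarrow> dist (w x) (w b) < e"
    using cw ab e unfolding continuous_on_iff by (metis atLeastAtMost_iff less_eq_real_def order_refl)
  obtain N where N: "real N > 3 / d1" "real N > 3 / d2"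
    using reals_Archimedean2[of "max (3 / d1) (3 / d2)"] by auto
  have N0: "real N > 0" using N(1) d1(1) by (smt (verit) divide_pos_pos)
  have "norm (integral\<^sup>L ?M (\<lambda>x. w x * cutoff' a b n x) - 0) < r" if "n \<ge> N" for n
  proof -
    have n0: "n > 0" using N0 that by simp
    have n: "3 / real n < d1" "3 / real n < d2"
    proof -
      have "real n > 3 / d1" "real n > 3 / d2" using N that by linarith+
      then show "3 / real n < d1" "3 / real n < d2" using d1(1) d2(1) n0 by (simp_all add: field_simps)
    qed
    let ?I = "\<lambda>x. indicat_real {a..a + 3 / real n} x + indicat_real {b - 3 / real n..b} x"
    have bd: "norm (w x * cutoff' a b n x) \<le> e * (real n * ?I x)" if x: "x \<in> {a<..<b}" for x
    proof (cases "?I x = 0")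
      case True
      then have "\<bar>cutoff' a b n x\<bar> \<le> 0" using cutoff'_bound[OF n0, of a x b] x by simp
      then show ?thesis using True by simp
    next
      case False
      then consider "x \<in> {a..a + 3 / real n}" | "x \<in> {b - 3 / real n..b}" by (metis add.right_neutral indicator_simps(2))
      then have "\<bar>w x\<bar> \<le> e"
      proof cases
        case 1
        then have "dist x a < d1" using n by (auto simp: dist_real_def)
        then show ?thesis using d1(2)[of x] x w by (auto simp: dist_real_def)
      next
        case 2
        then have "dist x b < d2" using n by (auto simp: dist_real_def)
        then show ?thesis using d2(2)[of x] x w by (auto simp: dist_real_def)
      qed
      then show ?thesis using cutoff'_bound[OF n0, of a x b] x e unfolding real_norm_def abs_mult by (intro mult_mono) auto
    qed
    have ii: "integrable ?M (indicat_real {c..d})" "integral\<^sup>L ?M (indicat_real {c..d}) \<le> d - c" if "c \<le> d" for c d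
    proof -
      have s: "{c..d} \<inter> {a<..<b} \<in> sets lebesgue" by auto
      have eq: "integral\<^sup>L ?M (indicat_real {c..d}) = measure lebesgue ({c..d} \<inter> {a<..<b})"
        by (simp add: measure_restrict_space)
      have lm: "{c..d} \<inter> {a<..<b} \<in> lmeasurable" "{c..d} \<in> lmeasurable"
        by (auto intro: fmeasurable_Int_fmeasurable)
      have "measure lebesgue ({c..d} \<inter> {a<..<b}) \<le> measure lebesgue {c..d}"
        using lm by (intro measure_mono_fmeasurable) auto
      also have "\<dots> = d - c" using that by simp
      finally show "integral\<^sup>L ?M (indicat_real {c..d}) \<le> d - c" using eq by simp
      show "integrable ?M (indicat_real {c..d})"
        using lm(1) by (auto simp: integrable_indicator_iff emeasure_restrict_space fmeasurable_def sets_restrict_space_iff)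
    qed
    have "integrable ?M (\<lambda>x. w x * cutoff' a b n x)"
      using cutoff_C1 unfolding C1_fn_real
      by (intro integrable_continuous_interval continuous_intros cw) (meson continuous_on_subset subset_UNIV)
    then have "norm (integral\<^sup>L ?M (\<lambda>x. w x * cutoff' a b n x)) \<le> integral\<^sup>L ?M (\<lambda>x. e * (real n * ?I x))"
      using ii bd by (intro Bochner_Integration.integral_norm_bound_integral) auto
    also have "\<dots> = e * (real n * (integral\<^sup>L ?M (indicat_real {a..a + 3 / real n}) + integral\<^sup>L ?M (indicat_real {b - 3 / real n..b})))"
      using ii by simp
    also have "\<dots> \<le> e * (real n * (3 / real n + 3 / real n))"
      using ii(2)[of a "a + 3 / real n"] ii(2)[of "b - 3 / real n" b] e n0 by (intro mult_left_mono add_mono) auto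
    also have "\<dots> = 6 * e" using n0 by simp
    also have "\<dots> < r" using e unfolding e_def by simp
    finally show ?thesis by simp
  qed
  then show "\<exists>no. \<forall>n\<ge>no. norm (integral\<^sup>L ?M (\<lambda>x. w x * cutoff' a b n x) - 0) < r" by blast
qed

text \<open>Here the boundary values of \<open>u\<close> vanish and not those of
  \<open>\<phi>\<close>, which is arbitrary at the endpoints. The test function is
  \<open>\<phi>\<close> times a cutoff, and the term with the derivative of the cutoff disappears in
  the limit.\<close>

lemma weak_grad_integration_by_parts:
  fixes u u' :: "real \<Rightarrow> real"
  assumes ab: "a < b" and cu: "continuous_on {a..b} u" and u0: "u a = 0" "u b = 0"
    and wg: "weak_grad {a<..<b} u u'" and iu: "integrable (lebesgue_on {a<..<b}) u'"
    and d: "\<And>x. (\<phi> has_real_derivative \<phi>' x) (at x)" and c: "continuous_on UNIV \<phi>'"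
  shows "integral\<^sup>L (lebesgue_on {a<..<b}) (\<lambda>x. u x * \<phi>' x) = - integral\<^sup>L (lebesgue_on {a<..<b}) (\<lambda>x. u' x * \<phi> x)"
proof -
  let ?M = "lebesgue_on {a<..<b}"
  have C: "C1_fn \<phi> \<phi>'" using d c unfolding C1_fn_real by auto
  have c\<phi>: "continuous_on S \<phi>" "continuous_on S \<phi>'" for S
    using C1_fn_continuous[OF C] c continuous_on_subset by blast+
  have ck: "continuous_on S (cutoff a b n)" "continuous_on S (cutoff' a b n)" for n S
    using cutoff_C1[of a b n] C1_fn_continuous[OF cutoff_C1] continuous_on_subset unfolding C1_fn_def by blast+
  have meas: "f \<in> borel_measurable ?M" if "continuous_on UNIV f" for f :: "real \<Rightarrow> real"
    by (rule continuous_imp_measurable_on_sets_lebesgue[OF continuous_on_subset[OF that subset_UNIV]]) simp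
  obtain B where B: "\<And>x. x \<in> {a..b} \<Longrightarrow> \<bar>\<phi> x\<bar> \<le> B"
    using compact_imp_bounded[OF compact_continuous_image[OF c\<phi>(1) compact_Icc[of a b]]] unfolding bounded_iff by force
  have i\<phi>: "integrable ?M (\<lambda>x. u' x * \<phi> x)"
    by (rule integrable_mult_bounded(1)[OF iu meas[OF c\<phi>(1)], of B]) (use B in \<open>simp add: AE_restrict_space_iff\<close>)
  have t: "test_fn {a<..<b} (\<lambda>x. \<phi> x * cutoff a b n x) (\<lambda>x. \<phi> x * cutoff' a b n x + cutoff a b n x * \<phi>' x)" if "n > 0" for n
  proof -
    have "0 < 1 / real n" using that by simp
    then have "{a + 1 / real n .. b - 1 / real n} \<subseteq> {a<..<b}" by (auto simp del: zero_less_divide_1_iff)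
    then show ?thesis unfolding test_fn_C1 using C1_fn_mult[OF C cutoff_C1[of a b n]] cutoff_support[OF that]
      by (intro conjI exI[of _ "{a + 1 / real n .. b - 1 / real n}"]) auto
  qed
  have eq: "integral\<^sup>L ?M (\<lambda>x. (u x * \<phi> x) * cutoff' a b n x) + integral\<^sup>L ?M (\<lambda>x. (u x * \<phi>' x) * cutoff a b n x)
     = - integral\<^sup>L ?M (\<lambda>x. (u' x * \<phi> x) * cutoff a b n x)" if "n > 0" for n
  proof -
    have "integral\<^sup>L ?M (\<lambda>x. u x * ((\<phi> x * cutoff' a b n x + cutoff a b n x * \<phi>' x) \<bullet> 1)) = - integral\<^sup>L ?M (\<lambda>x. (u' x \<bullet> 1) * (\<phi> x * cutoff a b n x))"
    proof -
      have "(1::real) \<in> Basis" by simp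
      then show ?thesis using wg t[OF that] unfolding weak_grad_def by blast
    qed
    moreover have "integrable ?M (\<lambda>x. (u x * \<phi> x) * cutoff' a b n x)" "integrable ?M (\<lambda>x. (u x * \<phi>' x) * cutoff a b n x)"
      by (intro integrable_continuous_interval continuous_intros cu c\<phi> ck)+
    ultimately show ?thesis by (simp add: algebra_simps)
  qed
  have conv: "(\<lambda>n. integral\<^sup>L ?M (\<lambda>x. f x * cutoff a b n x)) \<longlonglongrightarrow> integral\<^sup>L ?M f" if f: "integrable ?M f" for f
  proof (rule integral_dominated_convergence[where w="\<lambda>x. \<bar>f x\<bar>"])
    show "(\<lambda>x. f x * cutoff a b n x) \<in> borel_measurable ?M" for n
      using f meas[OF ck(1)] by (intro borel_measurable_times) auto
    show "AE x in ?M. (\<lambda>n. f x * cutoff a b n x) \<longlonglongrightarrow> f x"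
      using cutoff_tendsto tendsto_mult[OF tendsto_const cutoff_tendsto] by (intro AE_I2) fastforce
    show "AE x in ?M. norm (f x * cutoff a b n x) \<le> \<bar>f x\<bar>" for n
      using cutoff_bounds[of a b n] by (intro AE_I2) (simp add: abs_mult mult_left_le)
  qed (use f in auto)
  have 1: "(\<lambda>n. integral\<^sup>L ?M (\<lambda>x. (u x * \<phi> x) * cutoff' a b n x)) \<longlonglongrightarrow> 0"
    using u0 by (intro integral_cutoff'_tendsto_0 ab continuous_intros cu c\<phi>) auto
  have 2: "(\<lambda>n. integral\<^sup>L ?M (\<lambda>x. (u x * \<phi>' x) * cutoff a b n x)) \<longlonglongrightarrow> integral\<^sup>L ?M (\<lambda>x. u x * \<phi>' x)"
    by (intro conv integrable_continuous_interval continuous_intros cu c\<phi>)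
  have 3: "(\<lambda>n. - integral\<^sup>L ?M (\<lambda>x. (u' x * \<phi> x) * cutoff a b n x)) \<longlonglongrightarrow> - integral\<^sup>L ?M (\<lambda>x. u' x * \<phi> x)"
    by (intro tendsto_minus conv i\<phi>)
  have "(\<lambda>n. integral\<^sup>L ?M (\<lambda>x. (u x * \<phi> x) * cutoff' a b n x) + integral\<^sup>L ?M (\<lambda>x. (u x * \<phi>' x) * cutoff a b n x))
    \<longlonglongrightarrow> - integral\<^sup>L ?M (\<lambda>x. u' x * \<phi> x)"
    by (rule Lim_transform_eventually[OF 3]) (use eq in \<open>auto intro!: eventually_sequentiallyI[of 1]\<close>)
  moreover have "(\<lambda>n. integral\<^sup>L ?M (\<lambda>x. (u x * \<phi> x) * cutoff' a b n x) + integral\<^sup>L ?M (\<lambda>x. (u x * \<phi>' x) * cutoff a b n x))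
    \<longlonglongrightarrow> 0 + integral\<^sup>L ?M (\<lambda>x. u x * \<phi>' x)" by (intro tendsto_add 1 2)
  ultimately show ?thesis using LIMSEQ_unique by fastforce
qed

section \<open>The one-dimensional minimizer\<close>

text \<open>\<open>s * bulk_coeff t s\<close> is the derivative of the bulk potential of the
  one-dimensional energy at \<open>s\<close>. The coefficient \<open>c\<close> of the overview is
  \<open>bulk_coeff t (h r)\<close>.\<close>

definition bulk_coeff :: "real \<Rightarrow> real \<Rightarrow> real" where
  "bulk_coeff t s = - (t/2) * (1 - s\<^sup>2) + 3 * hplus t / 2 * (s\<^sup>2 - s)"

definition Eh_density :: "real \<Rightarrow> (real \<Rightarrow> real) \<Rightarrow> (real \<Rightarrow> real) \<Rightarrow> real \<Rightarrow> real" where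
  "Eh_density t h h' r = r\<^sup>2 / 2 * (h' r)\<^sup>2 + 3 * (h r)\<^sup>2
      + r\<^sup>2 * (t / 8 * (1 - (h r)\<^sup>2)\<^sup>2 + hplus t / 8 * (1 + 3 * (h r)^4 - 4 * (h r)^3))"

lemma negligible_interval_diff: "negligible ({a..b} - {a<..<b::real})"
  by (rule negligible_subset[of "{a,b}"]) auto

lemma Eh_eq: "Eh R t h h' = integral\<^sup>L (lebesgue_on {1<..<R}) (Eh_density t h h')"
proof -
  have "{1<..<R} \<subseteq> {1..R}" by auto
  then show ?thesis unfolding Eh_def Eh_density_def
    by (intro lebesgue_on_negligible_diff(1) negligible_interval_diff) auto
qed

lemma continuous_measurable_interval:
  fixes f :: "real \<Rightarrow> real" assumes "continuous_on {a..b} f" shows "f \<in> borel_measurable (lebesgue_on {a<..<b})"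
  using integrable_continuous_interval[OF assms] by auto

lemma integrable_div_r2:
  fixes f :: "real \<Rightarrow> real"
  assumes "integrable (lebesgue_on {1<..<R}) (\<lambda>r. r\<^sup>2 * f r)"
  shows "integrable (lebesgue_on {1<..<R}) f"
proof -
  have c: "continuous_on {1..R} (\<lambda>r. 1 / r\<^sup>2)" by (intro continuous_intros) auto
  have "integrable (lebesgue_on {1<..<R}) (\<lambda>r. (r\<^sup>2 * f r) * (1 / r\<^sup>2))"
    by (rule integrable_mult_bounded(1)[OF assms continuous_measurable_interval[OF c], of 1])
      (auto simp: AE_restrict_space_iff divide_le_eq_1)
  moreover have "integrable (lebesgue_on {1<..<R}) (\<lambda>r. (r\<^sup>2 * f r) * (1 / r\<^sup>2)) = integrable (lebesgue_on {1<..<R}) f"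
    by (rule Bochner_Integration.integrable_cong) auto
  ultimately show ?thesis by simp
qed

lemma integrable_r2_mult:
  fixes f :: "real \<Rightarrow> real"
  assumes "integrable (lebesgue_on {1<..<R}) f"
  shows "integrable (lebesgue_on {1<..<R}) (\<lambda>r. r\<^sup>2 * f r)"
proof -
  have c: "continuous_on {1..R} (\<lambda>r. r\<^sup>2)" by (intro continuous_intros)
  show ?thesis
    by (rule integrable_mult_bounded(2)[OF assms continuous_measurable_interval[OF c], of "R\<^sup>2"])
      (auto simp: AE_restrict_space_iff power_mono)
qed

section \<open>First variation and regularity of the minimizer\<close>

lemma Ah_C1:
  assumes R: "1 < R" and c: "continuous_on {1..R} g" "continuous_on {1..R} g'"
    and d: "\<And>r. 1 < r \<Longrightarrow> r < R \<Longrightarrow> (g has_real_derivative g' r) (at r)" and b: "g 1 = 1" "g R = 1"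
  shows "Ah R g g'"
proof -
  have "weak_grad {1<..<R} g g'"
  proof (rule weak_grad_C1)
    show "continuous_on {1<..<R} g'" by (rule continuous_on_subset[OF c(2)]) auto
    have "(\<bullet>) (g' r) = (*) (g' r)" for r by (simp add: fun_eq_iff)
    then show "\<And>x. x \<in> {1<..<R} \<Longrightarrow> (g has_derivative (\<bullet>) (g' x)) (at x)"
      using d unfolding has_field_derivative_def by auto
  qed simp
  moreover have "integrable (lebesgue_on {1<..<R}) (\<lambda>x. (g x)\<^sup>2)" "integrable (lebesgue_on {1<..<R}) (\<lambda>r. r\<^sup>2 * (g' r)\<^sup>2)"
    by (intro integrable_continuous_interval continuous_intros c)+
  ultimately show ?thesis unfolding Ah_def L2_def using c b continuous_measurable_interval by auto
qed

text \<open>Along a line \<open>h + e * w\<close> the one-dimensional energy is a quartic polynomial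
  in \<open>e\<close>, so the first variation needs no differentiation under the integral
  sign.\<close>

lemma polynomial_local_min:
  fixes a1 a2 a3 a4 :: real
  assumes "\<And>e. 0 \<le> e * a1 + e^2 * a2 + e^3 * a3 + e^4 * a4"
  shows "a1 = 0"
proof -
  let ?p = "\<lambda>e. e * a1 + e^2 * a2 + e^3 * a3 + e^4 * a4"
  have "(?p has_real_derivative a1) (at 0)" by (auto intro!: derivative_eq_intros)
  then show ?thesis by (rule DERIV_local_min[of _ _ _ 1]) (use assms in auto)
qed

text \<open>The variation \<open>w\<close> may be any continuous function with square integrable
  weak derivative and zero boundary values, not only a smooth one. This generality lets the
  difference between a comparison function and \<open>h\<close> itself be inserted.\<close>

lemma first_variation:
  assumes R: "1 < R" and h: "Ah R h h'" and min: "\<And>g g'. Ah R g g' \<Longrightarrow> Eh R t h h' \<le> Eh R t g g'"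
    and cw: "continuous_on {1..R} w" and w0: "w 1 = 0" "w R = 0" and wg: "weak_grad {1<..<R} w w'"
    and mw: "w' \<in> borel_measurable (lebesgue_on {1<..<R})" and iw: "integrable (lebesgue_on {1<..<R}) (\<lambda>r. (w' r)\<^sup>2)"
  shows "integral\<^sup>L (lebesgue_on {1<..<R}) (\<lambda>r. r\<^sup>2 * (h' r * w' r)) + integral\<^sup>L (lebesgue_on {1<..<R}) (\<lambda>r. (6 * h r + r\<^sup>2 * (h r * bulk_coeff t (h r))) * w r) = 0"
    and "integrable (lebesgue_on {1<..<R}) (\<lambda>r. r\<^sup>2 * (h' r * w' r))"
proof -
  let ?M = "lebesgue_on {1<..<R}"
  have ch: "continuous_on {1..R} h" and mh: "h' \<in> borel_measurable ?M" and ih: "integrable ?M (\<lambda>r. r\<^sup>2 * (h' r)\<^sup>2)"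
    and wh: "weak_grad {1<..<R} h h'" and hb: "h 1 = 1" "h R = 1"
    using h unfolding Ah_def by auto
  have ih2: "integrable ?M (\<lambda>r. (h' r)\<^sup>2)" by (rule integrable_div_r2[OF ih])
  have ihw: "integrable ?M (\<lambda>r. h' r * w' r)" by (rule integrable_mult_L2[OF mh mw ih2 iw])
  show irhw: "integrable ?M (\<lambda>r. r\<^sup>2 * (h' r * w' r))" by (rule integrable_r2_mult[OF ihw])
  have irw: "integrable ?M (\<lambda>r. r\<^sup>2 * (w' r)\<^sup>2)" by (rule integrable_r2_mult[OF iw])
  define T H where "T = t / 8" and "H = hplus t / 8"
  define P1 where "P1 r = (6 * h r + r\<^sup>2 * (h r * bulk_coeff t (h r))) * w r" for r
  define P0 where "P0 r = 3 * (h r)\<^sup>2 + r\<^sup>2 * (T * (1 - (h r)\<^sup>2)\<^sup>2 + H * (1 + 3 * (h r)^4 - 4 * (h r)^3))" for r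
  define P2 where "P2 r = 3 * (w r)\<^sup>2 + r\<^sup>2 * (T * (4 * (h r)\<^sup>2 * (w r)\<^sup>2 - 2 * (1 - (h r)\<^sup>2) * (w r)\<^sup>2) + H * (18 * (h r)\<^sup>2 * (w r)\<^sup>2 - 12 * h r * (w r)\<^sup>2))" for r
  define P3 where "P3 r = r\<^sup>2 * (T * (4 * h r * (w r)^3) + H * (12 * h r * (w r)^3 - 4 * (w r)^3))" for r
  define P4 where "P4 r = r\<^sup>2 * (T * (w r)^4 + H * (3 * (w r)^4))" for r
  have iP: "integrable ?M P0" "integrable ?M P1" "integrable ?M P2" "integrable ?M P3" "integrable ?M P4"
    unfolding P0_def P1_def P2_def P3_def P4_def bulk_coeff_def
    by (intro integrable_continuous_interval continuous_intros ch cw; simp)+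
  have coeff: "bulk_coeff t s = - 4 * T * (1 - s\<^sup>2) + 12 * H * (s\<^sup>2 - s)" for s
    unfolding bulk_coeff_def T_def H_def by simp
  have expand: "Eh_density t (\<lambda>r. h r + e * w r) (\<lambda>r. h' r + e * w' r) r
    = (r\<^sup>2 * (h' r)\<^sup>2 / 2 + P0 r) + e * (r\<^sup>2 * (h' r * w' r) + P1 r) + e^2 * (r\<^sup>2 * (w' r)\<^sup>2 / 2 + P2 r) + e^3 * P3 r + e^4 * P4 r" for e r
    unfolding Eh_density_def P0_def P1_def P2_def P3_def P4_def T_def[symmetric] H_def[symmetric] coeff
    by (simp add: power2_eq_square power3_eq_cube power4_eq_xxxx algebra_simps)
  define a0 where "a0 = integral\<^sup>L ?M (\<lambda>r. r\<^sup>2 * (h' r)\<^sup>2 / 2 + P0 r)"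
  define a1 where "a1 = integral\<^sup>L ?M (\<lambda>r. r\<^sup>2 * (h' r * w' r) + P1 r)"
  define a2 where "a2 = integral\<^sup>L ?M (\<lambda>r. r\<^sup>2 * (w' r)\<^sup>2 / 2 + P2 r)"
  have E: "Eh R t (\<lambda>r. h r + e * w r) (\<lambda>r. h' r + e * w' r) = a0 + e * a1 + e^2 * a2 + e^3 * integral\<^sup>L ?M P3 + e^4 * integral\<^sup>L ?M P4" for e
    unfolding Eh_eq expand a0_def a1_def a2_def using ih irhw irw iP by simp
  have "Ah R (\<lambda>r. h r + e * w r) (\<lambda>r. h' r + e * w' r)" for e
    unfolding Ah_def L2_def
  proof (intro conjI)
    show c: "continuous_on {1..R} (\<lambda>r. h r + e * w r)" by (intro continuous_intros ch cw)
    show "(\<lambda>r. h r + e * w r) \<in> borel_measurable ?M" by (rule continuous_measurable_interval[OF c])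
    show "integrable ?M (\<lambda>r. (h r + e * w r)\<^sup>2)" by (intro integrable_continuous_interval continuous_intros ch cw)
    show "weak_grad {1<..<R} (\<lambda>r. h r + e * w r) (\<lambda>r. h' r + e * w' r)"
      using weak_grad_add_scale[OF _ wh wg, of e] by simp
    show "(\<lambda>r. h' r + e * w' r) \<in> borel_measurable ?M" using mh mw by simp
    have "r\<^sup>2 * (h' r + e * w' r)\<^sup>2 = r\<^sup>2 * (h' r)\<^sup>2 + 2 * e * (r\<^sup>2 * (h' r * w' r)) + e^2 * (r\<^sup>2 * (w' r)\<^sup>2)" for r
      by (simp add: power2_eq_square algebra_simps)
    then show "integrable ?M (\<lambda>r. r\<^sup>2 * (h' r + e * w' r)\<^sup>2)" using ih irhw irw by simp
  qed (use hb w0 in auto)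
  note adm = this
  have E0: "Eh R t h h' = a0" using E[of 0] by simp
  have "0 \<le> e * a1 + e^2 * a2 + e^3 * integral\<^sup>L ?M P3 + e^4 * integral\<^sup>L ?M P4"
    for e
  proof -
    have "a0 \<le> a0 + e * a1 + e^2 * a2 + e^3 * integral\<^sup>L ?M P3 + e^4 * integral\<^sup>L ?M P4"
      using min[OF adm[of e]] unfolding E E0 by simp
    then show ?thesis by simp
  qed
  then have "a1 = 0" by (rule polynomial_local_min)
  then show "integral\<^sup>L ?M (\<lambda>r. r\<^sup>2 * (h' r * w' r)) + integral\<^sup>L ?M (\<lambda>r. (6 * h r + r\<^sup>2 * (h r * bulk_coeff t (h r))) * w r) = 0"
    unfolding a1_def using irhw iP(2) by (simp add: P1_def[symmetric])
qed

lemma AE_zero_imp_zero_open: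
  fixes f :: "'a::euclidean_space \<Rightarrow> real"
  assumes U: "open U" and c: "continuous_on U f" and ae: "AE x in lebesgue_on U. f x = 0" and x: "x \<in> U"
  shows "f x = 0"
proof (rule ccontr)
  assume "f x \<noteq> 0"
  define V where "V = U \<inter> f -` (- {0})"
  have "open V" unfolding V_def using continuous_open_preimage[OF c U, of "- {0}"] by auto
  moreover have "V \<noteq> {}" using x \<open>f x \<noteq> 0\<close> V_def by auto
  ultimately have "\<not> negligible V" using open_not_negligible by blast
  moreover have "AE y in lebesgue. y \<notin> V" using ae U unfolding V_def by (auto simp: AE_restrict_space_iff elim!: eventually_mono)
  then have "negligible V" unfolding negligible_iff_null_sets using \<open>open V\<close> by (simp add: AE_iff_null_sets[symmetric] lborelD)
  ultimately show False by simp
qed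

text \<open>The comparison function \<open>K\<close> solves the once-integrated Euler-Lagrange equation for the given \<open>h\<close>;
  testing with \<open>K - h\<close> itself avoids any density argument.\<close>
lemma minimizer_C2:
  assumes R: "1 < R" and h: "Ah R h h'" and min: "\<And>g g'. Ah R g g' \<Longrightarrow> Eh R t h h' \<le> Eh R t g g'"
  obtains k k2 where "continuous_on {1..R} k" "continuous_on {1<..<R} k2"
    "\<And>r. 1 < r \<Longrightarrow> r < R \<Longrightarrow> (h has_real_derivative k r) (at r)"
    "\<And>r. 1 < r \<Longrightarrow> r < R \<Longrightarrow> (k has_real_derivative k2 r) (at r)"
    "\<And>r. 1 < r \<Longrightarrow> r < R \<Longrightarrow> r\<^sup>2 * k2 r + 2 * r * k r = 6 * h r + r\<^sup>2 * (h r * bulk_coeff t (h r))"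
    "AE r in lebesgue_on {1<..<R}. h' r = k r"
proof -
  let ?M = "lebesgue_on {1<..<R}"
  have ch: "continuous_on {1..R} h" and mh: "h' \<in> borel_measurable ?M" and ih: "integrable ?M (\<lambda>r. r\<^sup>2 * (h' r)\<^sup>2)"
    and wh: "weak_grad {1<..<R} h h'" and hb: "h 1 = 1" "h R = 1"
    using h unfolding Ah_def by auto
  have ih2: "integrable ?M (\<lambda>r. (h' r)\<^sup>2)" by (rule integrable_div_r2[OF ih])
  \<comment> \<open>Clamping to the interval extends functions that are continuous on
    \<open>{1..R}\<close> to continuous functions on the line, so that antiderivatives exist
    everywhere.\<close>
  define p where "p r = max 1 (min R r)" for r
  have p: "p r \<in> {1..R}" "1 \<le> r \<Longrightarrow> r \<le> R \<Longrightarrow> p r = r" for r using R unfolding p_def by auto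
  have cp: "continuous_on UNIV p" unfolding p_def by (intro continuous_intros)
  have ext: "continuous_on UNIV (\<lambda>r. f (p r))" if "continuous_on {1..R} f" for f :: "real \<Rightarrow> real"
    by (rule continuous_on_compose2[OF that cp]) (use p in auto)
  define F where "F r = 6 * h r + r\<^sup>2 * (h r * bulk_coeff t (h r))" for r
  have cF: "continuous_on {1..R} F" unfolding F_def bulk_coeff_def by (intro continuous_intros ch) auto
  obtain \<Phi> where \<Phi>: "\<And>r. (\<Phi> has_real_derivative F (p r)) (at r)"
    using continuous_antiderivative_real[OF ext[OF cF]] by blast
  have c\<Phi>: "continuous_on S \<Phi>" for S using \<Phi> by (meson DERIV_isCont continuous_at_imp_continuous_on)
  have c1: "continuous_on {1..R} (\<lambda>r. \<Phi> r / r\<^sup>2)" "continuous_on {1..R} (\<lambda>r. 1 / r\<^sup>2)"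
    by (intro continuous_intros c\<Phi>; auto)+
  obtain K0 where K0: "\<And>r. (K0 has_real_derivative \<Phi> (p r) / (p r)\<^sup>2) (at r)"
    using continuous_antiderivative_real[OF ext[OF c1(1)]] by blast
  obtain J where J: "\<And>r. (J has_real_derivative 1 / (p r)\<^sup>2) (at r)"
    using continuous_antiderivative_real[OF ext[OF c1(2)]] by blast
  have "J 1 < J R"
  proof (rule DERIV_pos_imp_increasing[OF R])
    fix x show "\<exists>y. (J has_real_derivative y) (at x) \<and> 0 < y"
      using J[of x] p(1)[of x] by (intro exI[of _ "1 / (p x)\<^sup>2"]) auto
  qed
  \<comment> \<open>The Euler-Lagrange equation is \<open>(r^2 K')' = F\<close>, hence
    \<open>r^2 K' = \<Phi> + C\<close>; this constant of integration is the one that gives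
    \<open>K R = 1\<close>.\<close>
  define C where "C = - (K0 R - K0 1) / (J R - J 1)"
  define K where "K r = 1 + (K0 r - K0 1) + C * (J r - J 1)" for r
  define k where "k r = (\<Phi> r + C) / r\<^sup>2" for r
  have Kb: "K 1 = 1" "K R = 1" unfolding K_def C_def using \<open>J 1 < J R\<close> by auto
  have Kd: "(K has_real_derivative (\<Phi> (p r) + C) / (p r)\<^sup>2) (at r)" for r
    unfolding K_def[abs_def] by (rule DERIV_cong[OF DERIV_add[OF DERIV_add[OF DERIV_const DERIV_diff[OF K0 DERIV_const]] DERIV_cmult[OF DERIV_diff[OF J DERIV_const]]]])
      (simp add: add_divide_distrib)
  have cK: "continuous_on S K" for S using Kd by (meson DERIV_isCont continuous_at_imp_continuous_on)
  have ck: "continuous_on {1..R} k" unfolding k_def by (intro continuous_intros c\<Phi>) auto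
  have Kdk: "(K has_real_derivative k r) (at r)" if "1 \<le> r" "r \<le> R" for r
    using Kd[of r] p(2)[OF that] unfolding k_def by simp
  have AK: "Ah R K k" by (rule Ah_C1[OF R cK ck Kdk Kb]) auto
  define w where "w r = K r + (-1) * h r" for r
  define w' where "w' r = k r + (-1) * h' r" for r
  have cw: "continuous_on {1..R} w" unfolding w_def by (intro continuous_intros cK ch)
  have w0: "w 1 = 0" "w R = 0" unfolding w_def using Kb hb by auto
  have wg: "weak_grad {1<..<R} w w'"
    using weak_grad_add_scale[OF _ _ wh, of K k "-1"] AK unfolding Ah_def w_def w'_def by simp
  have mk: "k \<in> borel_measurable ?M" by (rule continuous_measurable_interval[OF ck])
  have mw: "w' \<in> borel_measurable ?M" unfolding w'_def using mh mk by simp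
  have ik2: "integrable ?M (\<lambda>r. (k r)\<^sup>2)" by (intro integrable_continuous_interval continuous_intros ck)
  have iw2: "integrable ?M (\<lambda>r. (w' r)\<^sup>2)"
  proof -
    have "(w' r)\<^sup>2 = (k r)\<^sup>2 - 2 * (k r * h' r) + (h' r)\<^sup>2" for r unfolding w'_def by (simp add: power2_eq_square algebra_simps)
    then show ?thesis using ik2 ih2 integrable_mult_L2[OF mk mh ik2 ih2] by simp
  qed
  have one: "integrable ?M (\<lambda>r. 1::real)" by (intro integrable_continuous_interval continuous_intros)
  have iw: "integrable ?M w'" using integrable_mult_L2[OF mw _ iw2, of "\<lambda>r. 1"] one by simp
  note fv = first_variation[OF R h min cw w0 wg mw iw2]
  note ibp = weak_grad_integration_by_parts[OF R cw w0 wg iw]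
  have int_cong: "integral\<^sup>L ?M f = integral\<^sup>L ?M g" if "\<And>r. 1 < r \<Longrightarrow> r < R \<Longrightarrow> f r = g r" for f g :: "real \<Rightarrow> real"
    using that by (intro Bochner_Integration.integral_cong) auto
  have "integral\<^sup>L ?M (\<lambda>r. F r * w r) = integral\<^sup>L ?M (\<lambda>r. w r * F (p r))" by (rule int_cong) (simp add: p)
  also have "\<dots> = - integral\<^sup>L ?M (\<lambda>r. w' r * \<Phi> r)" by (rule ibp[OF \<Phi> ext[OF cF]])
  finally have e1: "integral\<^sup>L ?M (\<lambda>r. F r * w r) = - integral\<^sup>L ?M (\<lambda>r. w' r * \<Phi> r)" .
  have e2: "integral\<^sup>L ?M (\<lambda>r. w' r * C) = 0" using ibp[of "\<lambda>r. C" "\<lambda>r. 0"] by simp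
  have iw\<Phi>: "integrable ?M (\<lambda>r. w' r * \<Phi> r)"
    by (rule integrable_mult_L2[OF mw continuous_measurable_interval[OF c\<Phi>] iw2]) (intro integrable_continuous_interval continuous_intros c\<Phi>)
  \<comment> \<open>One factor \<open>w'\<close> is written as \<open>k - h'\<close> with
    \<open>r^2 k = \<Phi> + C\<close>. The terms with \<open>\<Phi>\<close> and with
    \<open>h'\<close> both integrate to minus the integral of \<open>F * w\<close>, by parts and by
    the first variation, so they cancel; the term with \<open>C\<close> has integral 0.\<close>
  have "integral\<^sup>L ?M (\<lambda>r. r\<^sup>2 * (w' r)\<^sup>2) = integral\<^sup>L ?M (\<lambda>r. (w' r * \<Phi> r + w' r * C) - r\<^sup>2 * (h' r * w' r))"
    by (rule int_cong) (simp add: w'_def k_def field_simps power2_eq_square)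
  also have "\<dots> = 0" using fv e1 e2 iw\<Phi> iw unfolding F_def[symmetric] by simp
  finally have z: "integral\<^sup>L ?M (\<lambda>r. r\<^sup>2 * (w' r)\<^sup>2) = 0" .
  have "AE r in ?M. r\<^sup>2 * (w' r)\<^sup>2 = 0"
    using integral_nonneg_eq_0_iff_AE[OF integrable_r2_mult[OF iw2]] z by simp
  then have w'0: "AE r in ?M. w' r = 0" by (auto simp: AE_restrict_space_iff elim!: eventually_mono)
  \<comment> \<open>Integrating by parts against an antiderivative of \<open>w\<close> itself turns
    \<open>w' = 0\<close> into a vanishing \<open>L^2\<close> norm of \<open>w\<close>.\<close>
  obtain \<Psi> where \<Psi>: "\<And>r. (\<Psi> has_real_derivative w (p r)) (at r)"
    using continuous_antiderivative_real[OF ext[OF cw]] by blast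
  have "integral\<^sup>L ?M (\<lambda>r. (w r)\<^sup>2) = integral\<^sup>L ?M (\<lambda>r. w r * w (p r))" by (rule int_cong) (simp add: p power2_eq_square)
  also have "\<dots> = - integral\<^sup>L ?M (\<lambda>r. w' r * \<Psi> r)" by (rule ibp[OF \<Psi> ext[OF cw]])
  also have "integral\<^sup>L ?M (\<lambda>r. w' r * \<Psi> r) = integral\<^sup>L ?M (\<lambda>r. 0)"
    by (rule AE_lebesgue_on_eq_integral) (use w'0 in \<open>auto elim!: eventually_mono\<close>)
  finally have "integral\<^sup>L ?M (\<lambda>r. (w r)\<^sup>2) = 0" by simp
  moreover have "integrable ?M (\<lambda>r. (w r)\<^sup>2)" by (intro integrable_continuous_interval continuous_intros cw)
  ultimately have aw: "AE r in ?M. (w r)\<^sup>2 = 0" using integral_nonneg_eq_0_iff_AE[of ?M "\<lambda>r. (w r)\<^sup>2"] by simp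
  have wz: "w r = 0" if "1 < r" "r < R" for r
  proof (rule AE_zero_imp_zero_open[of "{1<..<R}" w r])
    show "continuous_on {1<..<R} w" by (rule continuous_on_subset[OF cw]) auto
    show "AE r in ?M. w r = 0" using aw by simp
  qed (use that in auto)
  have hK: "h r = K r" if "1 < r" "r < R" for r using wz[OF that] unfolding w_def by simp
  define k2 where "k2 r = F r / r\<^sup>2 - 2 * (\<Phi> r + C) / r^3" for r
  show thesis
  proof (rule that)
    show "continuous_on {1..R} k" by (rule ck)
    show "continuous_on {1<..<R} k2" unfolding k2_def
      by (intro continuous_intros c\<Phi> continuous_on_subset[OF cF]) auto
    fix r assume r: "1 < r" "r < R"
    show "(h has_real_derivative k r) (at r)"
      by (rule has_field_derivative_transform_within_open[OF Kdk[of r], of "{1<..<R}"]) (use r hK in auto)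
    have "(\<Phi> has_real_derivative F r) (at r)" using \<Phi>[of r] p(2)[of r] r by simp
    then show "(k has_real_derivative k2 r) (at r)" unfolding k_def[abs_def] k2_def using r
      by (auto intro!: derivative_eq_intros simp: field_simps power2_eq_square power3_eq_cube)
    show "r\<^sup>2 * k2 r + 2 * r * k r = 6 * h r + r\<^sup>2 * (h r * bulk_coeff t (h r))"
      unfolding F_def[symmetric] k2_def k_def using r by (simp add: field_simps power2_eq_square power3_eq_cube)
  next
    show "AE r in ?M. h' r = k r" using w'0 by eventually_elim (simp add: w'_def)
  qed
qed

section \<open>Pointwise bounds from the minimum principle\<close>

lemma hplus_pos: "0 \<le> t \<Longrightarrow> 0 < hplus t"
  unfolding hplus_def by (simp add: add_pos_nonneg)

lemma bulk_coeff_neg: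
  assumes "0 \<le> t" "0 < s" "s < 1" shows "bulk_coeff t s < 0"
proof -
  have "bulk_coeff t s = - ((1 - s) * (t / 2 * (1 + s) + 3 * hplus t / 2 * s))"
    unfolding bulk_coeff_def by (simp add: power2_eq_square field_simps)
  then show ?thesis using assms hplus_pos[of t] by (simp add: add_nonneg_pos)
qed

lemma bulk_coeff_nonneg:
  assumes "0 \<le> t" "1 \<le> s" shows "0 \<le> bulk_coeff t s"
proof -
  have "bulk_coeff t s = (s - 1) * (t / 2 * (1 + s) + 3 * hplus t / 2 * s)"
    unfolding bulk_coeff_def by (simp add: power2_eq_square field_simps)
  moreover have "0 \<le> (s - 1) * (t / 2 * (1 + s) + 3 * hplus t / 2 * s)"
    using assms hplus_pos[of t] by (intro mult_nonneg_nonneg add_nonneg_nonneg) auto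
  ultimately show ?thesis by simp
qed

lemma second_derivative_local_min:
  fixes f k :: "real \<Rightarrow> real"
  assumes x: "a < x" "x < b" and d: "\<And>r. a < r \<Longrightarrow> r < b \<Longrightarrow> (f has_real_derivative k r) (at r)"
    and d2: "(k has_real_derivative k2) (at x)" and m: "\<And>r. a < r \<Longrightarrow> r < b \<Longrightarrow> f x \<le> f r"
  shows "k x = 0" "0 \<le> k2"
proof -
  show k0: "k x = 0"
    by (rule DERIV_local_min[OF d[OF x], of "min (x - a) (b - x)"]) (use x m in \<open>auto simp: abs_if split: if_splits\<close>)
  show "0 \<le> k2"
  proof (rule ccontr)
    assume "\<not> 0 \<le> k2"
    then obtain e where e: "0 < e" "\<And>h. 0 < h \<Longrightarrow> h < e \<Longrightarrow> k (x + h) < k x"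
      using DERIV_neg_dec_right[OF d2] by auto
    define y where "y = x + min (e/2) ((b - x)/2)"
    have y: "x < y" "y < x + e" "y < b" unfolding y_def using e(1) x by (auto simp: min_def field_simps)
    have "f y < f x"
    proof (rule DERIV_neg_imp_decreasing_open[OF y(1)])
      fix z assume z: "x < z" "z < y"
      then have "k z < 0" using e(2)[of "z - x"] k0 y by simp
      then show "\<exists>w. (f has_real_derivative w) (at z) \<and> w < 0" using d[of z] z x y by auto
    next
      show "continuous_on {x..y} f"
        by (intro continuous_at_imp_continuous_on ballI DERIV_isCont[OF d]) (use x y in auto)
    qed
    then show False using m[of y] x y by simp
  qed
qed

text \<open>At an interior minimum with nonpositive value the first derivative is 0 and the second
  is nonnegative, against \<open>s\<close>. Because \<open>s\<close> covers the value 0 as well, the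
  conclusion is strict.\<close>

lemma min_principle:
  fixes f k l :: "real \<Rightarrow> real"
  assumes R: "a < b" and cf: "continuous_on {a..b} f"
    and d: "\<And>r. a < r \<Longrightarrow> r < b \<Longrightarrow> (f has_real_derivative k r) (at r)"
    and d2: "\<And>r. a < r \<Longrightarrow> r < b \<Longrightarrow> (k has_real_derivative l r) (at r)"
    and bd: "0 \<le> f a" "0 \<le> f b"
    and s: "\<And>r. a < r \<Longrightarrow> r < b \<Longrightarrow> f r \<le> 0 \<Longrightarrow> k r = 0 \<Longrightarrow> l r < 0"
    and r: "a < r" "r < b"
  shows "0 < f r"
proof (rule ccontr)
  assume n: "\<not> 0 < f r"
  obtain x0 where x0: "x0 \<in> {a..b}" "\<And>y. y \<in> {a..b} \<Longrightarrow> f x0 \<le> f y"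
    using continuous_attains_inf[OF compact_Icc _ cf] R by auto
  \<comment> \<open>If the minimum is negative it lies in the interior by the boundary values.
    Otherwise the assumption \<open>f r \<le> 0\<close> makes the minimum 0, and it is attained at
    the interior point \<open>r\<close>.\<close>
  define x where "x = (if f x0 < 0 then x0 else r)"
  have le: "f x0 \<le> f r" using x0(2) r by auto
  have xm: "f x \<le> f y" if "y \<in> {a..b}" for y using x0(2)[OF that] le n unfolding x_def by (auto split: if_splits)
  have "f x \<le> 0" using n unfolding x_def by auto
  moreover have x: "a < x" "x < b" using x0(1) bd r unfolding x_def by (auto simp: less_le split: if_splits)
  ultimately show False
    using second_derivative_local_min[OF x d d2[OF x]] xm s[OF x] by fastforce
qed

text \<open>Compares \<open>h\<close> with smooth approximations of \<open>\<bar>h\<bar>\<close>: the energies of \<open>h\<close> and \<open>\<bar>h\<bar>\<close> differ only in the cubic term.\<close>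
lemma minimizer_nonneg:
  assumes R: "1 < R" and t: "0 \<le> t" and h: "Ah R h h'" and min: "\<And>g g'. Ah R g g' \<Longrightarrow> Eh R t h h' \<le> Eh R t g g'"
    and ck: "continuous_on {1..R} k" and d: "\<And>r. 1 < r \<Longrightarrow> r < R \<Longrightarrow> (h has_real_derivative k r) (at r)"
    and ae: "AE r in lebesgue_on {1<..<R}. h' r = k r" and r: "1 < r" "r < R"
  shows "0 \<le> h r"
proof -
  let ?M = "lebesgue_on {1<..<R}"
  have ch: "continuous_on {1..R} h" and hb: "h 1 = 1" "h R = 1" using h unfolding Ah_def by auto
  define B where "B r s = 3 * s\<^sup>2 + r\<^sup>2 * (t / 8 * (1 - s\<^sup>2)\<^sup>2 + hplus t / 8 * (1 + 3 * s^4 - 4 * s^3))" for r s :: real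
  have dens: "Eh_density t g g' r = r\<^sup>2 / 2 * (g' r)\<^sup>2 + B r (g r)" for g g' r unfolding Eh_density_def B_def by simp
  have cB: "continuous_on {1..R} (\<lambda>r. B r (g r))" if "continuous_on {1..R} g" for g
    unfolding B_def by (intro continuous_intros that)
  have iB: "integrable ?M (\<lambda>r. B r (g r))" if "continuous_on {1..R} g" for g
    by (rule integrable_continuous_interval[OF cB[OF that]])
  define e where "e n = 1 / real (Suc n)" for n
  have e: "0 < e n" "e n \<le> 1" for n unfolding e_def by (auto simp: field_simps)
  have e0: "e \<longlonglongrightarrow> 0" unfolding e_def using LIMSEQ_inverse_real_of_nat by (simp add: field_simps)
  define q where "q n s = sqrt (s\<^sup>2 + (e n)\<^sup>2)" for n s
  have q0: "0 < q n s" for n s unfolding q_def using e[of n] by (simp add: add_nonneg_pos)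
  \<comment> \<open>\<open>q n\<close> is a smooth version of the absolute value; the added constant
    restores the boundary value 1.\<close>
  define g where "g n r = q n (h r) + 1 - q n 1" for n r
  define g' where "g' n r = h r * k r / q n (h r)" for n r
  have cq: "continuous_on {1..R} (\<lambda>r. q n (h r))" for n unfolding q_def by (intro continuous_intros ch)
  have cg: "continuous_on {1..R} (g n)" for n unfolding g_def by (intro continuous_intros cq)
  have cg': "continuous_on {1..R} (g' n)" for n unfolding g'_def
    using q0 by (intro continuous_intros cq ch ck) (auto simp: less_imp_neq[THEN not_sym])
  have dq: "(q n has_real_derivative s / q n s) (at s)" for n s
  proof -
    have p: "0 < s\<^sup>2 + (e n)\<^sup>2" using e[of n] by (simp add: add_nonneg_pos)
    show ?thesis unfolding q_def[abs_def] using p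
      by (auto intro!: derivative_eq_intros simp: field_simps)
  qed
  have Ag: "Ah R (g n) (g' n)" for n
  proof (rule Ah_C1[OF R cg cg'])
    fix r assume "1 < r" "r < R"
    from DERIV_chain2[OF dq d[OF this]] show "(g n has_real_derivative g' n r) (at r)"
      unfolding g_def[abs_def] g'_def by (auto intro!: derivative_eq_intros)
  qed (use hb in \<open>auto simp: g_def\<close>)
  have k2: "integrable ?M (\<lambda>r. r\<^sup>2 / 2 * (k r)\<^sup>2)" "integrable ?M (\<lambda>r. r\<^sup>2 / 2 * (g' n r)\<^sup>2)" for n
    by (intro integrable_continuous_interval continuous_intros ck cg'; simp)+
  have Eh: "Eh R t h h' = integral\<^sup>L ?M (\<lambda>r. r\<^sup>2 / 2 * (k r)\<^sup>2) + integral\<^sup>L ?M (\<lambda>r. B r (h r))"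
  proof -
    have "Eh R t h h' = integral\<^sup>L ?M (\<lambda>r. r\<^sup>2 / 2 * (k r)\<^sup>2 + B r (h r))"
      unfolding Eh_eq dens by (rule AE_lebesgue_on_eq_integral(1)) (use ae in \<open>auto elim!: eventually_mono\<close>)
    then show ?thesis using k2(1) iB[OF ch] by simp
  qed
  \<comment> \<open>Smoothing does not increase the Dirichlet term, since the slope of
    \<open>q n\<close> is at most 1 in absolute value.\<close>
  have Eg: "Eh R t (g n) (g' n) \<le> integral\<^sup>L ?M (\<lambda>r. r\<^sup>2 / 2 * (k r)\<^sup>2) + integral\<^sup>L ?M (\<lambda>r. B r (g n r))" for n
  proof -
    have "(g' n r)\<^sup>2 \<le> (k r)\<^sup>2" for r
    proof -
      have "(h r)\<^sup>2 \<le> (q n (h r))\<^sup>2" unfolding q_def by simp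
      then have "(h r)\<^sup>2 * (k r)\<^sup>2 \<le> (q n (h r))\<^sup>2 * (k r)\<^sup>2" by (rule mult_right_mono) simp
      then show ?thesis unfolding g'_def using q0[of n "h r"] by (simp add: power_divide power_mult_distrib divide_le_eq mult.commute)
    qed
    then have "integral\<^sup>L ?M (\<lambda>r. r\<^sup>2 / 2 * (g' n r)\<^sup>2) \<le> integral\<^sup>L ?M (\<lambda>r. r\<^sup>2 / 2 * (k r)\<^sup>2)"
      by (intro integral_mono k2 mult_left_mono) auto
    then show ?thesis unfolding Eh_eq dens using k2(2)[of n] iB[OF cg[of n]] by simp
  qed
  have le: "integral\<^sup>L ?M (\<lambda>r. B r (h r)) \<le> integral\<^sup>L ?M (\<lambda>r. B r (g n r))" for n
    using min[OF Ag[of n]] Eg[of n] unfolding Eh by simp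
  obtain M where M: "\<And>r. r \<in> {1..R} \<Longrightarrow> \<bar>h r\<bar> \<le> M"
    using compact_imp_bounded[OF compact_continuous_image[OF ch compact_Icc]] unfolding bounded_iff by force
  have gb: "\<bar>g n r\<bar> \<le> M + 3" if "r \<in> {1..R}" for n r
  proof -
    have "q n s \<le> \<bar>s\<bar> + 1" for s
      using sqrt_sum_squares_le_sum_abs[of s "e n"] e[of n] unfolding q_def by simp
    from this[of "h r"] this[of 1] show ?thesis using q0[of n 1] q0[of n "h r"] M[OF that] unfolding g_def by simp
  qed
  obtain C where C: "\<And>p. p \<in> {1..R} \<times> {-(M+3)..M+3} \<Longrightarrow> \<bar>B (fst p) (snd p)\<bar> \<le> C"
  proof -
    have "continuous_on ({1..R} \<times> {-(M+3)..M+3}) (\<lambda>p. B (fst p) (snd p))"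
      unfolding B_def by (intro continuous_intros)
    from compact_imp_bounded[OF compact_continuous_image[OF this compact_Times[OF compact_Icc compact_Icc]]]
    show ?thesis using that unfolding bounded_iff by force
  qed
  have "(\<lambda>n. integral\<^sup>L ?M (\<lambda>r. B r (g n r))) \<longlonglongrightarrow> integral\<^sup>L ?M (\<lambda>r. B r \<bar>h r\<bar>)"
  proof (rule integral_dominated_convergence[where w="\<lambda>r. C"])
    show "integrable ?M (\<lambda>r. C)" by (intro integrable_continuous_interval continuous_intros)
    show "(\<lambda>r. B r \<bar>h r\<bar>) \<in> borel_measurable ?M" by (intro continuous_measurable_interval cB continuous_intros ch)
    show "(\<lambda>r. B r (g n r)) \<in> borel_measurable ?M" for n by (intro continuous_measurable_interval cB cg)
    show "AE r in ?M. norm (B r (g n r)) \<le> C" for n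
    proof (intro AE_I2)
      fix r assume "r \<in> space ?M"
      then have "r \<in> {1..R}" by simp
      then show "norm (B r (g n r)) \<le> C" using C[of "(r, g n r)"] gb[of r n] by (simp add: abs_le_iff)
    qed
    show "AE r in ?M. (\<lambda>n. B r (g n r)) \<longlonglongrightarrow> B r \<bar>h r\<bar>"
    proof (intro AE_I2)
      fix r
      have "(\<lambda>n. q n s) \<longlonglongrightarrow> sqrt (s\<^sup>2 + 0\<^sup>2)" for s unfolding q_def by (intro tendsto_intros e0)
      then have q: "(\<lambda>n. q n s) \<longlonglongrightarrow> \<bar>s\<bar>" for s by simp
      have "(\<lambda>n. g n r) \<longlonglongrightarrow> \<bar>h r\<bar> + 1 - \<bar>1\<bar>" unfolding g_def by (intro tendsto_intros q)
      then have "(\<lambda>n. g n r) \<longlonglongrightarrow> \<bar>h r\<bar>" by simp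
      then show "(\<lambda>n. B r (g n r)) \<longlonglongrightarrow> B r \<bar>h r\<bar>" unfolding B_def by (intro tendsto_intros)
    qed
  qed
  then have "integral\<^sup>L ?M (\<lambda>r. B r (h r)) \<le> integral\<^sup>L ?M (\<lambda>r. B r \<bar>h r\<bar>)"
    by (rule LIMSEQ_le_const) (use le in auto)
  then have "integral\<^sup>L ?M (\<lambda>r. B r (h r) - B r \<bar>h r\<bar>) \<le> 0"
    using iB[OF ch] iB[OF continuous_on_rabs[OF ch]] by simp
  \<comment> \<open>\<open>D\<close> is nonnegative and its integral is at most 0, so it vanishes on
    the open interval by continuity; this forces \<open>h\<close> to be nonnegative there.\<close>
  define D where "D r = hplus t / 2 * (r\<^sup>2 * (\<bar>h r\<bar>^3 - (h r)^3))" for r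
  have D: "B r (h r) - B r \<bar>h r\<bar> = D r" for r unfolding B_def D_def by (simp add: algebra_simps)
  have D0: "0 \<le> D r" for r unfolding D_def using hplus_pos[OF t]
    by (intro mult_nonneg_nonneg) (auto simp: power3_eq_cube abs_if mult_nonneg_nonpos mult_nonneg_nonneg)
  have cD: "continuous_on {1..R} D" unfolding D_def by (intro continuous_intros ch)
  have "integral\<^sup>L ?M D = 0"
    using \<open>integral\<^sup>L ?M (\<lambda>r. B r (h r) - B r \<bar>h r\<bar>) \<le> 0\<close> Bochner_Integration.integral_nonneg[of ?M D] D0
    unfolding D by (auto intro: antisym)
  then have "AE r in ?M. D r = 0"
    using integral_nonneg_eq_0_iff_AE[OF integrable_continuous_interval[OF cD]] D0 by simp
  then have "D r = 0"
    by (rule AE_zero_imp_zero_open[rotated 2]) (use r continuous_on_subset[OF cD, of "{1<..<R}"] in \<open>auto simp: subset_eq\<close>)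
  then have "\<bar>h r\<bar>^3 = (h r)^3" unfolding D_def using hplus_pos[OF t] r by auto
  then show "0 \<le> h r" by (metis abs_ge_zero zero_le_power zero_le_odd_power odd_numeral)
qed

text \<open>The solutions of this equation are spanned by \<open>r^2\<close> and
  \<open>1 / r^3\<close>, the exponents being the roots of \<open>s * (s + 1) = 6\<close>; both
  coefficients of \<open>eta R\<close> are positive.\<close>

lemma eta_ODE:
  assumes R: "1 < R"
  obtains k k2 where "continuous_on {1..R} (eta R)" "\<And>r. 0 < r \<Longrightarrow> (eta R has_real_derivative k r) (at r)"
    "\<And>r. 0 < r \<Longrightarrow> (k has_real_derivative k2 r) (at r)" "\<And>r. 0 < r \<Longrightarrow> r\<^sup>2 * k2 r + 2 * r * k r = 6 * eta R r"
    "\<And>r. 0 < r \<Longrightarrow> 0 < eta R r"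
    "eta R 1 = 1" "eta R R = 1"
proof -
  define A where "A = (R^3 - 1) / (R^5 - 1)"
  define B where "B = (R\<^sup>2 - 1) * R^3 / (R^5 - 1)"
  have p: "1 < R^2" "1 < R^3" "1 < R^5" using R by (auto intro: one_less_power)
  have AB: "0 < A" "0 < B" unfolding A_def B_def using p R by auto
  have e: "eta R r = A * r\<^sup>2 + B / r^3" for r
    unfolding eta_def A_def B_def by (simp add: power_divide distrib_left)
  have s: "A + B = 1" "A * R^5 + B = R^3"
  proof -
    show "A + B = 1" unfolding A_def B_def add_divide_distrib[symmetric] using p
      by (simp add: divide_eq_1_iff left_diff_distrib power_add[symmetric])
    have "A * R^5 + B = ((R^3 - 1) * R^5 + (R\<^sup>2 - 1) * R^3) / (R^5 - 1)" unfolding A_def B_def by (simp add: add_divide_distrib)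
    also have "(R^3 - 1) * R^5 + (R\<^sup>2 - 1) * R^3 = R^3 * (R^5 - 1)" by algebra
    finally show "A * R^5 + B = R^3" using p by simp
  qed
  show thesis
  proof (rule that[of "\<lambda>r. 2 * A * r - 3 * B / r^4" "\<lambda>r. 2 * A + 12 * B / r^5"])
    show "continuous_on {1..R} (eta R)" unfolding e[abs_def] by (intro continuous_intros) auto
    fix r :: real assume r: "0 < r"
    have dp: "((\<lambda>r. c / r ^ Suc n) has_real_derivative - (c * real (Suc n) / r ^ Suc (Suc n))) (at r)" for c n
      by (rule derivative_eq_intros refl | use r in \<open>simp add: field_simps\<close>)+
    have p: "r^5 = r^2 * r^3" "r^4 = r * r^3" by (simp_all add: power_add[symmetric] power_Suc[symmetric] del: power_Suc)
    have dp3: "((\<lambda>r. B / r ^ 3) has_real_derivative - (3 * B / r ^ 4)) (at r)"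
      using dp[of B 2] by (simp add: eval_nat_numeral mult_ac)
    have dp4: "((\<lambda>r. 3 * B / r ^ 4) has_real_derivative - (12 * B / r ^ 5)) (at r)"
      using dp[of "3 * B" 3] by (simp add: eval_nat_numeral mult_ac)
    have q: "((\<lambda>r. A * r\<^sup>2) has_real_derivative 2 * A * r) (at r)" "((\<lambda>r. 2 * A * r) has_real_derivative 2 * A) (at r)"
      by (auto intro!: derivative_eq_intros)
    show "(eta R has_real_derivative 2 * A * r - 3 * B / r^4) (at r)"
      using DERIV_add[OF q(1) dp3] unfolding e[abs_def] by simp
    show "((\<lambda>r. 2 * A * r - 3 * B / r^4) has_real_derivative 2 * A + 12 * B / r^5) (at r)"
      using DERIV_diff[OF q(2) dp4] by simp
    show "r\<^sup>2 * (2 * A + 12 * B / r^5) + 2 * r * (2 * A * r - 3 * B / r^4) = 6 * eta R r"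
      unfolding e p using r by (simp add: distrib_left right_diff_distrib power2_eq_square)
    show "0 < eta R r" unfolding e using AB r by (simp add: add_pos_pos)
  next
    show "eta R 1 = 1" unfolding e using s by simp
    have "eta R R = (A * R^5 + B) / R^3" 
    proof -
      have "A * R\<^sup>2 = A * R^5 / R^3" using R by (simp add: nonzero_eq_divide_eq power_add[symmetric])
      then show ?thesis unfolding e by (simp add: add_divide_distrib)
    qed
    then show "eta R R = 1" unfolding s(2) using R by simp
  qed
qed

text \<open>Where \<open>h\<close> is at least 1, \<open>bulk_coeff\<close> is nonnegative and the
  equation makes \<open>h\<close> strictly convex at critical points, which excludes a maximum. Then
  \<open>0 \<le> h < 1\<close> gives \<open>h * bulk_coeff t h\<close> the sign that makes
  \<open>h\<close> a supersolution of the equation for \<open>eta R\<close>. For negative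
  \<open>h\<close> this sign would be unknown, so nonnegativity has to come from minimality.\<close>

lemma minimizer_bounds:
  assumes R: "1 < R" and t: "0 \<le> t" and ch: "continuous_on {1..R} h" and hb: "h 1 = 1" "h R = 1"
    and d: "\<And>r. 1 < r \<Longrightarrow> r < R \<Longrightarrow> (h has_real_derivative k r) (at r)"
    and d2: "\<And>r. 1 < r \<Longrightarrow> r < R \<Longrightarrow> (k has_real_derivative k2 r) (at r)"
    and ode: "\<And>r. 1 < r \<Longrightarrow> r < R \<Longrightarrow> r\<^sup>2 * k2 r + 2 * r * k r = 6 * h r + r\<^sup>2 * (h r * bulk_coeff t (h r))"
    and nn: "\<And>r. 1 < r \<Longrightarrow> r < R \<Longrightarrow> 0 \<le> h r"
    and r: "1 < r" "r < R"
  shows "h r < 1" "eta R r < h r"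
proof -
  have h1: "h r < 1" if r: "1 < r" "r < R" for r
  proof -
    have "0 < 1 - h r"
    proof (rule min_principle[OF R _ _ _ _ _ _ r, where k="\<lambda>r. - k r" and l="\<lambda>r. - k2 r"])
      show "continuous_on {1..R} (\<lambda>r. 1 - h r)" by (intro continuous_intros ch)
      fix r assume r: "1 < r" "r < R"
      show "((\<lambda>r. 1 - h r) has_real_derivative - k r) (at r)" using d[OF r] by (auto intro!: derivative_eq_intros)
      show "((\<lambda>r. - k r) has_real_derivative - k2 r) (at r)" using d2[OF r] by (auto intro!: derivative_eq_intros)
      assume "1 - h r \<le> 0" "- k r = 0"
      then have "0 < r\<^sup>2 * k2 r" using ode[OF r] bulk_coeff_nonneg[OF t, of "h r"] by (simp add: add_pos_nonneg)
      then show "- k2 r < 0" by (simp add: zero_less_mult_iff)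
    qed (use hb in auto)
    then show ?thesis by simp
  qed
  show "h r < 1" by (rule h1[OF r])
  obtain j j2 where j: "continuous_on {1..R} (eta R)" "\<And>r. 0 < r \<Longrightarrow> (eta R has_real_derivative j r) (at r)"
    "\<And>r. 0 < r \<Longrightarrow> (j has_real_derivative j2 r) (at r)" "\<And>r. 0 < r \<Longrightarrow> r\<^sup>2 * j2 r + 2 * r * j r = 6 * eta R r"
    "\<And>r. 0 < r \<Longrightarrow> 0 < eta R r" "eta R 1 = 1" "eta R R = 1"
    using eta_ODE[OF R] by blast
  have "0 < h r - eta R r"
  proof (rule min_principle[OF R _ _ _ _ _ _ r, where k="\<lambda>r. k r - j r" and l="\<lambda>r. k2 r - j2 r"])
    show "continuous_on {1..R} (\<lambda>r. h r - eta R r)" by (intro continuous_intros ch j)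
    fix r assume r: "1 < r" "r < R"
    have r0: "0 < r" using r by simp
    show "((\<lambda>r. h r - eta R r) has_real_derivative k r - j r) (at r)" by (intro DERIV_diff d r j r0)
    show "((\<lambda>r. k r - j r) has_real_derivative k2 r - j2 r) (at r)" by (intro DERIV_diff d2 r j r0)
    assume le: "h r - eta R r \<le> 0" and "k r - j r = 0"
    then have "r\<^sup>2 * (k2 r - j2 r) = 6 * (h r - eta R r) + r\<^sup>2 * (h r * bulk_coeff t (h r))"
      using ode[OF r] j(4)[OF r0] by (simp add: algebra_simps)
    also have "\<dots> < 0"
    \<comment> \<open>If \<open>h r = 0\<close>, the nonlinear term is 0 and strictness comes from
      \<open>eta R r > 0\<close>.\<close>
    proof (cases "h r = 0")
      case True then show ?thesis using j(5)[OF r0] by simp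
    next
      case False
      then have "0 < h r" using nn[OF r] by simp
      then have "h r * bulk_coeff t (h r) < 0" using bulk_coeff_neg[OF t _ h1[OF r]] by (simp add: mult_pos_neg)
      then have "r\<^sup>2 * (h r * bulk_coeff t (h r)) < 0" using r by (simp add: mult_pos_neg)
      then show ?thesis using le by simp
    qed
    finally show "k2 r - j2 r < 0" using mult_nonneg_nonneg[of "r\<^sup>2" "k2 r - j2 r"] by fastforce
  qed (use hb j in auto)
  then show "eta R r < h r" by simp
qed

text \<open>At outer radius 9/4 the function \<open>eta\<close> drops to about 0.655 at
  \<open>r = 3/2\<close>, the geometric mean of the two radii.\<close>

lemma eta_constraint_bound:
  assumes "\<forall>R'. 1 < R' \<and> R' \<le> S \<longrightarrow> (\<forall>r\<in>{1..R'}. eta R' r \<ge> 2/3)"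
  shows "S < 9/4"
proof (rule ccontr)
  assume "\<not> S < 9/4"
  then have "\<forall>r\<in>{1..9/4}. eta (9/4) r \<ge> 2/3" using assms by simp
  then have "eta (9/4) (3/2) \<ge> 2/3" by auto
  then show False unfolding eta_def by (simp add: eval_nat_numeral)
qed

section \<open>Ladyzhenskaya's inequality in three dimensions\<close>

lemma abs_le_nn_integral_derivative:
  fixes f :: "real \<Rightarrow> real"
  assumes d: "\<And>x. (f has_real_derivative f' x) (at x)" and c: "continuous_on UNIV f'"
    and a: "a \<le> x" "f a = 0"
  shows "ennreal \<bar>f x\<bar> \<le> (\<integral>\<^sup>+s. ennreal \<bar>f' s\<bar> \<partial>lborel)"
proof -
  have 1: "has_bochner_integral lborel (\<lambda>s. indicator {a..x} s *\<^sub>R f' s) (f x - f a)"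
    using d c a by (intro has_bochner_integral_FTC_Icc)
      (auto simp: has_real_derivative_iff_has_vector_derivative[symmetric] intro: has_field_derivative_at_within continuous_on_subset)
  then have "f x = integral\<^sup>L lborel (\<lambda>s. indicator {a..x} s *\<^sub>R f' s)" using a by (simp add: has_bochner_integral_iff)
  then have "ennreal \<bar>f x\<bar> \<le> (\<integral>\<^sup>+s. ennreal (norm (indicator {a..x} s *\<^sub>R f' s)) \<partial>lborel)"
    using integral_norm_bound_ennreal 1 unfolding has_bochner_integral_iff by fastforce
  also have "\<dots> \<le> (\<integral>\<^sup>+s. ennreal \<bar>f' s\<bar> \<partial>lborel)"
    by (intro nn_integral_mono ennreal_leI) (auto simp: indicator_def)
  finally show ?thesis .
qed

lemma square_le_line_integral:
  fixes \<phi> :: "'a::euclidean_space \<Rightarrow> real"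
  assumes C: "C1_fn \<phi> g" and K: "compact K" "\<And>x. x \<notin> K \<Longrightarrow> \<phi> x = 0" and e: "e \<noteq> 0"
  shows "ennreal ((\<phi> (y + s *\<^sub>R e))\<^sup>2) \<le> (\<integral>\<^sup>+r. ennreal (2 * \<bar>\<phi> (y + r *\<^sub>R e) * (g (y + r *\<^sub>R e) \<bullet> e)\<bar>) \<partial>lborel)"
proof -
  let ?f = "\<lambda>r. (\<phi> (y + r *\<^sub>R e))\<^sup>2"
  let ?d = "\<lambda>r. 2 * (\<phi> (y + r *\<^sub>R e) * (g (y + r *\<^sub>R e) \<bullet> e))"
  obtain B where B: "\<And>x. x \<in> K \<Longrightarrow> norm x \<le> B" using compact_imp_bounded[OF K(1)] unfolding bounded_iff by auto
  \<comment> \<open>This parameter lies so far back on the line that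
    \<open>y + a *\<^sub>R e\<close> is outside a ball around \<open>K\<close>; there the square of
    \<open>\<phi>\<close> starts from 0.\<close>
  define a where "a = - \<bar>s\<bar> - (\<bar>B\<bar> + norm y + 1) / norm e"
  have a: "a \<le> s" unfolding a_def using e by (smt (verit) divide_nonneg_nonneg norm_ge_zero)
  have "y + a *\<^sub>R e \<notin> K"
  proof
    assume "y + a *\<^sub>R e \<in> K"
    then have "norm (y + a *\<^sub>R e) \<le> B" by (rule B)
    moreover have "\<bar>a\<bar> * norm e \<le> norm (y + a *\<^sub>R e) + norm y"
      using norm_triangle_ineq4[of "y + a *\<^sub>R e" y] by simp
    moreover have "\<bar>a\<bar> \<ge> (\<bar>B\<bar> + norm y + 1) / norm e" unfolding a_def by linarith
    then have "\<bar>a\<bar> * norm e \<ge> \<bar>B\<bar> + norm y + 1" using e by (simp add: divide_le_eq)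
    ultimately show False by linarith
  qed
  then have a0: "?f a = 0" using K(2) by simp
  have d: "(?f has_real_derivative ?d r) (at r)" for r
  proof -
    have "(\<phi> has_derivative (\<lambda>v. g (y + r *\<^sub>R e) \<bullet> v)) (at (y + r *\<^sub>R e))" using C unfolding C1_fn_def by auto
    moreover have "((\<lambda>r. y + r *\<^sub>R e) has_derivative (\<lambda>s. s *\<^sub>R e)) (at r)" by (auto intro!: derivative_eq_intros)
    ultimately have "((\<lambda>r. \<phi> (y + r *\<^sub>R e)) has_derivative (\<lambda>s. g (y + r *\<^sub>R e) \<bullet> (s *\<^sub>R e))) (at r)"
      by (rule has_derivative_compose[rotated])
    moreover have "(\<lambda>s. g (y + r *\<^sub>R e) \<bullet> (s *\<^sub>R e)) = (*) (g (y + r *\<^sub>R e) \<bullet> e)" by (auto simp: fun_eq_iff)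
    ultimately have "((\<lambda>r. \<phi> (y + r *\<^sub>R e)) has_real_derivative (g (y + r *\<^sub>R e) \<bullet> e)) (at r)"
      unfolding has_field_derivative_def by simp
    from DERIV_power[OF this, of 2] show ?thesis by (simp add: mult_ac)
  qed
  have c: "continuous_on UNIV ?d"
  proof -
    have 1: "continuous_on UNIV (\<lambda>r. y + r *\<^sub>R e)" by (intro continuous_intros)
    have "continuous_on UNIV g" using C unfolding C1_fn_def by blast
    then show ?thesis
      using continuous_on_compose2[OF C1_fn_continuous[OF C] 1] continuous_on_compose2[of UNIV g, OF _ 1]
      by (intro continuous_intros) auto
  qed
  from abs_le_nn_integral_derivative[OF d c a a0] show ?thesis by (simp add: abs_mult)
qed

text \<open>One factor of \<open>u * u\<close> is bounded by a function of \<open>b\<close> alone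
  and the other by a function of \<open>a\<close> alone, so the double integral of the bound splits
  into a product.\<close>

lemma loomis_whitney_plane:
  fixes u p1 p2 :: "real \<times> real \<Rightarrow> ennreal"
  assumes [measurable]: "u \<in> borel_measurable borel" "p1 \<in> borel_measurable borel" "p2 \<in> borel_measurable borel"
    and 1: "\<And>a b. u (a, b) \<le> (\<integral>\<^sup>+a'. p1 (a', b) \<partial>lborel)"
    and 2: "\<And>a b. u (a, b) \<le> (\<integral>\<^sup>+b'. p2 (a, b') \<partial>lborel)"
  shows "(\<integral>\<^sup>+p. u p * u p \<partial>lborel) \<le> (\<integral>\<^sup>+p. p1 p \<partial>lborel) * (\<integral>\<^sup>+p. p2 p \<partial>lborel)"
proof -
  have m: "f \<in> borel_measurable (lborel \<Otimes>\<^sub>M lborel)" if "f \<in> borel_measurable borel" for f :: "real \<times> real \<Rightarrow> ennreal"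
    using that unfolding lborel_prod by simp
  note [measurable] = m[OF assms(1)] m[OF assms(2)] m[OF assms(3)]
  have fub: "(\<integral>\<^sup>+p. f p \<partial>lborel) = (\<integral>\<^sup>+a. \<integral>\<^sup>+b. f (a, b) \<partial>lborel \<partial>lborel)"
    and fub': "(\<integral>\<^sup>+p. f p \<partial>lborel) = (\<integral>\<^sup>+b. \<integral>\<^sup>+a. f (a, b) \<partial>lborel \<partial>lborel)"
    if "f \<in> borel_measurable borel" for f :: "real \<times> real \<Rightarrow> ennreal"
    using lborel.nn_integral_fst[OF m[OF that]] lborel_pair.nn_integral_snd[OF m[OF that]] unfolding lborel_prod by auto
  have "(\<integral>\<^sup>+p. u p * u p \<partial>lborel) = (\<integral>\<^sup>+a. \<integral>\<^sup>+b. u (a, b) * u (a, b) \<partial>lborel \<partial>lborel)"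
    by (rule fub) measurable
  also have "\<dots> \<le> (\<integral>\<^sup>+a. \<integral>\<^sup>+b. (\<integral>\<^sup>+a'. p1 (a', b) \<partial>lborel) * (\<integral>\<^sup>+b'. p2 (a, b') \<partial>lborel) \<partial>lborel \<partial>lborel)"
    by (intro nn_integral_mono mult_mono 1 2) auto
  also have "\<dots> = (\<integral>\<^sup>+a. (\<integral>\<^sup>+b. (\<integral>\<^sup>+a'. p1 (a', b) \<partial>lborel) \<partial>lborel) * (\<integral>\<^sup>+b'. p2 (a, b') \<partial>lborel) \<partial>lborel)"
    by (intro nn_integral_cong nn_integral_multc) measurable
  also have "\<dots> = (\<integral>\<^sup>+p. p1 p \<partial>lborel) * (\<integral>\<^sup>+p. p2 p \<partial>lborel)"
    unfolding fub[OF assms(3)] fub'[OF assms(2)] by (intro nn_integral_cmult) measurable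
  finally show ?thesis .
qed

text \<open>The third coordinate comes first in the pair, so that the outer integral in
  \<open>nn_integral_coords3\<close> runs over planes orthogonal to the third axis.\<close>

definition coords3 :: "real \<times> real \<times> real \<Rightarrow> real^3" where
  "coords3 q = fst (snd q) *\<^sub>R axis 1 1 + snd (snd q) *\<^sub>R axis 2 1 + fst q *\<^sub>R axis 3 1"

lemma coords3_nth [simp]: "coords3 q $ 1 = fst (snd q)" "coords3 q $ 2 = snd (snd q)" "coords3 q $ 3 = fst q"
  unfolding coords3_def by (simp_all add: axis_def)

lemma continuous_on_coords3: "continuous_on UNIV coords3"
  unfolding coords3_def by (intro continuous_intros)

text \<open>\<open>coords3\<close> only permutes coordinates, so it preserves the volume of boxes
  and with it Lebesgue measure; the rest is Fubini.\<close>

lemma nn_integral_coords3: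
  fixes f :: "real^3 \<Rightarrow> ennreal"
  assumes f: "f \<in> borel_measurable borel"
  shows "(\<integral>\<^sup>+x. f x \<partial>lborel) = (\<integral>\<^sup>+c. \<integral>\<^sup>+p. f (coords3 (c, p)) \<partial>lborel \<partial>lborel)"
proof -
  have m: "coords3 \<in> borel_measurable borel" by (rule borel_measurable_continuous_onI[OF continuous_on_coords3])
  have l: "lborel = distr lborel borel coords3"
  proof (rule lborel_eqI)
    fix l u :: "real^3" assume le: "\<And>b. b \<in> Basis \<Longrightarrow> l \<bullet> b \<le> u \<bullet> b"
    have le': "l $ i \<le> u $ i" for i using le[of "axis i 1"] by (simp add: inner_axis axis_in_Basis_iff)
    have "coords3 -` box l u = {l $ 3<..<u $ 3} \<times> ({l $ 1<..<u $ 1} \<times> {l $ 2<..<u $ 2})"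
      by (auto simp: mem_box_cart forall_3)
    then have "emeasure (distr lborel borel coords3) (box l u) = emeasure (lborel \<Otimes>\<^sub>M (lborel :: (real \<times> real) measure)) ({l $ 3<..<u $ 3} \<times> ({l $ 1<..<u $ 1} \<times> {l $ 2<..<u $ 2}))"
      using m unfolding lborel_prod by (simp add: emeasure_distr)
    also have "\<dots> = ennreal (u $ 3 - l $ 3) * (ennreal (u $ 1 - l $ 1) * ennreal (u $ 2 - l $ 2))"
    proof -
      have "emeasure (lborel \<Otimes>\<^sub>M (lborel :: (real \<times> real) measure)) ({l $ 3<..<u $ 3} \<times> ({l $ 1<..<u $ 1} \<times> {l $ 2<..<u $ 2}))
          = emeasure lborel {l $ 3<..<u $ 3} * emeasure (lborel :: (real \<times> real) measure) ({l $ 1<..<u $ 1} \<times> {l $ 2<..<u $ 2})"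
        by (intro lborel.emeasure_pair_measure_Times) (auto intro!: borel_open open_Times)
      also have "emeasure (lborel :: (real \<times> real) measure) ({l $ 1<..<u $ 1} \<times> {l $ 2<..<u $ 2}) = emeasure lborel {l $ 1<..<u $ 1} * emeasure lborel {l $ 2<..<u $ 2}"
        unfolding lborel_prod[symmetric] by (intro lborel.emeasure_pair_measure_Times) auto
      finally show ?thesis using le' by simp
    qed
    also have "\<dots> = ennreal (\<Prod>i\<in>UNIV. u $ i - l $ i)"
      using le' unfolding UNIV_3 by (simp add: ennreal_mult[symmetric] mult_ac)
    also have "(\<Prod>i\<in>UNIV. u $ i - l $ i) = (\<Prod>b\<in>Basis. (u - l) \<bullet> b)"
    proof -
      have B: "Basis = (\<lambda>i. axis i (1::real)) ` (UNIV::3 set)" by (auto simp: Basis_vec_def)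
      have I: "inj (\<lambda>i::3. axis i (1::real))" by (auto simp: inj_on_def axis_eq_axis)
      show ?thesis unfolding B prod.reindex[OF I] o_def by (simp add: inner_axis)
    qed
    finally show "emeasure (distr lborel borel coords3) (box l u) = (\<Prod>b\<in>Basis. (u - l) \<bullet> b)" .
  qed simp
  have fm: "(\<lambda>q. f (coords3 q)) \<in> borel_measurable borel" using f m by measurable
  have "(\<integral>\<^sup>+x. f x \<partial>lborel) = (\<integral>\<^sup>+q. f (coords3 q) \<partial>lborel)"
    by (subst l) (use f m in \<open>simp add: nn_integral_distr\<close>)
  also have "\<dots> = (\<integral>\<^sup>+c. \<integral>\<^sup>+p. f (coords3 (c, p)) \<partial>lborel \<partial>lborel)"
    using lborel.nn_integral_fst[of "\<lambda>q. f (coords3 q)" "lborel::real measure"] fm unfolding lborel_prod by simp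
  finally show ?thesis .
qed

lemma mult_le_sum_squares_ennreal: "a * b \<le> a\<^sup>2 + (b\<^sup>2 :: ennreal)"
proof (cases "a \<le> b")
  case True
  then have "a * b \<le> b * b" by (rule mult_right_mono) simp
  also have "\<dots> \<le> a\<^sup>2 + b\<^sup>2" by (simp add: power2_eq_square)
  finally show ?thesis .
next
  case False
  then have "a * b \<le> a * a" by (intro mult_left_mono) auto
  also have "\<dots> \<le> a\<^sup>2 + b\<^sup>2" by (simp add: power2_eq_square)
  finally show ?thesis .
qed

text \<open>In each plane orthogonal to the third axis, the planar product bound and Cauchy-Schwarz
  estimate the integral of the fourth power by a multiple of \<open>N c * D c\<close>. Line
  integrals in the third direction bound \<open>N c\<close> by \<open>B3\<close> uniformly in
  \<open>c\<close>, and integrating over \<open>c\<close> turns \<open>D c\<close> into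
  \<open>B\<close>. The factor \<open>A + B\<close> is cruder than the usual product of powers, but
  only finiteness is wanted.\<close>

lemma ladyzhenskaya:
  fixes \<phi> :: "real^3 \<Rightarrow> real"
  assumes C: "C1_fn \<phi> g" and K: "compact K" "\<And>x. x \<notin> K \<Longrightarrow> \<phi> x = 0"
  defines "A \<equiv> \<integral>\<^sup>+x. ennreal ((\<phi> x)\<^sup>2) \<partial>lborel" and "B \<equiv> \<integral>\<^sup>+x. ennreal ((norm (g x))\<^sup>2) \<partial>lborel"
  shows "(\<integral>\<^sup>+x. ennreal ((\<phi> x)^4) \<partial>lborel) \<le> 8 * ((A + B) * B)"
proof -
  define T where "T c p = coords3 (c, p)" for c p
  define W where "W i x = ennreal (2 * \<bar>\<phi> x * (g x \<bullet> axis i 1)\<bar>)" for i x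
  define U where "U x = ennreal ((\<phi> x)\<^sup>2)" for x
  define G where "G x = ennreal ((norm (g x))\<^sup>2)" for x
  have cp: "continuous_on UNIV \<phi>" by (rule C1_fn_continuous[OF C])
  have cg: "continuous_on UNIV g" using C unfolding C1_fn_def by blast
  have m[measurable]: "\<phi> \<in> borel_measurable borel" "g \<in> borel_measurable borel" "coords3 \<in> borel_measurable borel"
    by (intro borel_measurable_continuous_onI cp cg continuous_on_coords3)+
  have [measurable]: "W i \<in> borel_measurable borel" "U \<in> borel_measurable borel" "G \<in> borel_measurable borel" for i
    unfolding W_def[abs_def] U_def[abs_def] G_def[abs_def] by measurable
  have Tm: "(\<lambda>p. F (T c p)) \<in> borel_measurable borel" "(\<lambda>q. F (coords3 q)) \<in> borel_measurable borel"
    if [measurable]: "F \<in> borel_measurable borel" for F :: "real^3 \<Rightarrow> ennreal" and c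
  proof -
    have "continuous_on UNIV (T c)" unfolding T_def by (intro continuous_on_compose2[OF continuous_on_coords3] continuous_intros) auto
    then have [measurable]: "T c \<in> borel_measurable borel" by (rule borel_measurable_continuous_onI)
    show "(\<lambda>p. F (T c p)) \<in> borel_measurable borel" by measurable
    show "(\<lambda>q. F (coords3 q)) \<in> borel_measurable borel" by measurable
  qed
  have Tp: "(\<lambda>(c, p). F (T c p)) \<in> borel_measurable (lborel \<Otimes>\<^sub>M lborel)"
    if "F \<in> borel_measurable borel" for F :: "real^3 \<Rightarrow> ennreal"
    using Tm(2)[OF that] unfolding T_def lborel_prod by (simp add: case_prod_unfold)
  have Tc: "(\<lambda>c. \<integral>\<^sup>+p. F (T c p) \<partial>lborel) \<in> borel_measurable lborel"
    if "F \<in> borel_measurable borel" for F :: "real^3 \<Rightarrow> ennreal"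
    using lborel.borel_measurable_nn_integral[OF Tp[OF that]] .
  have l1: "T c (a, b) = T c (0, b) + a *\<^sub>R axis 1 1" and l2: "T c (a, b) = T c (a, 0) + b *\<^sub>R axis 2 1"
    and l3: "T c p = T 0 p + c *\<^sub>R axis 3 1" for a b c p
    unfolding T_def coords3_def by (simp_all add: algebra_simps)
  have ax: "axis i (1::real) \<noteq> (0::real^3)" for i by (simp add: axis_eq_0_iff)
  have b1: "U (T c (a, b)) \<le> (\<integral>\<^sup>+a'. W 1 (T c (a', b)) \<partial>lborel)" for a b c
    using square_le_line_integral[OF C K ax[of 1], of "T c (0, b)" a] unfolding l1[symmetric] W_def U_def .
  have b2: "U (T c (a, b)) \<le> (\<integral>\<^sup>+b'. W 2 (T c (a, b')) \<partial>lborel)" for a b c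
    using square_le_line_integral[OF C K ax[of 2], of "T c (a, 0)" b] unfolding l2[symmetric] W_def U_def .
  have b3: "U (T c p) \<le> (\<integral>\<^sup>+c'. W 3 (T c' p) \<partial>lborel)" for c p
    using square_le_line_integral[OF C K ax[of 3], of "T 0 p" c] unfolding l3[symmetric] W_def U_def .
  define N where "N c = (\<integral>\<^sup>+p. U (T c p) \<partial>lborel)" for c
  define D where "D c = (\<integral>\<^sup>+p. G (T c p) \<partial>lborel)" for c
  have fub: "(\<integral>\<^sup>+x. F x \<partial>lborel) = (\<integral>\<^sup>+c. \<integral>\<^sup>+p. F (T c p) \<partial>lborel \<partial>lborel)"
    if "F \<in> borel_measurable borel" for F :: "real^3 \<Rightarrow> ennreal"
    using nn_integral_coords3[OF that] unfolding T_def .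
  define B3 where "B3 = (\<integral>\<^sup>+x. W 3 x \<partial>lborel)"
  have N_le: "N c \<le> B3" for c
  proof -
    have "N c \<le> (\<integral>\<^sup>+p. \<integral>\<^sup>+c'. W 3 (T c' p) \<partial>lborel \<partial>lborel)" unfolding N_def by (intro nn_integral_mono b3)
    also have "\<dots> = (\<integral>\<^sup>+c'. \<integral>\<^sup>+p. W 3 (T c' p) \<partial>lborel \<partial>lborel)"
      by (rule lborel_pair.Fubini'[OF Tp]) measurable
    also have "\<dots> = B3" unfolding B3_def by (rule fub[symmetric]) measurable
    finally show ?thesis .
  qed
  have Wsq: "(\<integral>\<^sup>+p. W i (T c p) \<partial>lborel)\<^sup>2 \<le> 4 * (N c * D c)" for i c
  proof -
    have W: "W i x \<le> ennreal (2 * \<bar>\<phi> x\<bar>) * ennreal (norm (g x))" for x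
    proof -
      have "\<bar>g x \<bullet> axis i 1\<bar> \<le> norm (g x)" using Cauchy_Schwarz_ineq2[of "g x" "axis i 1"] by simp
      then have "2 * \<bar>\<phi> x * (g x \<bullet> axis i 1)\<bar> \<le> 2 * \<bar>\<phi> x\<bar> * norm (g x)" by (simp add: abs_mult mult_left_mono)
      then show ?thesis unfolding W_def by (simp add: ennreal_mult[symmetric] ennreal_leI)
    qed
    have m1: "(\<lambda>p. ennreal (2 * \<bar>\<phi> (T c p)\<bar>)) \<in> borel_measurable lborel" "(\<lambda>p. ennreal (norm (g (T c p)))) \<in> borel_measurable lborel"
      using Tm(1)[of "\<lambda>x. ennreal (2 * \<bar>\<phi> x\<bar>)"] Tm(1)[of "\<lambda>x. ennreal (norm (g x))"] by auto
    have "(\<integral>\<^sup>+p. W i (T c p) \<partial>lborel) \<le> (\<integral>\<^sup>+p. ennreal (2 * \<bar>\<phi> (T c p)\<bar>) * ennreal (norm (g (T c p))) \<partial>lborel)"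
      by (intro nn_integral_mono W)
    then have "(\<integral>\<^sup>+p. W i (T c p) \<partial>lborel)\<^sup>2 \<le> (\<integral>\<^sup>+p. ennreal (2 * \<bar>\<phi> (T c p)\<bar>) * ennreal (norm (g (T c p))) \<partial>lborel)\<^sup>2"
      by (rule power_mono) simp
    also have "\<dots> \<le> (\<integral>\<^sup>+p. (ennreal (2 * \<bar>\<phi> (T c p)\<bar>))\<^sup>2 \<partial>lborel) * (\<integral>\<^sup>+p. (ennreal (norm (g (T c p))))\<^sup>2 \<partial>lborel)"
      by (rule Cauchy_Schwarz_nn_integral[OF m1])
    also have "(\<integral>\<^sup>+p. (ennreal (norm (g (T c p))))\<^sup>2 \<partial>lborel) = D c" unfolding D_def G_def by (simp add: ennreal_power)
    also have "(\<integral>\<^sup>+p. (ennreal (2 * \<bar>\<phi> (T c p)\<bar>))\<^sup>2 \<partial>lborel) = (\<integral>\<^sup>+p. 4 * U (T c p) \<partial>lborel)"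
      unfolding U_def by (intro nn_integral_cong) (simp add: ennreal_power power_mult_distrib ennreal_mult)
    also have "\<dots> = 4 * N c" unfolding N_def by (intro nn_integral_cmult) (use Tm(1)[of U c] in simp)
    finally show ?thesis by (simp add: mult_ac)
  qed
  have slice: "(\<integral>\<^sup>+p. U (T c p) * U (T c p) \<partial>lborel) \<le> 8 * (B3 * D c)" for c
  proof -
    have "(\<integral>\<^sup>+p. U (T c p) * U (T c p) \<partial>lborel) \<le> (\<integral>\<^sup>+p. W 1 (T c p) \<partial>lborel) * (\<integral>\<^sup>+p. W 2 (T c p) \<partial>lborel)"
      by (intro loomis_whitney_plane Tm b1 b2) measurable
    also have "\<dots> \<le> (\<integral>\<^sup>+p. W 1 (T c p) \<partial>lborel)\<^sup>2 + (\<integral>\<^sup>+p. W 2 (T c p) \<partial>lborel)\<^sup>2" by (rule mult_le_sum_squares_ennreal)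
    also have "\<dots> \<le> 4 * (N c * D c) + 4 * (N c * D c)" by (intro add_mono Wsq)
    also have "\<dots> = 8 * (N c * D c)" by (simp add: distrib_right[symmetric])
    also have "\<dots> \<le> 8 * (B3 * D c)" by (intro mult_left_mono mult_right_mono N_le) auto
    finally show ?thesis .
  qed
  have "(\<integral>\<^sup>+x. ennreal ((\<phi> x)^4) \<partial>lborel) = (\<integral>\<^sup>+x. U x * U x \<partial>lborel)"
    unfolding U_def by (intro nn_integral_cong) (simp add: ennreal_mult[symmetric] power2_eq_square power4_eq_xxxx mult_ac)
  also have "\<dots> = (\<integral>\<^sup>+c. \<integral>\<^sup>+p. U (T c p) * U (T c p) \<partial>lborel \<partial>lborel)" by (rule fub) measurable
  also have "\<dots> \<le> (\<integral>\<^sup>+c. 8 * (B3 * D c) \<partial>lborel)" by (intro nn_integral_mono slice)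
  also have "\<dots> = (8 * B3) * (\<integral>\<^sup>+c. D c \<partial>lborel)"
    unfolding mult.assoc[symmetric] D_def by (intro nn_integral_cmult Tc) measurable
  also have "(\<integral>\<^sup>+c. D c \<partial>lborel) = B" unfolding D_def B_def G_def[symmetric] by (rule fub[symmetric]) measurable
  finally have 1: "(\<integral>\<^sup>+x. ennreal ((\<phi> x)^4) \<partial>lborel) \<le> (8 * B3) * B" .
  have "B3 \<le> (\<integral>\<^sup>+x. U x + G x \<partial>lborel)"
    unfolding B3_def
  proof (rule nn_integral_mono)
    fix x
    have "\<bar>g x \<bullet> axis 3 1\<bar> \<le> norm (g x)" using Cauchy_Schwarz_ineq2[of "g x" "axis 3 1"] by simp
    then have "2 * \<bar>\<phi> x * (g x \<bullet> axis 3 1)\<bar> \<le> 2 * \<bar>\<phi> x\<bar> * norm (g x)" by (simp add: abs_mult mult_left_mono)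
    also have "\<dots> \<le> (\<phi> x)\<^sup>2 + (norm (g x))\<^sup>2" using sum_squares_bound[of "\<bar>\<phi> x\<bar>" "norm (g x)"] by simp
    finally show "W 3 x \<le> U x + G x" unfolding W_def U_def G_def by (simp add: ennreal_plus[symmetric] ennreal_leI del: ennreal_plus)
  qed
  also have "\<dots> = A + B" unfolding A_def B_def U_def[symmetric] G_def[symmetric] by (intro nn_integral_add) auto
  finally have "(8 * B3) * B \<le> 8 * ((A + B) * B)" unfolding mult.assoc by (intro mult_left_mono mult_right_mono) auto
  with 1 show ?thesis by (rule order_trans)
qed

section \<open>A Hardy inequality for the second variation\<close>

lemma radial_gradient:
  fixes x :: "'a::euclidean_space"
  assumes "x \<noteq> 0" "(f has_real_derivative d) (at (norm x))"
  shows "((\<lambda>x. f (norm x)) has_derivative (\<lambda>v. ((d / norm x) *\<^sub>R x) \<bullet> v)) (at x)"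
proof -
  have "(f has_derivative (*) d) (at (norm x))" using assms(2) unfolding has_field_derivative_def .
  moreover have "(norm has_derivative (\<lambda>v. sgn x \<bullet> v)) (at x)"
    using has_derivative_norm[OF assms(1)] by (simp add: inner_commute)
  ultimately have "((\<lambda>x. f (norm x)) has_derivative (\<lambda>v. d * (sgn x \<bullet> v))) (at x)"
    by (rule has_derivative_compose[rotated])
  then show ?thesis by (simp add: sgn_div_norm divide_inverse mult.assoc)
qed

lemma gradient_mult:
  assumes "(u has_derivative (\<lambda>v. G \<bullet> v)) (at x)" "(w has_derivative (\<lambda>v. H \<bullet> v)) (at x)"
  shows "((\<lambda>x. u x * w x) has_derivative (\<lambda>v. (u x *\<^sub>R H + w x *\<^sub>R G) \<bullet> v)) (at x)"
  using has_derivative_mult[OF assms] by (simp add: inner_add_left mult.commute)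

lemma divergence_test_fn:
  fixes X :: "'a::euclidean_space \<Rightarrow> 'a"
  assumes U: "open U" and t: "test_fn U \<phi> g" and cX: "continuous_on U X"
    and cD: "\<And>e. e \<in> Basis \<Longrightarrow> continuous_on U (D e)"
    and der: "\<And>x e. x \<in> U \<Longrightarrow> e \<in> Basis \<Longrightarrow> ((\<lambda>s. X (x + s *\<^sub>R e) \<bullet> e) has_real_derivative D e x) (at 0)"
  shows "integral\<^sup>L (lebesgue_on U) (\<lambda>x. X x \<bullet> g x) = - integral\<^sup>L (lebesgue_on U) (\<lambda>x. (\<Sum>e\<in>Basis. D e x) * \<phi> x)"
proof -
  have cXe: "continuous_on U (\<lambda>x. X x \<bullet> e)" for e by (intro continuous_intros cX)
  have "integral\<^sup>L (lebesgue_on U) (\<lambda>x. X x \<bullet> g x) = integral\<^sup>L (lebesgue_on U) (\<lambda>x. \<Sum>e\<in>Basis. (X x \<bullet> e) * (g x \<bullet> e))"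
    by (intro Bochner_Integration.integral_cong refl euclidean_inner)
  also have "\<dots> = (\<Sum>e\<in>Basis. integral\<^sup>L (lebesgue_on U) (\<lambda>x. (X x \<bullet> e) * (g x \<bullet> e)))"
    by (rule Bochner_Integration.integral_sum) (rule integrable_mult_test(2)[OF U cXe t])
  also have "\<dots> = (\<Sum>e\<in>Basis. - integral\<^sup>L (lebesgue_on U) (\<lambda>x. D e x * \<phi> x))"
    by (intro sum.cong refl integration_by_parts_test_fn[OF U t cXe cD der])
  also have "\<dots> = - integral\<^sup>L (lebesgue_on U) (\<lambda>x. \<Sum>e\<in>Basis. D e x * \<phi> x)"
    unfolding sum_negf by (subst Bochner_Integration.integral_sum) (auto intro: integrable_mult_test(1)[OF U cD t])
  finally show ?thesis by (simp add: sum_distrib_right)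
qed

text \<open>Completing the square: \<open>\<bar>g - \<phi> X\<bar>\<^sup>2 \<ge> 0\<close> and the divergence theorem for \<open>\<phi>\<^sup>2 X\<close>.\<close>
lemma hardy_vector_field:
  fixes X :: "'a::euclidean_space \<Rightarrow> 'a"
  assumes U: "open U" and t: "test_fn U \<phi> g" and cX: "continuous_on U X"
    and cD: "\<And>e. e \<in> Basis \<Longrightarrow> continuous_on U (D e)"
    and der: "\<And>x e. x \<in> U \<Longrightarrow> e \<in> Basis \<Longrightarrow> ((\<lambda>s. X (x + s *\<^sub>R e) \<bullet> e) has_real_derivative D e x) (at 0)"
    and cc: "continuous_on U c"
    and ineq: "\<And>x. x \<in> U \<Longrightarrow> (\<Sum>e\<in>Basis. D e x) + (norm (X x))\<^sup>2 \<le> c x - \<epsilon>"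
  shows "\<epsilon> * integral\<^sup>L (lebesgue_on U) (\<lambda>x. (\<phi> x)\<^sup>2) \<le> integral\<^sup>L (lebesgue_on U) (\<lambda>x. (norm (g x))\<^sup>2 + c x * (\<phi> x)\<^sup>2)"
proof -
  let ?M = "lebesgue_on U"
  obtain K where K: "compact K" "K \<subseteq> U" "\<And>x. x \<notin> K \<Longrightarrow> \<phi> x = 0" "\<And>x. x \<notin> K \<Longrightarrow> g x = 0"
    using test_fn_grad_zero[OF t] by blast
  have C: "C1_fn \<phi> g" using t unfolding test_fn_C1 by blast
  have c: "continuous_on U \<phi>" "continuous_on U g"
    using C C1_fn_continuous[OF C] continuous_on_subset unfolding C1_fn_def by blast+
  have t2: "test_fn U (\<lambda>x. \<phi> x * \<phi> x) (\<lambda>x. \<phi> x *\<^sub>R g x + \<phi> x *\<^sub>R g x)"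
    unfolding test_fn_C1 using C1_fn_mult[OF C C] K by auto
  have cS: "continuous_on U (\<lambda>x. \<Sum>e\<in>Basis. D e x)" by (intro continuous_intros cD)
  have int: "integrable ?M f" if "continuous_on U f" "\<And>x. x \<notin> K \<Longrightarrow> f x = 0" for f :: "'a \<Rightarrow> real"
    using that K by (intro lebesgue_on_zero_extension(2)[OF U that(1) K(1)]) auto
  have i: "integrable ?M (\<lambda>x. (norm (g x))\<^sup>2 + c x * (\<phi> x)\<^sup>2)" "integrable ?M (\<lambda>x. (\<phi> x)\<^sup>2)"
      "integrable ?M (\<lambda>x. X x \<bullet> (\<phi> x *\<^sub>R g x + \<phi> x *\<^sub>R g x))" "integrable ?M (\<lambda>x. (\<Sum>e\<in>Basis. D e x) * (\<phi> x * \<phi> x))"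
      "integrable ?M (\<lambda>x. \<epsilon> * (\<phi> x)\<^sup>2 + (\<Sum>e\<in>Basis. D e x) * (\<phi> x * \<phi> x) + X x \<bullet> (\<phi> x *\<^sub>R g x + \<phi> x *\<^sub>R g x))"
    by (intro int continuous_intros c cc cX cS; simp add: K)+
  have "\<epsilon> * integral\<^sup>L ?M (\<lambda>x. (\<phi> x)\<^sup>2) = integral\<^sup>L ?M (\<lambda>x. \<epsilon> * (\<phi> x)\<^sup>2 + (\<Sum>e\<in>Basis. D e x) * (\<phi> x * \<phi> x) + X x \<bullet> (\<phi> x *\<^sub>R g x + \<phi> x *\<^sub>R g x))"
    using divergence_test_fn[OF U t2 cX cD der] i by simp
  also have "\<dots> \<le> integral\<^sup>L ?M (\<lambda>x. (norm (g x))\<^sup>2 + c x * (\<phi> x)\<^sup>2)"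
  proof (rule integral_mono[OF i(5) i(1)])
    fix x assume "x \<in> space ?M"
    then have x: "x \<in> U" by simp
    have "0 \<le> (norm (g x - \<phi> x *\<^sub>R X x))\<^sup>2" by simp
    also have "\<dots> = (norm (g x))\<^sup>2 - 2 * \<phi> x * (X x \<bullet> g x) + (norm (X x))\<^sup>2 * (\<phi> x)\<^sup>2"
      unfolding power2_norm_eq_inner by (simp add: inner_diff_left inner_diff_right inner_commute power2_eq_square algebra_simps)
    finally have 1: "2 * \<phi> x * (X x \<bullet> g x) \<le> (norm (g x))\<^sup>2 + (norm (X x))\<^sup>2 * (\<phi> x)\<^sup>2" by simp
    have "((\<Sum>e\<in>Basis. D e x) + (norm (X x))\<^sup>2) * (\<phi> x)\<^sup>2 \<le> (c x - \<epsilon>) * (\<phi> x)\<^sup>2"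
      by (intro mult_right_mono ineq x) simp
    then show "\<epsilon> * (\<phi> x)\<^sup>2 + (\<Sum>e\<in>Basis. D e x) * (\<phi> x * \<phi> x) + X x \<bullet> (\<phi> x *\<^sub>R g x + \<phi> x *\<^sub>R g x)
       \<le> (norm (g x))\<^sup>2 + c x * (\<phi> x)\<^sup>2"
      using 1 by (simp add: inner_add_right power2_eq_square algebra_simps)
  qed
  finally show ?thesis .
qed

section \<open>Radial vector fields on the shell\<close>

lemma open_shell_int: "open (shell_int R)"
proof -
  have "shell_int R = norm -` {1<..<R}" unfolding shell_int_def by auto
  then show ?thesis by (auto intro!: open_vimage continuous_intros)
qed

lemma continuous_on_radial:
  "continuous_on {1<..<R} f \<Longrightarrow> continuous_on (shell_int R) (\<lambda>x. f (norm x))"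
  by (rule continuous_on_compose2[where f=norm]) (auto simp: shell_int_def intro!: continuous_intros)

lemma shell_int_D: "x \<in> shell_int R \<Longrightarrow> 1 < norm x \<and> norm x < R \<and> x \<noteq> 0"
  unfolding shell_int_def by auto

text \<open>For the field \<open>\<xi> (norm x) *\<^sub>R x\<close> in dimension three, the
  divergence is \<open>3 * \<xi> + r * \<xi>'\<close> and the squared length is
  \<open>r^2 * \<xi>^2\<close>.\<close>

lemma hardy_radial:
  assumes t: "test_fn (shell_int R) \<phi> g"
    and d: "\<And>r. 1 < r \<Longrightarrow> r < R \<Longrightarrow> (\<xi> has_real_derivative \<xi>' r) (at r)" and c\<xi>: "continuous_on {1<..<R} \<xi>'"
    and cc: "continuous_on {1<..<R} c"
    and ineq: "\<And>r. 1 < r \<Longrightarrow> r < R \<Longrightarrow> 3 * \<xi> r + r * \<xi>' r + r\<^sup>2 * (\<xi> r)\<^sup>2 \<le> c r - \<epsilon>"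
  shows "\<epsilon> * integral\<^sup>L (lebesgue_on (shell_int R)) (\<lambda>x. (\<phi> x)\<^sup>2)
    \<le> integral\<^sup>L (lebesgue_on (shell_int R)) (\<lambda>x. (norm (g x))\<^sup>2 + c (norm x) * (\<phi> x)\<^sup>2)"
proof (rule hardy_vector_field[OF open_shell_int t, where X="\<lambda>x. \<xi> (norm x) *\<^sub>R x"
      and D="\<lambda>e x. \<xi>' (norm x) / norm x * (x \<bullet> e)\<^sup>2 + \<xi> (norm x)"])
  have c: "continuous_on {1<..<R} \<xi>" using d by (intro continuous_at_imp_continuous_on ballI DERIV_isCont[OF d]) auto
  have cn: "continuous_on (shell_int R) (\<lambda>x. 1 / norm x)" by (intro continuous_intros) (auto simp: shell_int_D)
  show "continuous_on (shell_int R) (\<lambda>x. \<xi> (norm x) *\<^sub>R x)" by (intro continuous_intros continuous_on_radial[OF c])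
  show "continuous_on (shell_int R) (\<lambda>x. \<xi>' (norm x) / norm x * (x \<bullet> e)\<^sup>2 + \<xi> (norm x))" for e
    by (intro continuous_intros continuous_on_radial[OF c] continuous_on_radial[OF c\<xi>]) (auto simp: shell_int_D)
  show "continuous_on (shell_int R) (\<lambda>x. c (norm x))" by (rule continuous_on_radial[OF cc])
  fix x :: "real^3" assume x: "x \<in> shell_int R"
  then have r: "1 < norm x" "norm x < R" "x \<noteq> 0" using shell_int_D by auto
  show "((\<lambda>s. \<xi> (norm (x + s *\<^sub>R e)) *\<^sub>R (x + s *\<^sub>R e) \<bullet> e) has_real_derivative \<xi>' (norm x) / norm x * (x \<bullet> e)\<^sup>2 + \<xi> (norm x)) (at 0)"
    if e: "e \<in> Basis" for e
  proof -
    have "((\<lambda>x. x \<bullet> e) has_derivative (\<lambda>v. e \<bullet> v)) (at x)" by (auto intro!: derivative_eq_intros simp: inner_commute)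
    from gradient_directional[OF gradient_mult[OF radial_gradient[OF r(3) d[OF r(1,2)]] this], of e]
    show ?thesis using e by (simp add: inner_add_left power2_eq_square algebra_simps)
  qed
  have "(\<Sum>e\<in>Basis. (x \<bullet> e)\<^sup>2) = (norm x)\<^sup>2"
    unfolding power2_norm_eq_inner euclidean_inner[of x x] by (simp add: power2_eq_square)
  then have "(\<Sum>e\<in>Basis. \<xi>' (norm x) / norm x * (x \<bullet> e)\<^sup>2 + \<xi> (norm x)) = \<xi>' (norm x) / norm x * (norm x)\<^sup>2 + 3 * \<xi> (norm x)"
    by (simp add: sum.distrib sum_distrib_left[symmetric] sum_divide_distrib[symmetric])
  also have "\<dots> = norm x * \<xi>' (norm x) + 3 * \<xi> (norm x)" using r by (simp add: power2_eq_square)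
  finally show "(\<Sum>e\<in>Basis. \<xi>' (norm x) / norm x * (x \<bullet> e)\<^sup>2 + \<xi> (norm x)) + (norm (\<xi> (norm x) *\<^sub>R x))\<^sup>2 \<le> c (norm x) - \<epsilon>"
    using ineq[OF r(1,2)] by (simp add: power_mult_distrib algebra_simps)
qed

text \<open>The summand \<open>k / (r * h)\<close> is the coefficient of \<open>x\<close> in the
  gradient of \<open>ln h\<close>; alone it contributes the Laplacian of \<open>h\<close> over
  \<open>h\<close>, that is \<open>c + 6 / r^2\<close>. Dividing \<open>z\<close> by
  \<open>h^2\<close> in the second summand makes the cross term cancel against the derivative of
  \<open>1 / h^2\<close>, so \<open>k\<close> drops out of the result.\<close>

lemma riccati_algebra:
  fixes r h k c z z' :: real
  assumes r: "r > 0" and h: "h > 0" and k2: "r\<^sup>2 * k2 + 2 * r * k = 6 * h + r\<^sup>2 * (h * c)"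
  shows "3 * (k / (r * h) + z / (r\<^sup>2 * h\<^sup>2))
     + r * (k2 / (r * h) - k / (r\<^sup>2 * h) - k\<^sup>2 / (r * h\<^sup>2) + z' / (r\<^sup>2 * h\<^sup>2) - 2 * z / (r^3 * h\<^sup>2) - 2 * z * k / (r\<^sup>2 * h^3))
     + r\<^sup>2 * (k / (r * h) + z / (r\<^sup>2 * h\<^sup>2))\<^sup>2
    = c + (6 * (h\<^sup>2)\<^sup>2 + (r * z' + z) * h\<^sup>2 + z\<^sup>2) / (r\<^sup>2 * (h\<^sup>2)\<^sup>2)"
proof -
  have k2': "k2 = 6 * h / r\<^sup>2 + h * c - 2 * k / r"
  proof -
    have "r\<^sup>2 * (6 * h / r\<^sup>2 + h * c - 2 * k / r) = 6 * h + r\<^sup>2 * (h * c) - 2 * r * k"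
      using r by (simp add: distrib_left right_diff_distrib power2_eq_square)
    then have "r\<^sup>2 * k2 = r\<^sup>2 * (6 * h / r\<^sup>2 + h * c - 2 * k / r)" using k2 by simp
    then show ?thesis using r by simp
  qed
  \<comment> \<open>Naming the reciprocals makes the claim a polynomial identity modulo
    \<open>u * r = 1\<close> and \<open>v * h = 1\<close>.\<close>
  define u v where "u = 1 / r" and "v = 1 / h"
  have uv: "u * r = 1" "v * h = 1" unfolding u_def v_def using r h by auto
  have e: "a / r = a * u" "a / h = a * v" "a / (r * b) = a * u * (1 / b)" "a / (h * b) = a * v * (1/b)" for a b :: real
    unfolding u_def v_def by simp_all
  have e1: "a / (r * h) = a * u * v" "a / (r\<^sup>2 * h\<^sup>2) = a * u^2 * v^2" "a / (r\<^sup>2 * h) = a * u^2 * v" "a / (r * h\<^sup>2) = a * u * v^2"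
    "a / (r^3 * h\<^sup>2) = a * u^3 * v^2" "a / (r\<^sup>2 * h^3) = a * u^2 * v^3" "a / (r\<^sup>2 * (h\<^sup>2)\<^sup>2) = a * u^2 * v^4" "a / r\<^sup>2 = a * u^2" "a / r = a * u" for a
    unfolding u_def v_def by (simp_all add: power_divide power_mult_distrib)
  show ?thesis unfolding k2' e1 using uv by algebra
qed

text \<open>A convex quadratic lies below its chord between 4/9 and 1; the identity in the proof
  displays the chord and the nonpositive correction.\<close>

lemma quadratic_nonpos_between:
  fixes q B C :: real
  assumes q: "4/9 \<le> q" "q \<le> 1" and 1: "6 + B + C \<le> 0" and 2: "6 * (4/9)\<^sup>2 + B * (4/9) + C \<le> 0"
  shows "6 * q\<^sup>2 + B * q + C \<le> 0"
proof -
  have "(q - 4/9) * (6 + B + C) \<le> 0" using q 1 by (simp add: mult_nonneg_nonpos)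
  moreover have "(1 - q) * (6 * (4/9)\<^sup>2 + B * (4/9) + C) \<le> 0" using q 2 by (simp add: mult_nonneg_nonpos)
  moreover have "(q - 4/9) * (1 - q) \<ge> 0" using q by simp
  moreover have "5/9 * (6 * q\<^sup>2 + B * q + C) = (q - 4/9) * (6 + B + C) + (1 - q) * (6 * (4/9)\<^sup>2 + B * (4/9) + C) - 10/3 * ((q - 4/9) * (1 - q))"
    by (simp add: power2_eq_square field_simps)
  ultimately have "5/9 * (6 * q\<^sup>2 + B * q + C) \<le> 0" by argo
  then show ?thesis by simp
qed

text \<open>With \<open>q = h\<^sup>2\<close> and \<open>\<tau> = tan (11/3 (ln r - ln R / 2))\<close>, the left-hand side is \<open>q\<close> times
  \<open>r z' + z + z\<^sup>2 / q + 6 q\<close>. The constants are chosen so that at \<open>q = 4/9\<close> both the linear and the quadratic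
  terms in \<open>\<tau>\<close> cancel.\<close>
lemma riccati_bound:
  fixes \<tau> q :: real
  assumes q: "4/9 \<le> q" "q \<le> 1"
  defines "z \<equiv> - 2/9 - 44/27 * \<tau>"
  shows "6 * q\<^sup>2 + (- (44/27) * (11/3) * (1 + \<tau>\<^sup>2) + z) * q + z\<^sup>2 \<le> - q / 20"
proof -
  have "6 * q\<^sup>2 + (- (44/27) * (11/3) * (1 + \<tau>\<^sup>2) + z + 1/20) * q + z\<^sup>2 \<le> 0"
  proof (rule quadratic_nonpos_between[OF q])
    \<comment> \<open>At \<open>q = 1\<close> the expression is a concave quadratic in
      \<open>\<tau>\<close>. Completing the square leaves \<open>5/81 - 12/81 + 1/20\<close>, which
      is negative; the margin 7/81 is what pays for the term 1/20.\<close>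
    have "6 + (- (44/27) * (11/3) * (1 + \<tau>\<^sup>2) + z + 1/20) + z\<^sup>2 = - (2420/729) * (\<tau> + 27/198)\<^sup>2 + 2420/729 * (27/198)\<^sup>2 - 12/81 + 1/20"
      unfolding z_def by (simp add: power2_eq_square field_simps)
    also have "\<dots> \<le> 2420/729 * (27/198)\<^sup>2 - 12/81 + 1/20" by simp
    also have "\<dots> \<le> (0::real)" by (simp add: power2_eq_square)
    finally show "6 + (- (44/27) * (11/3) * (1 + \<tau>\<^sup>2) + z + 1/20) + z\<^sup>2 \<le> 0" .
    show "6 * (4/9)\<^sup>2 + (- (44/27) * (11/3) * (1 + \<tau>\<^sup>2) + z + 1/20) * (4/9) + z\<^sup>2 \<le> 0"
      unfolding z_def by (simp add: power2_eq_square field_simps)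
  qed
  then show ?thesis by (simp add: algebra_simps)
qed

text \<open>This keeps the tangent in the Hardy field away from its poles. Centering at the
  logarithmic midpoint leaves only half of \<open>ln R\<close> to be multiplied by 11/3.\<close>

lemma ln_ratio_bound: 
  assumes "1 < R" "R < 9/4" "1 < r" "r < R"
  shows "\<bar>11/3 * (ln r - ln R / 2)\<bar> < pi / 2"
proof -
  have "(9/4::real) \<le> (1 + 83/200 + (83/200)\<^sup>2 / 2)\<^sup>2" by (simp add: power2_eq_square)
  also have "\<dots> \<le> (exp (83/200))\<^sup>2" by (intro power_mono exp_lower_Taylor_quadratic) auto
  also have "\<dots> = exp (83/100)" by (simp add: power2_eq_square exp_add[symmetric])
  finally have "R < exp (83/100)" using assms by simp
  then have "ln R < 83/100" using assms ln_less_cancel_iff[of R "exp (83/100)"] by simp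
  moreover have "0 < ln r" "ln r < ln R" using assms by auto
  moreover have "pi > 31/10" using pi_approx(1) by simp
  ultimately show ?thesis by (auto simp: abs_less_iff field_simps)
qed

text \<open>The field is \<open>\<nabla> ln h + z x / (r\<^sup>2 h\<^sup>2)\<close>. The first summand alone would give the potential \<open>c + 6 / r\<^sup>2\<close>, because
  \<open>h\<close> solves the Euler-Lagrange equation; the second one absorbs \<open>6 / r\<^sup>2\<close>.\<close>
lemma second_variation_coercive:
  assumes R: "1 < R" "R < 9/4" and t: "test_fn (shell_int R) \<phi> g"
    and d: "\<And>r. 1 < r \<Longrightarrow> r < R \<Longrightarrow> (h has_real_derivative k r) (at r)"
    and d2: "\<And>r. 1 < r \<Longrightarrow> r < R \<Longrightarrow> (k has_real_derivative l r) (at r)" and cl: "continuous_on {1<..<R} l"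
    and ode: "\<And>r. 1 < r \<Longrightarrow> r < R \<Longrightarrow> r\<^sup>2 * l r + 2 * r * k r = 6 * h r + r\<^sup>2 * (h r * c r)"
    and hb: "\<And>r. 1 < r \<Longrightarrow> r < R \<Longrightarrow> 2/3 \<le> h r" "\<And>r. 1 < r \<Longrightarrow> r < R \<Longrightarrow> h r \<le> 1"
    and cc: "continuous_on {1<..<R} c"
  shows "1 / (20 * R\<^sup>2) * integral\<^sup>L (lebesgue_on (shell_int R)) (\<lambda>x. (\<phi> x)\<^sup>2)
    \<le> integral\<^sup>L (lebesgue_on (shell_int R)) (\<lambda>x. (norm (g x))\<^sup>2 + c (norm x) * (\<phi> x)\<^sup>2)"
proof -
  \<comment> \<open>The frequency 11/3 lies in a narrow window. With
    \<open>44/27 = 4/9 * 11/3\<close> scaled along, it must exceed \<open>sqrt 53 / 2\<close>, about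
    3.64, for the case \<open>q = 1\<close> of \<open>riccati_bound\<close> to hold with a positive
    surplus. It must stay below \<open>pi / ln (9/4)\<close>, about 3.87, for the tangent to be
    finite on all shells with \<open>R < 9/4\<close>.\<close>
  define \<alpha> where "\<alpha> r = 11/3 * (ln r - ln R / 2)" for r
  define z where "z r = - 2/9 - 44/27 * tan (\<alpha> r)" for r
  define z' where "z' r = - (44/27) * (11/3) * (1 + (tan (\<alpha> r))\<^sup>2) / r" for r
  have cos: "cos (\<alpha> r) \<noteq> 0" if "1 < r" "r < R" for r
  proof -
    have "\<bar>\<alpha> r\<bar> < pi / 2" unfolding \<alpha>_def by (rule ln_ratio_bound[OF R that])
    then have "0 < cos (\<alpha> r)" by (intro cos_gt_zero_pi) linarith+
    then show ?thesis by simp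
  qed
  have d\<alpha>: "(\<alpha> has_real_derivative 11/3 / r) (at r)" if "1 < r" for r
    unfolding \<alpha>_def[abs_def] using that by (auto intro!: derivative_eq_intros simp: field_simps)
  have dz: "(z has_real_derivative z' r) (at r)" if r: "1 < r" "r < R" for r
  proof -
    have "((\<lambda>r. tan (\<alpha> r)) has_real_derivative inverse ((cos (\<alpha> r))\<^sup>2) * (11/3 / r)) (at r)"
      by (rule DERIV_chain2[OF DERIV_tan[OF cos[OF r]] d\<alpha>[OF r(1)]])
    then have "((\<lambda>r. tan (\<alpha> r)) has_real_derivative (1 + (tan (\<alpha> r))\<^sup>2) * (11/3 / r)) (at r)"
      using tan_sec[OF cos[OF r]] by (simp add: power_inverse)
    from DERIV_diff[OF DERIV_const DERIV_cmult[OF this, of "44/27"]] show ?thesis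
      unfolding z_def[abs_def] z'_def by (rule DERIV_cong) simp
  qed
  have ch: "continuous_on {1<..<R} h" "continuous_on {1<..<R} k" "continuous_on {1<..<R} z"
    by (intro continuous_at_imp_continuous_on ballI; auto intro: DERIV_isCont d d2 dz)+
  have c\<alpha>: "continuous_on {1<..<R} (\<lambda>r. tan (\<alpha> r))"
  proof -
    have "continuous_on {1<..<R} (\<lambda>r. (- 2/9 - z r) / (44/27))" by (intro continuous_intros ch) auto
    moreover have "(\<lambda>r. (- 2/9 - z r) / (44/27)) = (\<lambda>r. tan (\<alpha> r))" by (auto simp: z_def fun_eq_iff)
    ultimately show ?thesis by metis
  qed
  have cz': "continuous_on {1<..<R} z'" unfolding z'_def by (intro continuous_intros c\<alpha>) auto
  have nz: "r \<noteq> 0" "h r \<noteq> 0" "0 < h r" if "1 < r" "r < R" for r using hb(1)[OF that] that by auto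
  define \<xi> where "\<xi> r = k r / (r * h r) + z r / (r\<^sup>2 * (h r)\<^sup>2)" for r
  define \<xi>' where "\<xi>' r = l r / (r * h r) - k r / (r\<^sup>2 * h r) - (k r)\<^sup>2 / (r * (h r)\<^sup>2) + z' r / (r\<^sup>2 * (h r)\<^sup>2) - 2 * z r / (r^3 * (h r)\<^sup>2) - 2 * z r * k r / (r\<^sup>2 * (h r)^3)" for r
  show ?thesis
  proof (rule hardy_radial[OF t, of \<xi> \<xi>'])
    show "continuous_on {1<..<R} c" by (rule cc)
    show "continuous_on {1<..<R} \<xi>'" unfolding \<xi>'_def using nz by (intro continuous_intros cl ch cz') auto
    fix r assume r: "1 < r" "r < R"
    note n = nz[OF r]
    have 1: "((\<lambda>r. k r / (r * h r)) has_real_derivative l r / (r * h r) - k r / (r\<^sup>2 * h r) - (k r)\<^sup>2 / (r * (h r)\<^sup>2)) (at r)"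
      using n by (auto intro!: derivative_eq_intros d[OF r] d2[OF r] simp: field_simps power2_eq_square)
    have 2: "((\<lambda>r. z r / (r\<^sup>2 * (h r)\<^sup>2)) has_real_derivative z' r / (r\<^sup>2 * (h r)\<^sup>2) - 2 * z r / (r^3 * (h r)\<^sup>2) - 2 * z r * k r / (r\<^sup>2 * (h r)^3)) (at r)"
      using n by (auto intro!: derivative_eq_intros d[OF r] dz[OF r] simp: field_simps power2_eq_square power3_eq_cube)
    show "(\<xi> has_real_derivative \<xi>' r) (at r)"
      unfolding \<xi>_def[abs_def] \<xi>'_def using DERIV_add[OF 1 2] by (simp add: algebra_simps)
    have q: "4/9 \<le> (h r)\<^sup>2" "(h r)\<^sup>2 \<le> 1"
      using power_mono[OF hb(1)[OF r], of 2] power_mono[OF hb(2)[OF r], of 2] n by (auto simp: power2_eq_square)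
    have rz: "r * z' r = - (44/27) * (11/3) * (1 + (tan (\<alpha> r))\<^sup>2)" unfolding z'_def using n by simp
    have "6 * ((h r)\<^sup>2)\<^sup>2 + (r * z' r + z r) * (h r)\<^sup>2 + (z r)\<^sup>2 \<le> - (h r)\<^sup>2 / 20"
      unfolding rz unfolding z_def by (rule riccati_bound[OF q])
    then have "(6 * ((h r)\<^sup>2)\<^sup>2 + (r * z' r + z r) * (h r)\<^sup>2 + (z r)\<^sup>2) / (r\<^sup>2 * ((h r)\<^sup>2)\<^sup>2) \<le> (- (h r)\<^sup>2 / 20) / (r\<^sup>2 * ((h r)\<^sup>2)\<^sup>2)"
      by (rule divide_right_mono) simp
    also have "\<dots> = - (1 / (20 * (r\<^sup>2 * (h r)\<^sup>2)))" using n by (simp add: power2_eq_square)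
    also have "\<dots> \<le> - (1 / (20 * R\<^sup>2))"
    proof -
      have "r\<^sup>2 * (h r)\<^sup>2 \<le> R\<^sup>2 * 1" using r q by (intro mult_mono power_mono) auto
      moreover have "0 < r\<^sup>2 * (h r)\<^sup>2" using n r by simp
      ultimately show ?thesis by (simp add: frac_le)
    qed
    finally show "3 * \<xi> r + r * \<xi>' r + r\<^sup>2 * (\<xi> r)\<^sup>2 \<le> c r - 1 / (20 * R\<^sup>2)"
      unfolding \<xi>_def \<xi>'_def using riccati_algebra[OF _ n(3) ode[OF r], of "z r" "z' r"] r by simp
  qed
qed

section \<open>Expansion of the bulk energy\<close>

definition frob :: "real^3^3 \<Rightarrow> real^3^3 \<Rightarrow> real" where
  "frob A B = (\<Sum>i\<in>UNIV. \<Sum>j\<in>UNIV. A $ i $ j * B $ i $ j)"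

definition uniaxial :: "real \<Rightarrow> real^3 \<Rightarrow> real^3^3" where
  "uniaxial a n = (\<chi> i j. a * (n $ i * n $ j - (if i = j then 1/3 else 0)))"

lemma norm_eq_1_sum: "norm n = 1 \<Longrightarrow> (n $ 1)\<^sup>2 + (n $ 2)\<^sup>2 + (n $ 3)\<^sup>2 = (1::real)" for n :: "real^3"
  unfolding norm_vec_def L2_set_def sum3 by simp

lemma fnorm2_add: "fnorm2 (A + B) = fnorm2 A + 2 * frob A B + fnorm2 B"
  unfolding fnorm2_def frob_def sum3 by (simp add: power2_eq_square algebra_simps)

lemma trace_cube_add:
  "trace ((A + B) ** (A + B) ** (A + B)) = trace (A ** A ** A) + 3 * trace (A ** A ** B) + 3 * trace (A ** B ** B) + trace (B ** B ** (B :: real^3^3))"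
proof -
  have r: "trace (X ** Y ** Z) = trace (Z ** X ** Y)" for X Y Z :: "real^3^3"
    by (subst trace_mul_sym) (simp add: matrix_mul_assoc)
  have d: "(X + Y) ** Z = X ** Z + Y ** Z" for X Y Z :: "real^3^3"
    by (simp add: matrix_matrix_mult_def vec_eq_iff distrib_right sum.distrib)
  have "(A + B) ** (A + B) ** (A + B) = A ** A ** A + A ** A ** B + A ** B ** A + A ** B ** B + B ** A ** A + B ** A ** B + B ** B ** A + B ** B ** B"
    by (simp add: matrix_add_ldistrib d algebra_simps)
  then show ?thesis using r[of A B A] r[of B A A] r[of B A B] r[of B B A] r[of A A B] r[of A B B]
    by (simp add: trace_add)
qed

text \<open>The square is a combination of the matrix itself and the identity. Against a traceless
  \<open>V\<close> the identity part vanishes, so the linear term of the cubic energy at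
  \<open>H\<close> is a multiple of \<open>frob H V\<close>, as are the other linear terms.\<close>

lemma uniaxial_square:
  assumes n: "norm n = 1"
  shows "uniaxial a n ** uniaxial a n = (\<chi> i j. a / 3 * (uniaxial a n $ i $ j) + (if i = j then 2 * a\<^sup>2 / 9 else 0))"
proof -
  have "(n $ 1)\<^sup>2 + (n $ 2)\<^sup>2 + (n $ 3)\<^sup>2 = 1" by (rule norm_eq_1_sum[OF n])
  then have s: "n $ 3 * n $ 3 = 1 - n $ 1 * n $ 1 - n $ 2 * n $ 2" by (simp add: power2_eq_square)
  show ?thesis
    unfolding matrix_matrix_mult_def uniaxial_def vec_eq_iff forall_3
    using s by (simp add: sum3 power2_eq_square; algebra)
qed

lemma fnorm2_uniaxial: assumes "norm n = 1" shows "fnorm2 (uniaxial a n) = 2/3 * a\<^sup>2"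
proof -
  have "(n $ 1)\<^sup>2 + (n $ 2)\<^sup>2 + (n $ 3)\<^sup>2 = 1" by (rule norm_eq_1_sum[OF assms])
  then show ?thesis unfolding fnorm2_def uniaxial_def sum3 by (simp add: field_simps; algebra)
qed

lemma uniaxial_S0: assumes "norm n = 1" shows "uniaxial a n \<in> S0"
proof -
  have "(n $ 1)\<^sup>2 + (n $ 2)\<^sup>2 + (n $ 3)\<^sup>2 = 1" by (rule norm_eq_1_sum[OF assms])
  then have "trace (uniaxial a n) = 0" unfolding trace_def uniaxial_def sum3 by (simp add: field_simps; algebra)
  then show ?thesis unfolding S0_def by (simp add: transpose_def uniaxial_def vec_eq_iff mult.commute)
qed

lemma trace_mult_symmetric: "transpose B = B \<Longrightarrow> trace (A ** B) = frob A B" for A B :: "real^3^3"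
proof -
  assume "transpose B = B"
  then have "B $ i $ j = B $ j $ i" for i j by (rule transpose_eq_nth)
  then show ?thesis unfolding trace_def matrix_matrix_mult_def frob_def by simp
qed

definition bulk :: "real \<Rightarrow> real^3^3 \<Rightarrow> real" where
  "bulk t Q = t / 8 * (1 - fnorm2 Q)\<^sup>2 + hplus t / 8 * (1 + 3 * (fnorm2 Q)\<^sup>2 - 4 * sqrt 6 * trace (Q ** Q ** Q))"

text \<open>The expansion is exact. The terms with \<open>bulk_coeff\<close> go to the
  Euler-Lagrange equation and to the Hardy inequality; everything else of second, third and fourth
  order is kept together in a square and in the expression of \<open>matrix_ineq\<close>. The link
  between the two forms is
  \<open>sqrt 6 * h * (n \<bullet> (V *v n)) = 2 * frob H V\<close>.\<close>

lemma bulk_uniaxial_add: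
  fixes h :: real
  assumes n: "norm n = 1" and V: "V \<in> S0"
  defines "H \<equiv> uniaxial (sqrt (3/2) * h) n"
  shows "bulk t (H + V) - bulk t H = bulk_coeff t h * frob H V + bulk_coeff t h / 2 * fnorm2 V
    + t / 8 * (2 * frob H V + fnorm2 V)\<^sup>2
    + hplus t / 8 * (18 * h * fnorm2 V - 36 * h * (norm (V *v n))\<^sup>2
      + 3 * (sqrt 6 * h * (n \<bullet> (V *v n)) + fnorm2 V)\<^sup>2 - 4 * sqrt 6 * trace (V ** V ** V))"
proof -
  define s where "s = sqrt (3/2)"
  have s2: "s * s = 3/2" unfolding s_def by simp
  have s6: "sqrt 6 = 2 * s"
  proof -
    have "sqrt 6 = sqrt (4 * (3/2))" by simp
    also have "\<dots> = 2 * s" unfolding real_sqrt_mult s_def by simp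
    finally show ?thesis .
  qed
  have Vs: "transpose V = V" and Vt: "trace V = 0" using V unfolding S0_def by auto
  have Vsym: "V $ i $ j = V $ j $ i" for i j by (rule transpose_eq_nth[OF Vs])
  have tr: "V$1$1 + V$2$2 + V$3$3 = 0" using Vt by (simp add: trace_def sum3)
  have Hnth: "H $ i $ j = s * h * (n $ i * n $ j - (if i = j then 1/3 else 0))" for i j
    unfolding H_def uniaxial_def s_def by simp
  have fH: "fnorm2 H = h\<^sup>2" unfolding H_def fnorm2_uniaxial[OF n] by (simp add: power_mult_distrib)
  have HV: "frob H V = s * h * (n \<bullet> (V *v n))"
  proof -
    have "frob H V = s * h * (n \<bullet> (V *v n)) - s * h / 3 * (V$1$1 + V$2$2 + V$3$3)"
      unfolding frob_def Hnth inner_vec_def matrix_vector_mult_def sum3 by (simp add: sum3 algebra_simps)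
    then show ?thesis using tr by simp
  qed
  have HHV: "trace (H ** H ** V) = s * h / 3 * frob H V"
  proof -
    have "trace (H ** H ** V) = s * h / 3 * frob H V + 2 * (s * h)\<^sup>2 / 9 * (V$1$1 + V$2$2 + V$3$3)"
      unfolding trace_mult_symmetric[OF Vs] frob_def unfolding H_def uniaxial_square[OF n] sum3 s_def
      by (simp add: algebra_simps)
    then show ?thesis using tr by simp
  qed
  have HVV: "trace (H ** V ** V) = s * h * ((norm (V *v n))\<^sup>2 - fnorm2 V / 3)"
  proof -
    have st: "transpose (V ** V) = V ** V" by (simp add: matrix_transpose_mul Vs)
    have "trace (H ** V ** V) = frob H (V ** V)" using trace_mult_symmetric[OF st] by (simp add: matrix_mul_assoc)
    also have "\<dots> = s * h * ((norm (V *v n))\<^sup>2 - fnorm2 V / 3)"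
      unfolding frob_def Hnth fnorm2_def power2_norm_eq_inner inner_vec_def matrix_vector_mult_def matrix_matrix_mult_def
      by (simp add: sum3 Vsym[of 2 1] Vsym[of 3 1] Vsym[of 3 2] power2_eq_square field_simps)
    finally show ?thesis .
  qed
  define Y W F T where "Y = frob H V" and "W = (norm (V *v n))\<^sup>2" and "F = fnorm2 V" and "T = trace (V ** V ** V)"
  have snV: "sqrt 6 * h * (n \<bullet> (V *v n)) = 2 * Y" unfolding s6 Y_def HV by simp
  have "bulk t (H + V) - bulk t H = t / 8 * ((1 - (h\<^sup>2 + 2 * Y + F))\<^sup>2 - (1 - h\<^sup>2)\<^sup>2)
     + hplus t / 8 * (3 * ((h\<^sup>2 + 2 * Y + F)\<^sup>2 - (h\<^sup>2)\<^sup>2) - 4 * sqrt 6 * (3 * (s * h / 3 * Y) + 3 * (s * h * (W - F / 3)) + T))"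
    unfolding bulk_def trace_cube_add fnorm2_add fH HHV HVV Y_def W_def F_def T_def by (simp add: algebra_simps)
  also have "4 * sqrt 6 * (3 * (s * h / 3 * Y) + 3 * (s * h * (W - F / 3)) + T) = 12 * h * Y + 36 * h * (W - F / 3) + 4 * sqrt 6 * T"
  proof -
    have "4 * sqrt 6 * (3 * (s * h / 3 * Y) + 3 * (s * h * (W - F / 3)) + T) = (s * s) * (8 * h * Y + 24 * h * (W - F / 3)) + 4 * sqrt 6 * T"
      unfolding s6 by (simp add: algebra_simps)
    then show ?thesis unfolding s2 by simp
  qed
  finally show ?thesis unfolding snV Y_def[symmetric] W_def[symmetric] F_def[symmetric] T_def[symmetric] bulk_coeff_def
    by (simp add: power2_eq_square field_simps)
qed

lemma bulk_uniaxial_add_ge: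
  assumes n: "norm n = 1" and V: "V \<in> S0" and t: "0 \<le> t" and h: "2/3 \<le> h"
  shows "bulk_coeff t h * frob (uniaxial (sqrt (3/2) * h) n) V + bulk_coeff t h / 2 * fnorm2 V
    \<le> bulk t (uniaxial (sqrt (3/2) * h) n + V) - bulk t (uniaxial (sqrt (3/2) * h) n)"
  unfolding bulk_uniaxial_add[OF n V]
  using matrix_ineq[OF h V n] hplus_pos[OF t] t by simp

section \<open>Radial multiples of harmonic quadratic polynomials\<close>

lemma test_fn_extension:
  fixes u :: "'a::euclidean_space \<Rightarrow> real"
  assumes U: "open U" and d: "\<And>x. x \<in> U \<Longrightarrow> (u has_derivative (\<lambda>v. G x \<bullet> v)) (at x)" and cG: "continuous_on U G"
    and K: "compact K" "K \<subseteq> U" "\<And>x. x \<in> U \<Longrightarrow> x \<notin> K \<Longrightarrow> u x = 0"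
  shows "test_fn U (\<lambda>x. if x \<in> U then u x else 0) (\<lambda>x. if x \<in> U then G x else 0)"
proof -
  let ?u = "\<lambda>x. if x \<in> U then u x else 0" and ?G = "\<lambda>x. if x \<in> U then G x else 0"
  have oK: "open (- K)" using K(1) by (simp add: compact_imp_closed open_Compl)
  have zero: "(?u has_derivative (\<lambda>v. 0 \<bullet> v)) (at x)" if "x \<notin> K" for x
  proof -
    have "((\<lambda>x. 0) has_derivative (\<lambda>v. 0 \<bullet> v)) (at x)" by simp
    then show ?thesis by (rule has_derivative_transform_within_open[OF _ oK]) (use that K(3) in auto)
  qed
  have inU: "(?u has_derivative (\<lambda>v. G x \<bullet> v)) (at x)" if "x \<in> U" for x
    by (rule has_derivative_transform_within_open[OF d[OF that] U that]) auto
  have G0: "?G x = 0" if x: "x \<notin> K" for x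
  proof (cases "x \<in> U")
    case True
    have "(\<lambda>v. G x \<bullet> v) = (\<lambda>v. 0 \<bullet> v)" by (rule has_derivative_unique[OF inU[OF True] zero[OF x]])
    then have "G x \<bullet> G x = 0" by (metis inner_zero_left)
    then show ?thesis by simp
  qed simp
  have "(?u has_derivative (\<lambda>v. ?G x \<bullet> v)) (at x)" for x
    using inU[of x] zero[of x] K(2) by (cases "x \<in> U") auto
  moreover have "continuous_on UNIV ?G"
    by (rule continuous_on_zero_extension[OF _ U K(1,2) G0]) (use cG in \<open>auto intro: continuous_on_eq\<close>)
  moreover have "\<forall>x. x \<notin> K \<longrightarrow> ?u x = 0" using K(3) by auto
  ultimately show ?thesis unfolding test_fn_def using K by blast
qed

text \<open>These are the entries of the hedgehog pattern multiplied by the square of the radius: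
  harmonic polynomials, homogeneous of degree two, without a quotient by the norm.\<close>

definition hedge_poly :: "3 \<Rightarrow> 3 \<Rightarrow> real^3 \<Rightarrow> real" where
  "hedge_poly i j x = x $ i * x $ j - (if i = j then 1/3 else 0) * (norm x)\<^sup>2"

definition hedge_grad :: "3 \<Rightarrow> 3 \<Rightarrow> real^3 \<Rightarrow> real^3" where
  "hedge_grad i j x = x $ i *\<^sub>R axis j 1 + x $ j *\<^sub>R axis i 1 - (2 * (if i = j then 1/3 else 0)) *\<^sub>R x"

lemma has_derivative_nth: "((\<lambda>x::real^3. x $ i) has_derivative (\<lambda>v. axis i 1 \<bullet> v)) F"
proof -
  have "((\<lambda>x::real^3. x $ i) has_derivative (\<lambda>v. v $ i)) F"
    by (rule bounded_linear.has_derivative[OF bounded_linear_vec_nth has_derivative_ident])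
  then show ?thesis by (simp add: inner_axis' )
qed

lemma hedge_poly_grad: "(hedge_poly i j has_derivative (\<lambda>v. hedge_grad i j x \<bullet> v)) (at x)"
proof -
  have n: "((\<lambda>x::real^3. x \<bullet> x) has_derivative (\<lambda>v. (2 *\<^sub>R x) \<bullet> v)) (at x)"
    by (auto intro!: derivative_eq_intros simp: inner_commute)
  define d :: real where "d = (if i = j then 1/3 else 0)"
  have "((\<lambda>x. x $ i * x $ j - d * (x \<bullet> x)) has_derivative (\<lambda>v. (x $ i *\<^sub>R axis j 1 + x $ j *\<^sub>R axis i 1) \<bullet> v - d * ((2 *\<^sub>R x) \<bullet> v))) (at x)"
    by (intro has_derivative_diff has_derivative_mult_right gradient_mult has_derivative_nth n)
  then show ?thesis unfolding hedge_poly_def[abs_def] hedge_grad_def d_def[symmetric] power2_norm_eq_inner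
    by (simp add: inner_diff_left mult_ac)
qed

text \<open>This is Euler's identity for a function homogeneous of degree two.\<close>

lemma inner_hedge_grad: "x \<bullet> hedge_grad i j x = 2 * hedge_poly i j x"
  unfolding hedge_grad_def hedge_poly_def power2_norm_eq_inner
  by (simp add: inner_diff_right inner_add_right inner_axis algebra_simps)

lemma continuous_on_hedge_grad: "continuous_on S (hedge_grad i j)"
  unfolding hedge_grad_def[abs_def] by (intro continuous_intros)

lemma continuous_on_hedge_poly: "continuous_on S (hedge_poly i j)"
  unfolding hedge_poly_def[abs_def] by (intro continuous_intros)

definition rgrad :: "(real \<Rightarrow> real) \<Rightarrow> (real \<Rightarrow> real) \<Rightarrow> 3 \<Rightarrow> 3 \<Rightarrow> real^3 \<Rightarrow> real^3" where
  "rgrad f f' i j x = f (norm x) *\<^sub>R hedge_grad i j x + (f' (norm x) / norm x * hedge_poly i j x) *\<^sub>R x"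

lemma radial_hedge_grad:
  assumes "x \<noteq> 0" "(f has_real_derivative f' (norm x)) (at (norm x))"
  shows "((\<lambda>x. f (norm x) * hedge_poly i j x) has_derivative (\<lambda>v. rgrad f f' i j x \<bullet> v)) (at x)"
  using gradient_mult[OF radial_gradient[OF assms] hedge_poly_grad[of i j x]]
  unfolding rgrad_def by (simp add: mult.commute)

lemma continuous_on_norm_compose:
  assumes "continuous_on (norm ` S) f" shows "continuous_on S (\<lambda>x::'a::real_normed_vector. f (norm x))"
  by (rule continuous_on_compose2[OF assms]) (auto intro!: continuous_intros)

lemma continuous_on_rgrad:
  assumes "continuous_on (norm ` S) f" "continuous_on (norm ` S) f'" "0 \<notin> S"
  shows "continuous_on S (rgrad f f' i j)"
  unfolding rgrad_def[abs_def] using assms(3)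
  by (auto intro!: continuous_intros continuous_on_hedge_grad continuous_on_hedge_poly continuous_on_norm_compose[OF assms(1)] continuous_on_norm_compose[OF assms(2)])

lemma continuous_on_radial_hedge:
  assumes "continuous_on (norm ` S) f"
  shows "continuous_on S (\<lambda>x. f (norm x) * hedge_poly i j x)"
  by (intro continuous_intros continuous_on_hedge_poly continuous_on_norm_compose[OF assms])

text \<open>For a harmonic \<open>P\<close> of degree two, the Laplacian of \<open>f P\<close> is
  \<open>(f'' + 2 f' / r) P\<close> plus twice the inner product of the gradients, and by Euler's
  identity the latter contributes \<open>4 f' / r\<close> times \<open>P\<close>.\<close>

lemma radial_hedge_laplacian:
  assumes t: "test_fn (shell_int R) \<phi> g"
    and d: "\<And>r. 1 < r \<Longrightarrow> r < R \<Longrightarrow> (f has_real_derivative f' r) (at r)"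
    and d2: "\<And>r. 1 < r \<Longrightarrow> r < R \<Longrightarrow> (f' has_real_derivative f'' r) (at r)"
    and c: "continuous_on {1<..<R} f''"
  shows "integral\<^sup>L (lebesgue_on (shell_int R)) (\<lambda>x. rgrad f f' i j x \<bullet> g x)
    = - integral\<^sup>L (lebesgue_on (shell_int R)) (\<lambda>x. (f'' (norm x) + 6 * f' (norm x) / norm x) * hedge_poly i j x * \<phi> x)"
proof -
  let ?P = "hedge_poly i j" and ?N = "hedge_grad i j"
  define a where "a r = f' r / r" for r
  define b where "b r = (f'' r - f' r / r) / r" for r
  \<comment> \<open>\<open>A e\<close> is the second derivative of \<open>hedge_poly i j\<close>
    along \<open>e\<close>; its sum over the basis is the Laplacian, and \<open>s3\<close> states
    that it is 0.\<close>
  define A where "A e = 2 * ((axis i 1 \<bullet> e) * (axis j 1 \<bullet> e)) - 2 * (if i = j then 1/3 else 0)" for e :: "real^3"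
  define D where "D e x = b (norm x) / norm x * (x \<bullet> e)\<^sup>2 * ?P x + a (norm x) * ?P x + 2 * a (norm x) * (x \<bullet> e) * (?N x \<bullet> e) + f (norm x) * A e" for e x
  have cf: "continuous_on {1<..<R} f" "continuous_on {1<..<R} f'"
    by (intro continuous_at_imp_continuous_on ballI; auto intro: DERIV_isCont d d2)+
  have ca: "continuous_on {1<..<R} a" "continuous_on {1<..<R} b"
    unfolding a_def b_def by (intro continuous_intros cf c; auto)+
  have im: "norm ` shell_int R \<subseteq> {1<..<R}" "0 \<notin> shell_int R" by (auto simp: shell_int_def)
  have "integral\<^sup>L (lebesgue_on (shell_int R)) (\<lambda>x. rgrad f f' i j x \<bullet> g x)
     = - integral\<^sup>L (lebesgue_on (shell_int R)) (\<lambda>x. (\<Sum>e\<in>Basis. D e x) * \<phi> x)"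
  proof (rule divergence_test_fn[OF open_shell_int t])
    show "continuous_on (shell_int R) (rgrad f f' i j)"
      by (rule continuous_on_rgrad) (use im cf continuous_on_subset in blast)+
    show "continuous_on (shell_int R) (D e)" for e
      unfolding D_def[abs_def]
      by (intro continuous_intros continuous_on_radial cf ca continuous_on_hedge_poly continuous_on_hedge_grad) (auto simp: shell_int_D)
    fix x e :: "real^3" assume x: "x \<in> shell_int R" and e: "e \<in> Basis"
    then have r: "1 < norm x" "norm x < R" "x \<noteq> 0" using shell_int_D by auto
    have da: "(a has_real_derivative b (norm x)) (at (norm x))"
      unfolding a_def[abs_def] b_def using r
      by (auto intro!: derivative_eq_intros d2[OF r(1,2)] simp: diff_divide_distrib)
    have 1: "((\<lambda>s. f (norm (x + s *\<^sub>R e))) has_real_derivative a (norm x) * (x \<bullet> e)) (at 0)"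
      using gradient_directional[OF radial_gradient[OF r(3) d[OF r(1,2)]], of e] unfolding a_def by simp
    have 2: "((\<lambda>s. a (norm (x + s *\<^sub>R e))) has_real_derivative b (norm x) / norm x * (x \<bullet> e)) (at 0)"
      using gradient_directional[OF radial_gradient[OF r(3) da], of e] by simp
    have 3: "((\<lambda>s. ?P (x + s *\<^sub>R e)) has_real_derivative ?N x \<bullet> e) (at 0)"
      by (rule gradient_directional[OF hedge_poly_grad])
    have ee: "e \<bullet> e = 1" using e by simp
    have ex: "((\<lambda>s. (x + s *\<^sub>R e) \<bullet> e) has_real_derivative 1) (at 0)"
      by (simp add: inner_add_left ee) (auto intro!: derivative_eq_intros)
    have 4: "((\<lambda>s. ?N (x + s *\<^sub>R e) \<bullet> e) has_real_derivative A e) (at 0)"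
    proof -
      have "?N (x + s *\<^sub>R e) \<bullet> e = ?N x \<bullet> e + s * A e" for s
        unfolding hedge_grad_def A_def by (simp add: inner_diff_left inner_add_left ee inner_axis inner_axis' algebra_simps)
      then show ?thesis by (auto intro!: derivative_eq_intros)
    qed
    have "rgrad f f' i j y \<bullet> e = f (norm y) * (?N y \<bullet> e) + a (norm y) * ?P y * (y \<bullet> e)" for y
      unfolding rgrad_def a_def by (simp add: inner_add_left)
    then show "((\<lambda>s. rgrad f f' i j (x + s *\<^sub>R e) \<bullet> e) has_real_derivative D e x) (at 0)"
      using DERIV_add[OF DERIV_mult[OF 1 4] DERIV_mult[OF DERIV_mult[OF 2 3] ex]]
      unfolding D_def by (simp add: power2_eq_square algebra_simps)
  qed
  also have "integral\<^sup>L (lebesgue_on (shell_int R)) (\<lambda>x. (\<Sum>e\<in>Basis. D e x) * \<phi> x)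
     = integral\<^sup>L (lebesgue_on (shell_int R)) (\<lambda>x. (f'' (norm x) + 6 * f' (norm x) / norm x) * ?P x * \<phi> x)"
  proof (rule Bochner_Integration.integral_cong[OF refl])
    fix x assume "x \<in> space (lebesgue_on (shell_int R))"
    then have r: "1 < norm x" "x \<noteq> 0" using shell_int_D by auto
    have s1: "(\<Sum>e\<in>Basis. (x \<bullet> e)\<^sup>2) = (norm x)\<^sup>2"
      unfolding power2_norm_eq_inner euclidean_inner[of x x] by (simp add: power2_eq_square)
    have s2: "(\<Sum>e\<in>Basis. (x \<bullet> e) * (?N x \<bullet> e)) = 2 * ?P x"
      unfolding euclidean_inner[symmetric] by (rule inner_hedge_grad)
    have s3: "(\<Sum>e\<in>Basis. A e) = 0"
      unfolding A_def sum_subtractf sum_distrib_left[symmetric] euclidean_inner[symmetric]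
      by (simp add: inner_axis_axis)
    have "(\<Sum>e\<in>Basis. D e x) = b (norm x) / norm x * ?P x * (\<Sum>e\<in>Basis. (x \<bullet> e)\<^sup>2) + 3 * (a (norm x) * ?P x)
        + 2 * a (norm x) * (\<Sum>e\<in>Basis. (x \<bullet> e) * (?N x \<bullet> e)) + f (norm x) * (\<Sum>e\<in>Basis. A e)"
      unfolding D_def by (simp add: sum.distrib sum_distrib_left sum_distrib_right sum_divide_distrib mult_ac)
    also have "\<dots> = (f'' (norm x) + 6 * f' (norm x) / norm x) * ?P x"
      unfolding s1 s2 s3 a_def b_def using r by (simp add: power2_eq_square field_simps)
    finally show "(\<Sum>e\<in>Basis. D e x) * \<phi> x = (f'' (norm x) + 6 * f' (norm x) / norm x) * ?P x * \<phi> x" by simp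
  qed
  finally show ?thesis .
qed

section \<open>Approximation of radial profiles by test functions\<close>

definition quad_cut :: "real \<Rightarrow> real \<Rightarrow> real" where
  "quad_cut d y = (max 0 (y - d))\<^sup>2 / y"

definition quad_cut' :: "real \<Rightarrow> real \<Rightarrow> real" where
  "quad_cut' d y = 2 * max 0 (y - d) / y - (max 0 (y - d))\<^sup>2 / y\<^sup>2"

lemma quad_cut_deriv:
  assumes "y > 0" shows "(quad_cut d has_real_derivative quad_cut' d y) (at y)"
proof -
  have "((\<lambda>x. x - d) has_real_derivative 1) (at y)" by (auto intro!: derivative_eq_intros)
  from DERIV_chain2[OF smooth_step_deriv this]
  have 1: "((\<lambda>x. (max 0 (x - d))\<^sup>2) has_real_derivative 2 * max 0 (y - d)) (at y)" by simp
  show ?thesis unfolding quad_cut_def[abs_def] quad_cut'_def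
    by (rule DERIV_cong[OF DERIV_divide[OF 1 DERIV_ident]]) (use assms in \<open>simp_all add: field_simps power2_eq_square\<close>)
qed

text \<open>With \<open>m = max 0 (y - d) / y\<close> between 0 and 1, \<open>quad_cut d y\<close>
  is \<open>m^2 * y\<close> and \<open>1 - quad_cut' d y\<close> is \<open>(1 - m)^2\<close>. The
  bounds do not depend on \<open>d\<close>, as dominated convergence requires.\<close>

lemma quad_cut_bounds:
  assumes "y > 0" "d \<ge> 0"
  shows "0 \<le> quad_cut d y" "quad_cut d y \<le> y" "\<bar>quad_cut' d y - 1\<bar> \<le> 1"
proof -
  define m where "m = max 0 (y - d) / y"
  have m: "0 \<le> m" "m \<le> 1" unfolding m_def using assms by auto
  have 1: "quad_cut d y = m\<^sup>2 * y" unfolding quad_cut_def m_def using assms by (simp add: power2_eq_square)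
  have 2: "1 - quad_cut' d y = (1 - m)\<^sup>2" unfolding quad_cut'_def m_def using assms by (simp add: power2_eq_square field_simps)
  have "m\<^sup>2 \<le> 1" "(1 - m)\<^sup>2 \<le> 1" using m by (auto simp: power_le_one)
  then show "0 \<le> quad_cut d y" "quad_cut d y \<le> y"
    using 1 assms mult_right_mono[of "m\<^sup>2" 1 y] by auto
  show "\<bar>quad_cut' d y - 1\<bar> \<le> 1" using 2 \<open>(1 - m)\<^sup>2 \<le> 1\<close> zero_le_power2[of "1 - m"] by linarith
qed

lemma quad_cut_tendsto:
  assumes "y > 0" "d \<longlonglongrightarrow> 0"
  shows "(\<lambda>n. quad_cut (d n) y) \<longlonglongrightarrow> y" "(\<lambda>n. quad_cut' (d n) y) \<longlonglongrightarrow> 1"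
proof -
  have m: "(\<lambda>n. max 0 (y - d n)) \<longlonglongrightarrow> max 0 (y - 0)" by (intro tendsto_intros assms)
  have "(\<lambda>n. quad_cut (d n) y) \<longlonglongrightarrow> (max 0 (y - 0))\<^sup>2 / y"
    unfolding quad_cut_def using assms by (intro tendsto_intros m) auto
  then show "(\<lambda>n. quad_cut (d n) y) \<longlonglongrightarrow> y" using assms by (simp add: power2_eq_square)
  have "(\<lambda>n. quad_cut' (d n) y) \<longlonglongrightarrow> 2 * max 0 (y - 0) / y - (max 0 (y - 0))\<^sup>2 / y\<^sup>2"
    unfolding quad_cut'_def using assms by (intro tendsto_intros m) auto
  then show "(\<lambda>n. quad_cut' (d n) y) \<longlonglongrightarrow> 1" using assms by simp
qed

lemma compact_shell: "compact (shell R)"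
proof -
  have "shell R = cball 0 R - ball 0 1" by (auto simp: shell_def)
  then show ?thesis by (simp add: compact_diff)
qed

lemma shell_int_subset: "shell_int R \<subseteq> shell R" unfolding shell_def shell_int_def by auto

lemma negligible_shell_boundary: "negligible (shell R - shell_int R)"
proof -
  have "shell R - shell_int R \<subseteq> sphere 0 1 \<union> sphere 0 R" unfolding shell_def shell_int_def by auto
  then show ?thesis by (rule negligible_subset[OF negligible_Un[OF negligible_sphere negligible_sphere]])
qed

lemma shell_sets: "shell R \<in> sets lebesgue" "shell_int R \<in> sets lebesgue"
  using compact_shell open_shell_int by (auto simp: lmeasurable_compact fmeasurableD)

lemmas lebesgue_on_shell = lebesgue_on_negligible_diff[OF shell_sets(2,1) shell_int_subset negligible_shell_boundary]

lemma integrable_continuous_shell: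
  fixes f :: "real^3 \<Rightarrow> real"
  assumes "continuous_on (shell R) f" shows "integrable (lebesgue_on (shell_int R)) f"
  using integrable_continuous_compact[OF compact_shell assms] lebesgue_on_shell(2) by blast

lemma measurable_continuous_shell_int:
  fixes f :: "real^3 \<Rightarrow> 'b::euclidean_space"
  assumes "continuous_on (shell_int R) f" shows "f \<in> borel_measurable (lebesgue_on (shell_int R))"
  by (rule continuous_imp_measurable_on_sets_lebesgue[OF assms shell_sets(2)])

lemma norm_image_shell: "norm ` shell R \<subseteq> {1..R}" "0 \<notin> shell R" "norm ` shell_int R \<subseteq> {1<..<R}" "0 \<notin> shell_int R"
  unfolding shell_def shell_int_def by auto

lemma W12_radial_hedge:
  assumes d: "\<And>r. 1 < r \<Longrightarrow> r < R \<Longrightarrow> (f has_real_derivative f' r) (at r)"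
    and c: "continuous_on {1..R} f" "continuous_on {1..R} f'"
  shows "W12 (shell_int R) (\<lambda>x. f (norm x) * hedge_poly i j x) (rgrad f f' i j)"
proof -
  have cs: "continuous_on (shell R) (rgrad f f' i j)" "continuous_on (shell R) (\<lambda>x. f (norm x) * hedge_poly i j x)"
    by (intro continuous_on_rgrad continuous_on_radial_hedge norm_image_shell continuous_on_subset[OF c(1) norm_image_shell(1)] continuous_on_subset[OF c(2) norm_image_shell(1)])+
  note ci = continuous_on_subset[OF cs(1) shell_int_subset] continuous_on_subset[OF cs(2) shell_int_subset]
  have "weak_grad (shell_int R) (\<lambda>x. f (norm x) * hedge_poly i j x) (rgrad f f' i j)"
    by (rule weak_grad_C1[OF open_shell_int _ ci(1)]) (use shell_int_D d radial_hedge_grad in blast)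
  then show ?thesis unfolding W12_def L2_def L2vec_def
    by (auto intro!: measurable_continuous_shell_int ci integrable_continuous_shell continuous_intros cs)
qed

text \<open>Replacing \<open>s\<close> by \<open>(s - d)\<^sub>+\<^sup>2 / s\<close> gives \<open>C\<^sup>1\<close> functions that vanish near the boundary.\<close>
lemma W0_radial_hedge:
  assumes R: "1 < R" and cs: "continuous_on {1..R} s" and s: "s 1 = 0" "s R = 0" "\<And>r. 1 < r \<Longrightarrow> r < R \<Longrightarrow> 0 < s r"
    and d: "\<And>r. 1 < r \<Longrightarrow> r < R \<Longrightarrow> (s has_real_derivative s' r) (at r)" and cs': "continuous_on {1..R} s'"
  shows "W0 (shell_int R) (\<lambda>x. \<kappa> * s (norm x) / (norm x)\<^sup>2 * hedge_poly i j x)"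
proof -
  let ?U = "shell_int R" and ?M = "lebesgue_on (shell_int R)" and ?P = "hedge_poly i j" and ?N = "hedge_grad i j"
  define F where "F \<sigma> r = \<kappa> * \<sigma> r / r\<^sup>2" for \<sigma> :: "real \<Rightarrow> real" and r
  define F' where "F' \<sigma> \<sigma>' r = \<kappa> * (\<sigma>' r / r\<^sup>2 - 2 * \<sigma> r / r^3)" for \<sigma> \<sigma>' :: "real \<Rightarrow> real" and r
  have dF: "(F \<sigma> has_real_derivative F' \<sigma> \<sigma>' r) (at r)" if "(\<sigma> has_real_derivative \<sigma>' r) (at r)" "1 < r" for \<sigma> \<sigma>' r
    unfolding F_def[abs_def] F'_def using that
    by (auto intro!: derivative_eq_intros simp: field_simps power2_eq_square power3_eq_cube)
  have cF: "continuous_on {1..R} (F s)" "continuous_on {1..R} (F' s s')"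
    unfolding F_def F'_def by (intro continuous_intros cs cs'; auto)+
  define u where "u x = F s (norm x) * ?P x" for x
  define G where "G = rgrad (F s) (F' s s') i j"
  have W: "W12 ?U u G" unfolding u_def[abs_def] G_def by (rule W12_radial_hedge[OF dF[OF d] cF])
  define e where "e n = 1 / real (Suc n)" for n
  have e: "0 < e n" for n unfolding e_def by simp
  have e0: "e \<longlonglongrightarrow> 0" unfolding e_def using LIMSEQ_inverse_real_of_nat by (simp add: field_simps)
  define \<sigma> where "\<sigma> n r = quad_cut (e n) (s r)" for n r
  define \<sigma>' where "\<sigma>' n r = quad_cut' (e n) (s r) * s' r" for n r
  have d\<sigma>: "(\<sigma> n has_real_derivative \<sigma>' n r) (at r)" if "1 < r" "r < R" for n r
    unfolding \<sigma>_def[abs_def] \<sigma>'_def by (rule DERIV_chain2[OF quad_cut_deriv[OF s(3)[OF that]] d[OF that]])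
  have sub: "{1<..<R} \<subseteq> {1..R}" by auto
  have c\<sigma>: "continuous_on {1<..<R} (\<sigma> n)" "continuous_on {1<..<R} (\<sigma>' n)" for n
    unfolding \<sigma>_def \<sigma>'_def quad_cut_def quad_cut'_def using s(3)
    by (intro continuous_intros continuous_on_subset[OF cs sub] continuous_on_subset[OF cs' sub]; force)+
  have cF\<sigma>: "continuous_on {1<..<R} (F (\<sigma> n))" "continuous_on {1<..<R} (F' (\<sigma> n) (\<sigma>' n))" for n
    unfolding F_def F'_def by (intro continuous_intros c\<sigma>; auto)+
  define v where "v n x = F (\<sigma> n) (norm x) * ?P x" for n x
  define H where "H n = rgrad (F (\<sigma> n)) (F' (\<sigma> n) (\<sigma>' n)) i j" for n
  have cvH: "continuous_on ?U (v n)" "continuous_on ?U (H n)" for n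
    unfolding v_def[abs_def] H_def
    by (intro continuous_on_rgrad continuous_on_radial_hedge norm_image_shell continuous_on_subset[OF cF\<sigma>(1) norm_image_shell(3)] continuous_on_subset[OF cF\<sigma>(2) norm_image_shell(3)])+
  \<comment> \<open>The profile \<open>s\<close> is 0 on both boundary spheres and
    \<open>e n\<close> is positive, so this closed subset of the closed shell lies in the open
    one.\<close>
  define K where "K n = {x \<in> shell R. s (norm x) \<in> {e n..}}" for n
  have t: "test_fn ?U (\<lambda>x. if x \<in> ?U then v n x else 0) (\<lambda>x. if x \<in> ?U then H n x else 0)" for n
  proof (rule test_fn_extension[OF open_shell_int _ cvH(2)])
    show "(v n has_derivative (\<lambda>w. H n x \<bullet> w)) (at x)" if "x \<in> ?U" for x
      unfolding v_def[abs_def] H_def using shell_int_D[OF that] by (intro radial_hedge_grad dF d\<sigma>) auto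
    have "continuous_on (shell R) (\<lambda>x. s (norm x))"
      by (rule continuous_on_norm_compose[OF continuous_on_subset[OF cs norm_image_shell(1)]])
    from continuous_closed_preimage[OF this compact_imp_closed[OF compact_shell] closed_atLeast]
    have "closed (shell R \<inter> (\<lambda>x. s (norm x)) -` {e n..})" .
    moreover have "K n = shell R \<inter> (\<lambda>x. s (norm x)) -` {e n..}" unfolding K_def by auto
    ultimately show "compact (K n)" using compact_shell by (metis compact_Int_closed inf_left_idem)
    show "K n \<subseteq> ?U"
      unfolding K_def shell_def shell_int_def using s(1,2) e[of n] by (auto simp: less_le)
    show "v n x = 0" if "x \<in> ?U" "x \<notin> K n" for x
    proof -
      have "s (norm x) < e n" using that shell_int_subset unfolding K_def by auto
      then show ?thesis unfolding v_def F_def \<sigma>_def quad_cut_def by simp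
    qed
  qed
  have csn: "continuous_on (shell R) (\<lambda>x. s (norm x))" "continuous_on (shell R) (\<lambda>x. s' (norm x))"
    by (intro continuous_on_norm_compose continuous_on_subset[OF cs norm_image_shell(1)] continuous_on_subset[OF cs' norm_image_shell(1)])+
  have nz: "\<forall>x\<in>shell R. x \<noteq> 0" using norm_image_shell(2) by auto
  \<comment> \<open>Both dominating functions come from
    \<open>\<bar>\<sigma> n r - s r\<bar> \<le> s r\<close> and
    \<open>\<bar>\<sigma>' n r - s' r\<bar> \<le> \<bar>s' r\<bar>\<close>, which hold for every
    \<open>n\<close>.\<close>
  define w1 where "w1 x = (\<bar>\<kappa>\<bar> * s (norm x) / (norm x)\<^sup>2 * \<bar>?P x\<bar>)\<^sup>2" for x
  define w2 where "w2 x = (\<bar>\<kappa>\<bar> * s (norm x) / (norm x)\<^sup>2 * norm (?N x) + \<bar>\<kappa>\<bar> * (\<bar>s' (norm x)\<bar> / (norm x)\<^sup>2 + 2 * s (norm x) / (norm x)^3) / norm x * \<bar>?P x\<bar> * norm x)\<^sup>2" for x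
  have iw: "integrable ?M w1" "integrable ?M w2" unfolding w1_def w2_def using nz
    by (intro integrable_continuous_shell continuous_intros csn continuous_on_hedge_poly continuous_on_hedge_grad; simp)+
  have cuG: "continuous_on ?U u" "continuous_on ?U G"
    unfolding u_def[abs_def] G_def
    by (intro continuous_on_rgrad continuous_on_radial_hedge norm_image_shell continuous_on_subset[OF cF(1) subset_trans[OF norm_image_shell(3) sub]] continuous_on_subset[OF cF(2) subset_trans[OF norm_image_shell(3) sub]])+
  have lim: "(\<lambda>n. F (\<sigma> n) r) \<longlonglongrightarrow> F s r" "(\<lambda>n. F' (\<sigma> n) (\<sigma>' n) r) \<longlonglongrightarrow> F' s s' r" if r: "1 < r" "r < R" for r
  proof -
    note q = quad_cut_tendsto[OF s(3)[OF r] e0]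
    show "(\<lambda>n. F (\<sigma> n) r) \<longlonglongrightarrow> F s r" unfolding F_def \<sigma>_def using r by (intro tendsto_intros q) auto
    have "(\<lambda>n. F' (\<sigma> n) (\<sigma>' n) r) \<longlonglongrightarrow> \<kappa> * (1 * s' r / r\<^sup>2 - 2 * s r / r^3)"
      unfolding F'_def \<sigma>_def \<sigma>'_def using r by (intro tendsto_intros q) auto
    then show "(\<lambda>n. F' (\<sigma> n) (\<sigma>' n) r) \<longlonglongrightarrow> F' s s' r" unfolding F'_def by simp
  qed
  have bF: "\<bar>F (\<sigma> n) r - F s r\<bar> \<le> \<bar>\<kappa>\<bar> * s r / r\<^sup>2"
    "\<bar>F' (\<sigma> n) (\<sigma>' n) r - F' s s' r\<bar> \<le> \<bar>\<kappa>\<bar> * (\<bar>s' r\<bar> / r\<^sup>2 + 2 * s r / r^3)" if r: "1 < r" "r < R" for n r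
  proof -
    note q = quad_cut_bounds[OF s(3)[OF r] less_imp_le[OF e[of n]]]
    have 1: "\<bar>\<sigma> n r - s r\<bar> \<le> s r" unfolding \<sigma>_def using q(1,2) by auto
    have 2: "\<bar>\<sigma>' n r - s' r\<bar> \<le> \<bar>s' r\<bar>"
    proof -
      have "\<sigma>' n r - s' r = (quad_cut' (e n) (s r) - 1) * s' r" unfolding \<sigma>'_def by (simp add: algebra_simps)
      then show ?thesis using mult_right_mono[OF q(3), of "\<bar>s' r\<bar>"] by (simp add: abs_mult)
    qed
    have "F (\<sigma> n) r - F s r = \<kappa> * (\<sigma> n r - s r) / r\<^sup>2" unfolding F_def by (simp add: right_diff_distrib diff_divide_distrib)
    then show "\<bar>F (\<sigma> n) r - F s r\<bar> \<le> \<bar>\<kappa>\<bar> * s r / r\<^sup>2"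
      using 1 by (simp add: abs_mult divide_right_mono mult_left_mono)
    have "F' (\<sigma> n) (\<sigma>' n) r - F' s s' r = \<kappa> * ((\<sigma>' n r - s' r) / r\<^sup>2 - 2 * (\<sigma> n r - s r) / r^3)"
      unfolding F'_def by (simp add: right_diff_distrib diff_divide_distrib)
    moreover have "\<bar>(\<sigma>' n r - s' r) / r\<^sup>2 - 2 * (\<sigma> n r - s r) / r^3\<bar> \<le> \<bar>s' r\<bar> / r\<^sup>2 + 2 * s r / r^3"
    proof -
      have "\<bar>(\<sigma>' n r - s' r) / r\<^sup>2\<bar> \<le> \<bar>s' r\<bar> / r\<^sup>2"
        unfolding abs_divide abs_power2 by (rule divide_right_mono[OF 2]) simp
      moreover have "\<bar>2 * (\<sigma> n r - s r) / r^3\<bar> \<le> 2 * s r / r^3"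
        unfolding abs_divide abs_mult using r 1 by (simp add: divide_right_mono)
      ultimately show ?thesis by linarith
    qed
    ultimately show "\<bar>F' (\<sigma> n) (\<sigma>' n) r - F' s s' r\<bar> \<le> \<bar>\<kappa>\<bar> * (\<bar>s' r\<bar> / r\<^sup>2 + 2 * s r / r^3)"
      by (simp only: abs_mult) (rule mult_left_mono, assumption, simp)
  qed
  have ind: "x \<in> space ?M \<longleftrightarrow> x \<in> ?U" for x by simp
  have L1: "(\<lambda>n. integral\<^sup>L ?M (\<lambda>x. (v n x - u x)\<^sup>2)) \<longlonglongrightarrow> integral\<^sup>L ?M (\<lambda>x. 0)"
  proof (rule integral_dominated_convergence[OF _ _ iw(1)])
    show "(\<lambda>x. (v n x - u x)\<^sup>2) \<in> borel_measurable ?M" for n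
      by (intro measurable_continuous_shell_int continuous_intros cvH cuG)
    show "AE x in ?M. (\<lambda>n. (v n x - u x)\<^sup>2) \<longlonglongrightarrow> 0"
    proof (intro AE_I2)
      fix x assume "x \<in> space ?M"
      then have r: "1 < norm x" "norm x < R" using ind shell_int_D by auto
      have "(\<lambda>n. (v n x - u x)\<^sup>2) \<longlonglongrightarrow> (u x - u x)\<^sup>2" unfolding v_def u_def by (intro tendsto_intros lim r)
      then show "(\<lambda>n. (v n x - u x)\<^sup>2) \<longlonglongrightarrow> 0" by simp
    qed
    show "AE x in ?M. norm ((v n x - u x)\<^sup>2) \<le> w1 x" for n
    proof (intro AE_I2)
      fix x assume "x \<in> space ?M"
      then have r: "1 < norm x" "norm x < R" using ind shell_int_D by auto
      have "v n x - u x = (F (\<sigma> n) (norm x) - F s (norm x)) * ?P x" unfolding v_def u_def by (simp add: left_diff_distrib)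
      then have "\<bar>v n x - u x\<bar> \<le> \<bar>\<kappa>\<bar> * s (norm x) / (norm x)\<^sup>2 * \<bar>?P x\<bar>"
        using mult_right_mono[OF bF(1)[OF r], of "\<bar>?P x\<bar>"] by (simp add: abs_mult)
      from power_mono[OF this, of 2] show "norm ((v n x - u x)\<^sup>2) \<le> w1 x" unfolding w1_def by simp
    qed
  qed simp
  have L2: "(\<lambda>n. integral\<^sup>L ?M (\<lambda>x. (norm (H n x - G x))\<^sup>2)) \<longlonglongrightarrow> integral\<^sup>L ?M (\<lambda>x. 0)"
  proof (rule integral_dominated_convergence[OF _ _ iw(2)])
    show "(\<lambda>x. (norm (H n x - G x))\<^sup>2) \<in> borel_measurable ?M" for n
      by (intro measurable_continuous_shell_int continuous_intros cvH cuG)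
    show "AE x in ?M. (\<lambda>n. (norm (H n x - G x))\<^sup>2) \<longlonglongrightarrow> 0"
    proof (intro AE_I2)
      fix x assume "x \<in> space ?M"
      then have r: "1 < norm x" "norm x < R" using ind shell_int_D by auto
      have "(\<lambda>n. (norm (H n x - G x))\<^sup>2) \<longlonglongrightarrow> (norm (G x - G x))\<^sup>2" unfolding H_def G_def rgrad_def
        using r by (intro tendsto_intros lim r) auto
      then show "(\<lambda>n. (norm (H n x - G x))\<^sup>2) \<longlonglongrightarrow> 0" by simp
    qed
    show "AE x in ?M. norm ((norm (H n x - G x))\<^sup>2) \<le> w2 x" for n
    proof (intro AE_I2)
      fix x assume "x \<in> space ?M"
      then have r: "1 < norm x" "norm x < R" using ind shell_int_D by auto
      let ?a = "F (\<sigma> n) (norm x) - F s (norm x)" and ?b = "F' (\<sigma> n) (\<sigma>' n) (norm x) - F' s s' (norm x)"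
      have "H n x - G x = ?a *\<^sub>R ?N x + (?b / norm x * ?P x) *\<^sub>R x"
        unfolding H_def G_def rgrad_def by (simp add: scaleR_diff_left diff_divide_distrib left_diff_distrib)
      then have "norm (H n x - G x) \<le> \<bar>?a\<bar> * norm (?N x) + \<bar>?b\<bar> / norm x * \<bar>?P x\<bar> * norm x"
        using norm_triangle_ineq[of "?a *\<^sub>R ?N x" "(?b / norm x * ?P x) *\<^sub>R x"] by (simp add: abs_mult)
      also have "\<dots> \<le> \<bar>\<kappa>\<bar> * s (norm x) / (norm x)\<^sup>2 * norm (?N x) + \<bar>\<kappa>\<bar> * (\<bar>s' (norm x)\<bar> / (norm x)\<^sup>2 + 2 * s (norm x) / (norm x)^3) / norm x * \<bar>?P x\<bar> * norm x"
        by (intro add_mono mult_right_mono divide_right_mono bF r) auto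
      finally show "norm ((norm (H n x - G x))\<^sup>2) \<le> w2 x" unfolding w2_def by (simp add: power_mono)
    qed
  qed simp
  have "(\<lambda>x. \<kappa> * s (norm x) / (norm x)\<^sup>2 * ?P x) = u" unfolding u_def F_def by simp
  moreover have "W0 ?U u"
    unfolding W0_def
  proof (intro exI conjI allI)
    show "W12 ?U u G" by (rule W)
    show "test_fn ?U (\<lambda>x. if x \<in> ?U then v n x else 0) (\<lambda>x. if x \<in> ?U then H n x else 0)" for n by (rule t)
    have "integral\<^sup>L ?M (\<lambda>x. ((if x \<in> ?U then v n x else 0) - u x)\<^sup>2) = integral\<^sup>L ?M (\<lambda>x. (v n x - u x)\<^sup>2)" for n
      by (rule Bochner_Integration.integral_cong) auto
    then show "(\<lambda>n. integral\<^sup>L ?M (\<lambda>x. ((if x \<in> ?U then v n x else 0) - u x)\<^sup>2)) \<longlonglongrightarrow> 0" using L1 by simp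
    have "integral\<^sup>L ?M (\<lambda>x. (norm ((if x \<in> ?U then H n x else 0) - G x))\<^sup>2) = integral\<^sup>L ?M (\<lambda>x. (norm (H n x - G x))\<^sup>2)" for n
      by (rule Bochner_Integration.integral_cong) auto
    then show "(\<lambda>n. integral\<^sup>L ?M (\<lambda>x. (norm ((if x \<in> ?U then H n x else 0) - G x))\<^sup>2)) \<longlonglongrightarrow> 0" using L2 by simp
  qed
  ultimately show ?thesis by simp
qed

section \<open>Limits of test functions\<close>

text \<open>The integral of \<open>(f + s * g)^2\<close> is a nonnegative quadratic in
  \<open>s\<close>; evaluating it at its minimizer gives the bound, and in the degenerate case
  \<open>W = 0\<close> a nonzero linear term would make it negative somewhere.\<close>

lemma Cauchy_Schwarz_integral_square:
  fixes f g :: "'a \<Rightarrow> real"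
  assumes m: "f \<in> borel_measurable M" "g \<in> borel_measurable M" and i: "integrable M (\<lambda>x. (f x)\<^sup>2)" "integrable M (\<lambda>x. (g x)\<^sup>2)"
  shows "(integral\<^sup>L M (\<lambda>x. f x * g x))\<^sup>2 \<le> integral\<^sup>L M (\<lambda>x. (f x)\<^sup>2) * integral\<^sup>L M (\<lambda>x. (g x)\<^sup>2)"
proof -
  define F X W where "F = integral\<^sup>L M (\<lambda>x. (f x)\<^sup>2)" and "X = integral\<^sup>L M (\<lambda>x. f x * g x)" and "W = integral\<^sup>L M (\<lambda>x. (g x)\<^sup>2)"
  have ifg: "integrable M (\<lambda>x. f x * g x)" by (rule integrable_mult_L2[OF m i])
  have q: "0 \<le> F + 2 * s * X + s\<^sup>2 * W" for s
  proof -
    have "0 \<le> integral\<^sup>L M (\<lambda>x. (f x + s * g x)\<^sup>2)" by (rule Bochner_Integration.integral_nonneg) simp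
    also have "\<dots> = integral\<^sup>L M (\<lambda>x. (f x)\<^sup>2 + (2 * s) * (f x * g x) + s\<^sup>2 * (g x)\<^sup>2)"
      by (rule Bochner_Integration.integral_cong) (simp_all add: power2_eq_square algebra_simps)
    also have "\<dots> = F + 2 * s * X + s\<^sup>2 * W" unfolding F_def X_def W_def using i ifg by simp
    finally show ?thesis .
  qed
  have W0: "0 \<le> W" unfolding W_def by (rule Bochner_Integration.integral_nonneg) simp
  have "X\<^sup>2 \<le> F * W"
  proof (cases "W = 0")
    case True
    have "X = 0"
    proof (rule ccontr)
      assume "X \<noteq> 0"
      then have "F + 2 * (- (F + 1) / (2 * X)) * X + (- (F + 1) / (2 * X))\<^sup>2 * W = - 1" using True by (simp add: field_simps)
      then show False using q[of "- (F + 1) / (2 * X)"] by simp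
    qed
    then show ?thesis using True by simp
  next
    case False
    have "F + 2 * (- X / W) * X + (- X / W)\<^sup>2 * W = F - X\<^sup>2 / W" using False by (simp add: power2_eq_square field_simps)
    then have "X\<^sup>2 / W \<le> F" using q[of "- X / W"] by simp
    then show ?thesis using False W0 by (simp add: divide_le_eq mult.commute)
  qed
  then show ?thesis unfolding F_def X_def W_def .
qed

lemma integrable_square_diff:
  fixes f g :: "'a \<Rightarrow> real"
  assumes m: "f \<in> borel_measurable M" "g \<in> borel_measurable M" and i: "integrable M (\<lambda>x. (f x)\<^sup>2)" "integrable M (\<lambda>x. (g x)\<^sup>2)"
  shows "integrable M (\<lambda>x. (f x - g x)\<^sup>2)"
proof -
  have "(f x - g x)\<^sup>2 = (f x)\<^sup>2 - 2 * (f x * g x) + (g x)\<^sup>2" for x by (simp add: power2_eq_square algebra_simps)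
  then show ?thesis using i integrable_mult_L2[OF m i] by simp
qed

lemma L2_tendsto_mult:
  fixes f u :: "'a \<Rightarrow> real" and v :: "nat \<Rightarrow> 'a \<Rightarrow> real"
  assumes f: "f \<in> borel_measurable M" "integrable M (\<lambda>x. (f x)\<^sup>2)"
    and u: "u \<in> borel_measurable M" "integrable M (\<lambda>x. (u x)\<^sup>2)"
    and v: "\<And>n. v n \<in> borel_measurable M" "\<And>n. integrable M (\<lambda>x. (v n x)\<^sup>2)"
    and lim: "(\<lambda>n. integral\<^sup>L M (\<lambda>x. (v n x - u x)\<^sup>2)) \<longlonglongrightarrow> 0"
  shows "(\<lambda>n. integral\<^sup>L M (\<lambda>x. f x * v n x)) \<longlonglongrightarrow> integral\<^sup>L M (\<lambda>x. f x * u x)"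
proof (rule LIM_zero_cancel, rule Lim_null_comparison)
  define F where "F = integral\<^sup>L M (\<lambda>x. (f x)\<^sup>2)"
  show "\<forall>\<^sub>F n in sequentially. norm (integral\<^sup>L M (\<lambda>x. f x * v n x) - integral\<^sup>L M (\<lambda>x. f x * u x)) \<le> sqrt (F * integral\<^sup>L M (\<lambda>x. (v n x - u x)\<^sup>2))"
  proof (intro always_eventually allI)
    fix n
    have "integral\<^sup>L M (\<lambda>x. f x * v n x) - integral\<^sup>L M (\<lambda>x. f x * u x) = integral\<^sup>L M (\<lambda>x. f x * (v n x - u x))"
      using integrable_mult_L2[OF f(1) v(1) f(2) v(2)] integrable_mult_L2[OF f(1) u(1) f(2) u(2)] by (simp add: right_diff_distrib)
    moreover have "(integral\<^sup>L M (\<lambda>x. f x * (v n x - u x)))\<^sup>2 \<le> F * integral\<^sup>L M (\<lambda>x. (v n x - u x)\<^sup>2)"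
      unfolding F_def using u v by (intro Cauchy_Schwarz_integral_square f integrable_square_diff) auto
    ultimately show "norm (integral\<^sup>L M (\<lambda>x. f x * v n x) - integral\<^sup>L M (\<lambda>x. f x * u x)) \<le> sqrt (F * integral\<^sup>L M (\<lambda>x. (v n x - u x)\<^sup>2))"
      by (simp add: real_le_rsqrt)
  qed
  have "(\<lambda>n. sqrt (F * integral\<^sup>L M (\<lambda>x. (v n x - u x)\<^sup>2))) \<longlonglongrightarrow> sqrt (F * 0)" by (intro tendsto_intros lim)
  then show "(\<lambda>n. sqrt (F * integral\<^sup>L M (\<lambda>x. (v n x - u x)\<^sup>2))) \<longlonglongrightarrow> 0" by simp
qed

text \<open>The identity \<open>b v^2 = 2 (b u) v - b u^2 + b (v - u)^2\<close> reduces the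
  quadratic limit to the linear one and an error bounded by \<open>B\<close> times the squared
  distance.\<close>

lemma L2_tendsto_square:
  fixes b u :: "'a \<Rightarrow> real" and v :: "nat \<Rightarrow> 'a \<Rightarrow> real"
  assumes b: "b \<in> borel_measurable M" "AE x in M. \<bar>b x\<bar> \<le> B"
    and u: "u \<in> borel_measurable M" "integrable M (\<lambda>x. (u x)\<^sup>2)"
    and v: "\<And>n. v n \<in> borel_measurable M" "\<And>n. integrable M (\<lambda>x. (v n x)\<^sup>2)"
    and lim: "(\<lambda>n. integral\<^sup>L M (\<lambda>x. (v n x - u x)\<^sup>2)) \<longlonglongrightarrow> 0"
  shows "(\<lambda>n. integral\<^sup>L M (\<lambda>x. b x * (v n x)\<^sup>2)) \<longlonglongrightarrow> integral\<^sup>L M (\<lambda>x. b x * (u x)\<^sup>2)"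
proof -
  have bu: "(\<lambda>x. b x * u x) \<in> borel_measurable M" using b u by simp
  have ibu: "integrable M (\<lambda>x. (b x * u x)\<^sup>2)"
  proof -
    have "integrable M (\<lambda>x. b x * (b x * (u x)\<^sup>2))" by (intro integrable_mult_bounded(2)[OF _ b] u)
    moreover have "b x * (b x * (u x)\<^sup>2) = (b x * u x)\<^sup>2" for x by (simp add: power2_eq_square algebra_simps)
    ultimately show ?thesis by simp
  qed
  have iu: "integrable M (\<lambda>x. b x * (u x)\<^sup>2)" by (rule integrable_mult_bounded(2)[OF u(2) b])
  have id: "integrable M (\<lambda>x. (v n x - u x)\<^sup>2)" for n using integrable_square_diff[OF v(1) u(1) v(2) u(2)] .
  have ibd: "integrable M (\<lambda>x. b x * (v n x - u x)\<^sup>2)" for n by (rule integrable_mult_bounded(2)[OF id b])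
  have ibuv: "integrable M (\<lambda>x. (b x * u x) * v n x)" for n by (rule integrable_mult_L2[OF bu v(1) ibu v(2)])
  have eq: "integral\<^sup>L M (\<lambda>x. b x * (v n x)\<^sup>2) = 2 * integral\<^sup>L M (\<lambda>x. (b x * u x) * v n x) - integral\<^sup>L M (\<lambda>x. b x * (u x)\<^sup>2) + integral\<^sup>L M (\<lambda>x. b x * (v n x - u x)\<^sup>2)" for n
  proof -
    have "b x * (v n x)\<^sup>2 = 2 * ((b x * u x) * v n x) - b x * (u x)\<^sup>2 + b x * (v n x - u x)\<^sup>2" for x
      by (simp add: power2_eq_square algebra_simps)
    then show ?thesis using ibuv iu ibd by simp
  qed
  have 1: "(\<lambda>n. integral\<^sup>L M (\<lambda>x. (b x * u x) * v n x)) \<longlonglongrightarrow> integral\<^sup>L M (\<lambda>x. (b x * u x) * u x)"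
    by (rule L2_tendsto_mult[OF bu ibu u v lim])
  have 2: "(\<lambda>n. integral\<^sup>L M (\<lambda>x. b x * (v n x - u x)\<^sup>2)) \<longlonglongrightarrow> 0"
  proof (rule Lim_null_comparison)
    show "\<forall>\<^sub>F n in sequentially. norm (integral\<^sup>L M (\<lambda>x. b x * (v n x - u x)\<^sup>2)) \<le> B * integral\<^sup>L M (\<lambda>x. (v n x - u x)\<^sup>2)"
    proof (intro always_eventually allI)
      fix n
      have "norm (integral\<^sup>L M (\<lambda>x. b x * (v n x - u x)\<^sup>2)) \<le> integral\<^sup>L M (\<lambda>x. norm (b x * (v n x - u x)\<^sup>2))"
        by (rule Bochner_Integration.integral_norm_bound)
      also have "\<dots> \<le> integral\<^sup>L M (\<lambda>x. B * (v n x - u x)\<^sup>2)"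
      proof (rule integral_mono_AE)
        show "integrable M (\<lambda>x. norm (b x * (v n x - u x)\<^sup>2))" by (rule integrable_norm[OF ibd])
        show "integrable M (\<lambda>x. B * (v n x - u x)\<^sup>2)" using id by simp
        show "AE x in M. norm (b x * (v n x - u x)\<^sup>2) \<le> B * (v n x - u x)\<^sup>2"
          using b(2) by eventually_elim (simp add: abs_mult mult_right_mono)
      qed
      finally show "norm (integral\<^sup>L M (\<lambda>x. b x * (v n x - u x)\<^sup>2)) \<le> B * integral\<^sup>L M (\<lambda>x. (v n x - u x)\<^sup>2)" by simp
    qed
    show "(\<lambda>n. B * integral\<^sup>L M (\<lambda>x. (v n x - u x)\<^sup>2)) \<longlonglongrightarrow> 0" using tendsto_mult[OF tendsto_const lim, of B] by simp
  qed
  have "(\<lambda>n. integral\<^sup>L M (\<lambda>x. b x * (v n x)\<^sup>2)) \<longlonglongrightarrow> 2 * integral\<^sup>L M (\<lambda>x. (b x * u x) * u x) - integral\<^sup>L M (\<lambda>x. b x * (u x)\<^sup>2) + 0"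
    unfolding eq by (intro tendsto_intros 1 2)
  moreover have "integral\<^sup>L M (\<lambda>x. (b x * u x) * u x) = integral\<^sup>L M (\<lambda>x. b x * (u x)\<^sup>2)"
    by (simp add: power2_eq_square mult.assoc)
  ultimately show ?thesis by simp
qed

lemma test_fn_L2:
  fixes \<phi> :: "'a::euclidean_space \<Rightarrow> real"
  assumes U: "open U" and t: "test_fn U \<phi> g"
  shows "\<phi> \<in> borel_measurable (lebesgue_on U)" "g \<in> borel_measurable (lebesgue_on U)"
    "integrable (lebesgue_on U) (\<lambda>x. (\<phi> x)\<^sup>2)" "integrable (lebesgue_on U) (\<lambda>x. (norm (g x))\<^sup>2)"
proof -
  obtain K where K: "compact K" "K \<subseteq> U" "\<And>x. x \<notin> K \<Longrightarrow> \<phi> x = 0" "\<And>x. x \<notin> K \<Longrightarrow> g x = 0"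
    using test_fn_grad_zero[OF t] by blast
  have c: "continuous_on U \<phi>" "continuous_on U g"
    using t C1_fn_continuous continuous_on_subset unfolding test_fn_C1 C1_fn_def by blast+
  have Us: "U \<in> sets lebesgue" using U by auto
  show "\<phi> \<in> borel_measurable (lebesgue_on U)" "g \<in> borel_measurable (lebesgue_on U)"
    by (rule continuous_imp_measurable_on_sets_lebesgue[OF c(1) Us], rule continuous_imp_measurable_on_sets_lebesgue[OF c(2) Us])
  show "integrable (lebesgue_on U) (\<lambda>x. (\<phi> x)\<^sup>2)" "integrable (lebesgue_on U) (\<lambda>x. (norm (g x))\<^sup>2)"
    by (rule lebesgue_on_zero_extension(2)[OF U _ K(1,2)]; (intro continuous_intros c)?; simp add: K)+
qed

lemma integrable_inner_square:
  fixes G :: "'a \<Rightarrow> 'b::euclidean_space"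
  assumes "G \<in> borel_measurable M" "integrable M (\<lambda>x. (norm (G x))\<^sup>2)" "e \<in> Basis"
  shows "integrable M (\<lambda>x. (G x \<bullet> e)\<^sup>2)" "(\<lambda>x. G x \<bullet> e) \<in> borel_measurable M"
proof -
  show m: "(\<lambda>x. G x \<bullet> e) \<in> borel_measurable M" using assms(1) by simp
  have "(G x \<bullet> e)\<^sup>2 \<le> (norm (G x))\<^sup>2" for x
    using Basis_le_norm[OF assms(3), of "G x"] by (metis abs_ge_zero power2_abs power_mono)
  then show "integrable M (\<lambda>x. (G x \<bullet> e)\<^sup>2)"
    using m by (intro Bochner_Integration.integrable_bound[OF assms(2)]) auto
qed

lemma integrable_norm_square_diff:
  fixes F G :: "'a \<Rightarrow> 'b::euclidean_space"
  assumes "F \<in> borel_measurable M" "integrable M (\<lambda>x. (norm (F x))\<^sup>2)" "G \<in> borel_measurable M" "integrable M (\<lambda>x. (norm (G x))\<^sup>2)"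
  shows "integrable M (\<lambda>x. (norm (F x - G x))\<^sup>2)"
proof -
  have "(norm y)\<^sup>2 = (\<Sum>e\<in>Basis. (y \<bullet> e)\<^sup>2)" for y :: 'b
    unfolding power2_norm_eq_inner euclidean_inner[of y y] by (simp add: power2_eq_square)
  then show ?thesis
    by (simp add: inner_diff_left) (intro Bochner_Integration.integrable_sum integrable_square_diff integrable_inner_square assms)
qed

section \<open>Density arguments for functions with zero boundary values\<close>

lemma W0_with_grad:
  fixes u :: "'a::euclidean_space \<Rightarrow> real"
  assumes U: "open U" and u: "W0 U u" and G: "weak_grad U u G"
  obtains \<phi> g where "\<And>n::nat. test_fn U (\<phi> n) (g n)"
    "(\<lambda>n. integral\<^sup>L (lebesgue_on U) (\<lambda>x. (\<phi> n x - u x)\<^sup>2)) \<longlonglongrightarrow> 0"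
    "(\<lambda>n. integral\<^sup>L (lebesgue_on U) (\<lambda>x. (norm (g n x - G x))\<^sup>2)) \<longlonglongrightarrow> 0"
proof -
  obtain G0 \<phi> g where W: "W12 U u G0" and t: "\<And>n::nat. test_fn U (\<phi> n) (g n)"
    and 1: "(\<lambda>n. integral\<^sup>L (lebesgue_on U) (\<lambda>x. (\<phi> n x - u x)\<^sup>2)) \<longlonglongrightarrow> 0"
    and 2: "(\<lambda>n. integral\<^sup>L (lebesgue_on U) (\<lambda>x. (norm (g n x - G0 x))\<^sup>2)) \<longlonglongrightarrow> 0"
    using u unfolding W0_def by blast
  have "AE x in lebesgue_on U. G0 x = G x" using W weak_grad_unique[OF U _ G] unfolding W12_def by blast
  then have "integral\<^sup>L (lebesgue_on U) (\<lambda>x. (norm (g n x - G0 x))\<^sup>2) = integral\<^sup>L (lebesgue_on U) (\<lambda>x. (norm (g n x - G x))\<^sup>2)" for n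
    using U by (intro AE_lebesgue_on_eq_integral(1)) (auto elim!: eventually_mono)
  then show thesis using that[OF t 1] 2 by simp
qed

lemma W0_L2: "W0 U u \<Longrightarrow> u \<in> borel_measurable (lebesgue_on U) \<and> integrable (lebesgue_on U) (\<lambda>x. (u x)\<^sup>2)"
  unfolding W0_def W12_def L2_def by blast

lemma tendsto_inner_component:
  fixes g :: "nat \<Rightarrow> 'a \<Rightarrow> 'b::euclidean_space"
  assumes G: "G \<in> borel_measurable M" "integrable M (\<lambda>x. (norm (G x))\<^sup>2)"
    and g: "\<And>n. g n \<in> borel_measurable M" "\<And>n. integrable M (\<lambda>x. (norm (g n x))\<^sup>2)"
    and lim: "(\<lambda>n. integral\<^sup>L M (\<lambda>x. (norm (g n x - G x))\<^sup>2)) \<longlonglongrightarrow> 0" and e: "e \<in> Basis"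
  shows "(\<lambda>n. integral\<^sup>L M (\<lambda>x. (g n x \<bullet> e - G x \<bullet> e)\<^sup>2)) \<longlonglongrightarrow> 0"
proof (rule Lim_null_comparison[OF _ lim], intro always_eventually allI)
  fix n
  have i: "integrable M (\<lambda>x. (norm (g n x - G x))\<^sup>2)" by (rule integrable_norm_square_diff[OF g G])
  have m: "(\<lambda>x. g n x - G x) \<in> borel_measurable M" using g(1) G(1) by simp
  have "integral\<^sup>L M (\<lambda>x. ((g n x - G x) \<bullet> e)\<^sup>2) \<le> integral\<^sup>L M (\<lambda>x. (norm (g n x - G x))\<^sup>2)"
  proof (rule integral_mono[OF integrable_inner_square(1)[OF m i e] i])
    show "((g n x - G x) \<bullet> e)\<^sup>2 \<le> (norm (g n x - G x))\<^sup>2" for x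
      using Basis_le_norm[OF e, of "g n x - G x"] by (metis abs_ge_zero power2_abs power_mono)
  qed
  then show "norm (integral\<^sup>L M (\<lambda>x. (g n x \<bullet> e - G x \<bullet> e)\<^sup>2)) \<le> integral\<^sup>L M (\<lambda>x. (norm (g n x - G x))\<^sup>2)"
    using Bochner_Integration.integral_nonneg[of M "\<lambda>x. ((g n x - G x) \<bullet> e)\<^sup>2"] by (simp add: inner_diff_left)
qed

lemma integral_inner_sum:
  fixes F G :: "'a \<Rightarrow> 'b::euclidean_space"
  assumes "F \<in> borel_measurable M" "integrable M (\<lambda>x. (norm (F x))\<^sup>2)" "G \<in> borel_measurable M" "integrable M (\<lambda>x. (norm (G x))\<^sup>2)"
  shows "integrable M (\<lambda>x. F x \<bullet> G x)"
    "integral\<^sup>L M (\<lambda>x. F x \<bullet> G x) = (\<Sum>e\<in>Basis. integral\<^sup>L M (\<lambda>x. (F x \<bullet> e) * (G x \<bullet> e)))"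
proof -
  have i: "integrable M (\<lambda>x. (F x \<bullet> e) * (G x \<bullet> e))" if "e \<in> Basis" for e
    using that assms by (intro integrable_mult_L2 integrable_inner_square) auto
  have e: "F x \<bullet> G x = (\<Sum>e\<in>Basis. (F x \<bullet> e) * (G x \<bullet> e))" for x by (rule euclidean_inner)
  show "integrable M (\<lambda>x. F x \<bullet> G x)" unfolding e using i by (intro Bochner_Integration.integrable_sum) auto
  show "integral\<^sup>L M (\<lambda>x. F x \<bullet> G x) = (\<Sum>e\<in>Basis. integral\<^sup>L M (\<lambda>x. (F x \<bullet> e) * (G x \<bullet> e)))"
    unfolding e using i by (rule Bochner_Integration.integral_sum)
qed

text \<open>Both sides are continuous in \<open>u\<close> and its gradient for the
  \<open>L^2\<close> norms, so a weak equation tested with test functions may also be tested with an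
  element of \<open>W0\<close>.\<close>

lemma W0_linear_limit:
  fixes u :: "'a::euclidean_space \<Rightarrow> real"
  assumes U: "open U" and u: "W0 U u" and G: "weak_grad U u G" "L2vec U G" and F: "L2vec U F" and f: "L2 U f"
    and test: "\<And>\<phi> g. test_fn U \<phi> g \<Longrightarrow> integral\<^sup>L (lebesgue_on U) (\<lambda>x. F x \<bullet> g x) = - integral\<^sup>L (lebesgue_on U) (\<lambda>x. f x * \<phi> x)"
  shows "integral\<^sup>L (lebesgue_on U) (\<lambda>x. F x \<bullet> G x) = - integral\<^sup>L (lebesgue_on U) (\<lambda>x. f x * u x)"
proof -
  let ?M = "lebesgue_on U"
  obtain \<phi> g where t: "\<And>n::nat. test_fn U (\<phi> n) (g n)"
    and l: "(\<lambda>n. integral\<^sup>L ?M (\<lambda>x. (\<phi> n x - u x)\<^sup>2)) \<longlonglongrightarrow> 0" "(\<lambda>n. integral\<^sup>L ?M (\<lambda>x. (norm (g n x - G x))\<^sup>2)) \<longlonglongrightarrow> 0"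
    using W0_with_grad[OF U u G(1)] by blast
  note tt = test_fn_L2[OF U t]
  have Gm: "G \<in> borel_measurable ?M" "integrable ?M (\<lambda>x. (norm (G x))\<^sup>2)" using G(2) unfolding L2vec_def by auto
  have Fm: "F \<in> borel_measurable ?M" "integrable ?M (\<lambda>x. (norm (F x))\<^sup>2)" using F unfolding L2vec_def by auto
  have fm: "f \<in> borel_measurable ?M" "integrable ?M (\<lambda>x. (f x)\<^sup>2)" using f unfolding L2_def by auto
  have um: "u \<in> borel_measurable ?M" "integrable ?M (\<lambda>x. (u x)\<^sup>2)" using W0_L2[OF u] by auto
  have "(\<lambda>n. integral\<^sup>L ?M (\<lambda>x. F x \<bullet> g n x)) \<longlonglongrightarrow> integral\<^sup>L ?M (\<lambda>x. F x \<bullet> G x)"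
    unfolding integral_inner_sum(2)[OF Fm tt(2,4)] integral_inner_sum(2)[OF Fm Gm]
    by (intro tendsto_sum L2_tendsto_mult integrable_inner_square[OF Fm] integrable_inner_square[OF Gm] integrable_inner_square[OF tt(2,4)]
        tendsto_inner_component[OF Gm tt(2,4) l(2)])
  moreover have "(\<lambda>n. integral\<^sup>L ?M (\<lambda>x. F x \<bullet> g n x)) \<longlonglongrightarrow> - integral\<^sup>L ?M (\<lambda>x. f x * u x)"
    unfolding test[OF t] by (intro tendsto_minus L2_tendsto_mult fm um tt(1,3) l(1))
  ultimately show ?thesis by (rule LIMSEQ_unique)
qed

text \<open>Boundedness of \<open>b\<close> makes all three integrals continuous along the
  approximation; with this, coercivity on test functions passes to the difference of two
  competitors.\<close>

lemma W0_quadratic_limit: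
  fixes u :: "'a::euclidean_space \<Rightarrow> real"
  assumes U: "open U" and u: "W0 U u" and G: "weak_grad U u G" "L2vec U G"
    and b: "b \<in> borel_measurable (lebesgue_on U)" "AE x in lebesgue_on U. \<bar>b x\<bar> \<le> B"
    and test: "\<And>\<phi> g. test_fn U \<phi> g \<Longrightarrow> \<epsilon> * integral\<^sup>L (lebesgue_on U) (\<lambda>x. (\<phi> x)\<^sup>2) \<le> integral\<^sup>L (lebesgue_on U) (\<lambda>x. (norm (g x))\<^sup>2 + b x * (\<phi> x)\<^sup>2)"
  shows "\<epsilon> * integral\<^sup>L (lebesgue_on U) (\<lambda>x. (u x)\<^sup>2) \<le> integral\<^sup>L (lebesgue_on U) (\<lambda>x. (norm (G x))\<^sup>2) + integral\<^sup>L (lebesgue_on U) (\<lambda>x. b x * (u x)\<^sup>2)"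
proof -
  let ?M = "lebesgue_on U"
  obtain \<phi> g where t: "\<And>n::nat. test_fn U (\<phi> n) (g n)"
    and l: "(\<lambda>n. integral\<^sup>L ?M (\<lambda>x. (\<phi> n x - u x)\<^sup>2)) \<longlonglongrightarrow> 0" "(\<lambda>n. integral\<^sup>L ?M (\<lambda>x. (norm (g n x - G x))\<^sup>2)) \<longlonglongrightarrow> 0"
    using W0_with_grad[OF U u G(1)] by blast
  note tt = test_fn_L2[OF U t]
  have Gm: "G \<in> borel_measurable ?M" "integrable ?M (\<lambda>x. (norm (G x))\<^sup>2)" using G(2) unfolding L2vec_def by auto
  have um: "u \<in> borel_measurable ?M" "integrable ?M (\<lambda>x. (u x)\<^sup>2)" using W0_L2[OF u] by auto
  have sq: "(\<lambda>n. integral\<^sup>L ?M (\<lambda>x. 1 * (v n x)\<^sup>2)) \<longlonglongrightarrow> integral\<^sup>L ?M (\<lambda>x. 1 * (w x)\<^sup>2)"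
    if "w \<in> borel_measurable ?M" "integrable ?M (\<lambda>x. (w x)\<^sup>2)" "\<And>n. v n \<in> borel_measurable ?M" "\<And>n. integrable ?M (\<lambda>x. (v n x)\<^sup>2)"
      "(\<lambda>n. integral\<^sup>L ?M (\<lambda>x. (v n x - w x)\<^sup>2)) \<longlonglongrightarrow> 0" for v :: "nat \<Rightarrow> 'a \<Rightarrow> real" and w
    by (rule L2_tendsto_square[where B=1]) (use that in auto)
  have 1: "(\<lambda>n. \<epsilon> * integral\<^sup>L ?M (\<lambda>x. (\<phi> n x)\<^sup>2)) \<longlonglongrightarrow> \<epsilon> * integral\<^sup>L ?M (\<lambda>x. (u x)\<^sup>2)"
    using sq[OF um tt(1,3) l(1)] by (intro tendsto_intros) simp
  have nn: "(norm y)\<^sup>2 = y \<bullet> y" for y :: 'a by (rule power2_norm_eq_inner)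
  have 2: "(\<lambda>n. integral\<^sup>L ?M (\<lambda>x. (norm (g n x))\<^sup>2)) \<longlonglongrightarrow> integral\<^sup>L ?M (\<lambda>x. (norm (G x))\<^sup>2)"
    unfolding nn integral_inner_sum(2)[OF tt(2,4) tt(2,4)] integral_inner_sum(2)[OF Gm Gm]
  proof (rule tendsto_sum)
    fix e :: 'a assume e: "e \<in> Basis"
    show "(\<lambda>n. integral\<^sup>L ?M (\<lambda>x. (g n x \<bullet> e) * (g n x \<bullet> e))) \<longlonglongrightarrow> integral\<^sup>L ?M (\<lambda>x. (G x \<bullet> e) * (G x \<bullet> e))"
      using sq[OF integrable_inner_square(2,1)[OF Gm e] integrable_inner_square(2,1)[OF tt(2,4) e] tendsto_inner_component[OF Gm tt(2,4) l(2) e]]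
      by (simp add: power2_eq_square)
  qed
  have 3: "(\<lambda>n. integral\<^sup>L ?M (\<lambda>x. b x * (\<phi> n x)\<^sup>2)) \<longlonglongrightarrow> integral\<^sup>L ?M (\<lambda>x. b x * (u x)\<^sup>2)"
    by (rule L2_tendsto_square[OF b um tt(1,3) l(1)])
  have le: "\<epsilon> * integral\<^sup>L ?M (\<lambda>x. (\<phi> n x)\<^sup>2) \<le> integral\<^sup>L ?M (\<lambda>x. (norm (g n x))\<^sup>2) + integral\<^sup>L ?M (\<lambda>x. b x * (\<phi> n x)\<^sup>2)" for n
    using test[OF t[of n]] tt(4)[of n] integrable_mult_bounded(2)[OF tt(3)[of n] b] by simp
  show ?thesis by (rule LIMSEQ_le[OF 1 tendsto_add[OF 2 3]]) (use le in auto)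
qed

lemma W12_diff:
  fixes u v :: "'a::euclidean_space \<Rightarrow> real"
  assumes U: "open U" and u: "W12 U u G" and v: "W12 U v H"
  shows "W12 U (\<lambda>x. u x - v x) (\<lambda>x. G x - H x)"
  using weak_grad_add_scale[OF U, of u G v H "-1"] integrable_square_diff[of u "lebesgue_on U" v] integrable_norm_square_diff[of G "lebesgue_on U" H] u v
  unfolding W12_def L2_def L2vec_def by auto

lemma power2_norm_diff_le: "(norm (a - b))\<^sup>2 \<le> 2 * (norm a)\<^sup>2 + 2 * (norm (b::'b::real_inner))\<^sup>2"
proof -
  have "0 \<le> (norm (a + b))\<^sup>2" by simp
  then show ?thesis unfolding power2_norm_eq_inner
    by (simp add: inner_diff_left inner_diff_right inner_add_left inner_add_right inner_commute)
qed

text \<open>Both the competitor and the hedgehog differ from \<open>Qb\<close> by an element of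
  \<open>W0\<close>; this brings their difference into \<open>W0\<close>.\<close>

lemma W0_diff:
  fixes u v :: "'a::euclidean_space \<Rightarrow> real"
  assumes U: "open U" and u: "W0 U u" and v: "W0 U v"
  shows "W0 U (\<lambda>x. u x - v x)"
proof -
  let ?M = "lebesgue_on U"
  obtain G \<phi> g where W: "W12 U u G" and t: "\<And>n::nat. test_fn U (\<phi> n) (g n)"
    and 1: "(\<lambda>n. integral\<^sup>L ?M (\<lambda>x. (\<phi> n x - u x)\<^sup>2)) \<longlonglongrightarrow> 0"
    and 2: "(\<lambda>n. integral\<^sup>L ?M (\<lambda>x. (norm (g n x - G x))\<^sup>2)) \<longlonglongrightarrow> 0"
    using u unfolding W0_def by blast
  obtain H \<psi> k where W': "W12 U v H" and t': "\<And>n::nat. test_fn U (\<psi> n) (k n)"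
    and b1: "(\<lambda>n. integral\<^sup>L ?M (\<lambda>x. (\<psi> n x - v x)\<^sup>2)) \<longlonglongrightarrow> 0"
    and b2: "(\<lambda>n. integral\<^sup>L ?M (\<lambda>x. (norm (k n x - H x))\<^sup>2)) \<longlonglongrightarrow> 0"
    using v unfolding W0_def by blast
  note tt = test_fn_L2[OF U t] and tt' = test_fn_L2[OF U t']
  have m: "u \<in> borel_measurable ?M" "integrable ?M (\<lambda>x. (u x)\<^sup>2)" "G \<in> borel_measurable ?M" "integrable ?M (\<lambda>x. (norm (G x))\<^sup>2)"
    "v \<in> borel_measurable ?M" "integrable ?M (\<lambda>x. (v x)\<^sup>2)" "H \<in> borel_measurable ?M" "integrable ?M (\<lambda>x. (norm (H x))\<^sup>2)"
    using W W' unfolding W12_def L2_def L2vec_def by auto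
  have tn: "test_fn U (\<lambda>x. \<phi> n x - \<psi> n x) (\<lambda>x. g n x - k n x)" for n
  proof -
    obtain K K' where K: "compact K" "K \<subseteq> U" "\<And>x. x \<notin> K \<Longrightarrow> \<phi> n x = 0" "compact K'" "K' \<subseteq> U" "\<And>x. x \<notin> K' \<Longrightarrow> \<psi> n x = 0"
      using t[of n] t'[of n] unfolding test_fn_def by blast
    have "((\<lambda>x. \<phi> n x - \<psi> n x) has_derivative (\<lambda>v. (g n x - k n x) \<bullet> v)) (at x)" for x
      using has_derivative_diff[of "\<phi> n" "\<lambda>v. g n x \<bullet> v" "at x" "\<psi> n" "\<lambda>v. k n x \<bullet> v"] t[of n] t'[of n]
      unfolding test_fn_def by (simp add: inner_diff_left)
    moreover have "continuous_on UNIV (\<lambda>x. g n x - k n x)" using t[of n] t'[of n] unfolding test_fn_def by (intro continuous_intros) auto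
    moreover have "compact (K \<union> K')" "K \<union> K' \<subseteq> U" "\<forall>x. x \<notin> K \<union> K' \<longrightarrow> \<phi> n x - \<psi> n x = 0" using K by auto
    ultimately show ?thesis unfolding test_fn_def by blast
  qed
  have l1: "(\<lambda>n. integral\<^sup>L ?M (\<lambda>x. ((\<phi> n x - \<psi> n x) - (u x - v x))\<^sup>2)) \<longlonglongrightarrow> 0"
  proof (rule Lim_null_comparison[where g="\<lambda>n. 2 * integral\<^sup>L ?M (\<lambda>x. (\<phi> n x - u x)\<^sup>2) + 2 * integral\<^sup>L ?M (\<lambda>x. (\<psi> n x - v x)\<^sup>2)"], intro always_eventually allI)
    fix n
    have i: "integrable ?M (\<lambda>x. (\<phi> n x - u x)\<^sup>2)" "integrable ?M (\<lambda>x. (\<psi> n x - v x)\<^sup>2)"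
      by (intro integrable_square_diff tt tt' m)+
    have j: "integrable ?M (\<lambda>x. ((\<phi> n x - u x) - (\<psi> n x - v x))\<^sup>2)"
      using tt(1)[of n] tt'(1)[of n] m by (intro integrable_square_diff i) auto
    have "integral\<^sup>L ?M (\<lambda>x. ((\<phi> n x - u x) - (\<psi> n x - v x))\<^sup>2) \<le> integral\<^sup>L ?M (\<lambda>x. 2 * (\<phi> n x - u x)\<^sup>2 + 2 * (\<psi> n x - v x)\<^sup>2)"
      using i j power2_norm_diff_le[of "\<phi> n _ - u _" "\<psi> n _ - v _"] by (intro integral_mono) auto
    also have "\<dots> = 2 * integral\<^sup>L ?M (\<lambda>x. (\<phi> n x - u x)\<^sup>2) + 2 * integral\<^sup>L ?M (\<lambda>x. (\<psi> n x - v x)\<^sup>2)" using i by simp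
    also have "(\<lambda>x. ((\<phi> n x - u x) - (\<psi> n x - v x))\<^sup>2) = (\<lambda>x. ((\<phi> n x - \<psi> n x) - (u x - v x))\<^sup>2)" by (auto simp: algebra_simps)
    finally show "norm (integral\<^sup>L ?M (\<lambda>x. ((\<phi> n x - \<psi> n x) - (u x - v x))\<^sup>2)) \<le> 2 * integral\<^sup>L ?M (\<lambda>x. (\<phi> n x - u x)\<^sup>2) + 2 * integral\<^sup>L ?M (\<lambda>x. (\<psi> n x - v x)\<^sup>2)"
      using Bochner_Integration.integral_nonneg[of ?M "\<lambda>x. ((\<phi> n x - \<psi> n x) - (u x - v x))\<^sup>2"] by simp
  next
    show "(\<lambda>n. 2 * integral\<^sup>L ?M (\<lambda>x. (\<phi> n x - u x)\<^sup>2) + 2 * integral\<^sup>L ?M (\<lambda>x. (\<psi> n x - v x)\<^sup>2)) \<longlonglongrightarrow> 0"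
      using tendsto_add[OF tendsto_mult[OF tendsto_const[of 2] 1] tendsto_mult[OF tendsto_const[of 2] b1]] by simp
  qed
  have l2: "(\<lambda>n. integral\<^sup>L ?M (\<lambda>x. (norm ((g n x - k n x) - (G x - H x)))\<^sup>2)) \<longlonglongrightarrow> 0"
  proof (rule Lim_null_comparison[where g="\<lambda>n. 2 * integral\<^sup>L ?M (\<lambda>x. (norm (g n x - G x))\<^sup>2) + 2 * integral\<^sup>L ?M (\<lambda>x. (norm (k n x - H x))\<^sup>2)"], intro always_eventually allI)
    fix n
    have i: "integrable ?M (\<lambda>x. (norm (g n x - G x))\<^sup>2)" "integrable ?M (\<lambda>x. (norm (k n x - H x))\<^sup>2)"
      by (intro integrable_norm_square_diff tt tt' m)+
    have j: "integrable ?M (\<lambda>x. (norm ((g n x - G x) - (k n x - H x)))\<^sup>2)"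
      using tt(2)[of n] tt'(2)[of n] m by (intro integrable_norm_square_diff i) auto
    have "integral\<^sup>L ?M (\<lambda>x. (norm ((g n x - G x) - (k n x - H x)))\<^sup>2) \<le> integral\<^sup>L ?M (\<lambda>x. 2 * (norm (g n x - G x))\<^sup>2 + 2 * (norm (k n x - H x))\<^sup>2)"
      using i j power2_norm_diff_le by (intro integral_mono) auto
    also have "\<dots> = 2 * integral\<^sup>L ?M (\<lambda>x. (norm (g n x - G x))\<^sup>2) + 2 * integral\<^sup>L ?M (\<lambda>x. (norm (k n x - H x))\<^sup>2)" using i by simp
    also have "(\<lambda>x. (norm ((g n x - G x) - (k n x - H x)))\<^sup>2) = (\<lambda>x. (norm ((g n x - k n x) - (G x - H x)))\<^sup>2)" by (auto simp: algebra_simps)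
    finally show "norm (integral\<^sup>L ?M (\<lambda>x. (norm ((g n x - k n x) - (G x - H x)))\<^sup>2)) \<le> 2 * integral\<^sup>L ?M (\<lambda>x. (norm (g n x - G x))\<^sup>2) + 2 * integral\<^sup>L ?M (\<lambda>x. (norm (k n x - H x))\<^sup>2)"
      using Bochner_Integration.integral_nonneg[of ?M "\<lambda>x. (norm ((g n x - k n x) - (G x - H x)))\<^sup>2"] by simp
  next
    show "(\<lambda>n. 2 * integral\<^sup>L ?M (\<lambda>x. (norm (g n x - G x))\<^sup>2) + 2 * integral\<^sup>L ?M (\<lambda>x. (norm (k n x - H x))\<^sup>2)) \<longlonglongrightarrow> 0"
      using tendsto_add[OF tendsto_mult[OF tendsto_const[of 2] 2] tendsto_mult[OF tendsto_const[of 2] b2]] by simp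
  qed
  show ?thesis unfolding W0_def using W12_diff[OF U W W'] tn l1 l2 by (intro exI conjI allI)
qed

section \<open>Integrability of fourth powers\<close>

lemma L2_approx_bounded:
  fixes v :: "nat \<Rightarrow> 'a \<Rightarrow> 'b::euclidean_space"
  assumes u: "u \<in> borel_measurable M" "integrable M (\<lambda>x. (norm (u x))\<^sup>2)"
    and v: "\<And>n. v n \<in> borel_measurable M" "\<And>n. integrable M (\<lambda>x. (norm (v n x))\<^sup>2)"
    and lim: "(\<lambda>n. integral\<^sup>L M (\<lambda>x. (norm (v n x - u x))\<^sup>2)) \<longlonglongrightarrow> 0"
  obtains A where "\<And>n. integral\<^sup>L M (\<lambda>x. (norm (v n x))\<^sup>2) \<le> A"
proof -
  have "Bseq (\<lambda>n. integral\<^sup>L M (\<lambda>x. (norm (v n x - u x))\<^sup>2))" using lim convergent_imp_Bseq convergentI by blast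
  then obtain C where C: "\<And>n. \<bar>integral\<^sup>L M (\<lambda>x. (norm (v n x - u x))\<^sup>2)\<bar> \<le> C" unfolding Bseq_def by auto
  have "integral\<^sup>L M (\<lambda>x. (norm (v n x))\<^sup>2) \<le> 2 * C + 2 * integral\<^sup>L M (\<lambda>x. (norm (u x))\<^sup>2)" for n
  proof -
    have i: "integrable M (\<lambda>x. (norm (v n x - u x))\<^sup>2)" by (rule integrable_norm_square_diff[OF v u])
    have "(norm (v n x))\<^sup>2 \<le> 2 * (norm (v n x - u x))\<^sup>2 + 2 * (norm (u x))\<^sup>2" for x
      using power2_norm_diff_le[of "v n x - u x" "- u x"] by simp
    then have "integral\<^sup>L M (\<lambda>x. (norm (v n x))\<^sup>2) \<le> integral\<^sup>L M (\<lambda>x. 2 * (norm (v n x - u x))\<^sup>2 + 2 * (norm (u x))\<^sup>2)"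
      using i u(2) v(2)[of n] by (intro integral_mono) auto
    also have "\<dots> = 2 * integral\<^sup>L M (\<lambda>x. (norm (v n x - u x))\<^sup>2) + 2 * integral\<^sup>L M (\<lambda>x. (norm (u x))\<^sup>2)" using i u(2) by simp
    finally show ?thesis using C[of n] by simp
  qed
  then show thesis using that by blast
qed

lemma nn_integral_lebesgue_on_support:
  fixes f :: "'a::euclidean_space \<Rightarrow> real"
  assumes "f \<in> borel_measurable borel" "U \<in> sets lebesgue" "\<And>x. x \<notin> U \<Longrightarrow> f x = 0"
  shows "(\<integral>\<^sup>+x. ennreal (f x) \<partial>lebesgue_on U) = (\<integral>\<^sup>+x. ennreal (f x) \<partial>lborel)"
proof -
  have "(\<integral>\<^sup>+x. ennreal (f x) \<partial>lebesgue_on U) = (\<integral>\<^sup>+x. ennreal (f x) * indicator U x \<partial>lebesgue)"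
    using assms(2) by (intro nn_integral_restrict_space) simp
  also have "\<dots> = (\<integral>\<^sup>+x. ennreal (f x) \<partial>lebesgue)"
    using assms(3) by (intro nn_integral_cong) (auto simp: indicator_def)
  also have "\<dots> = (\<integral>\<^sup>+x. ennreal (f x) \<partial>lborel)" by (rule nn_integral_completion)
  finally show ?thesis .
qed

text \<open>The approximating test functions and their gradients are bounded in \<open>L^2\<close>,
  so \<open>ladyzhenskaya\<close> bounds their fourth powers by one constant, which survives the
  limit.\<close>

lemma W0_L4:
  fixes u :: "real^3 \<Rightarrow> real"
  assumes U: "open U" and u: "W0 U u"
  shows "integrable (lebesgue_on U) (\<lambda>x. (u x)^4)"
proof -
  let ?M = "lebesgue_on U"
  have Us: "U \<in> sets lebesgue" using U by auto
  obtain G \<phi> g where W: "W12 U u G" and t: "\<And>n::nat. test_fn U (\<phi> n) (g n)"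
    and l1: "(\<lambda>n. integral\<^sup>L ?M (\<lambda>x. (\<phi> n x - u x)\<^sup>2)) \<longlonglongrightarrow> 0"
    and l2: "(\<lambda>n. integral\<^sup>L ?M (\<lambda>x. (norm (g n x - G x))\<^sup>2)) \<longlonglongrightarrow> 0"
    using u unfolding W0_def by blast
  note tt = test_fn_L2[OF U t]
  have m: "u \<in> borel_measurable ?M" "integrable ?M (\<lambda>x. (u x)\<^sup>2)" "G \<in> borel_measurable ?M" "integrable ?M (\<lambda>x. (norm (G x))\<^sup>2)"
    using W unfolding W12_def L2_def L2vec_def by auto
  obtain A where A: "\<And>n. integral\<^sup>L ?M (\<lambda>x. (\<phi> n x)\<^sup>2) \<le> A"
    using L2_approx_bounded[of u ?M \<phi>] m(1,2) tt(1,3) l1 by auto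
  obtain B where B: "\<And>n. integral\<^sup>L ?M (\<lambda>x. (norm (g n x))\<^sup>2) \<le> B"
    using L2_approx_bounded[OF m(3,4) tt(2,4) l2] by blast
  define C where "C = 8 * ((ennreal A + ennreal B) * ennreal B)"
  have Cfin: "C < \<infinity>" unfolding C_def by (simp add: ennreal_mult_less_top less_top[symmetric] ennreal_mult_eq_top_iff)
  have bound: "(\<integral>\<^sup>+x. ennreal ((\<phi> n x)^4) \<partial>?M) \<le> C" for n
  proof -
    obtain K where K: "compact K" "K \<subseteq> U" "\<And>x. x \<notin> K \<Longrightarrow> \<phi> n x = 0" "\<And>x. x \<notin> K \<Longrightarrow> g n x = 0"
      using test_fn_grad_zero[OF t] by blast
    have C1: "C1_fn (\<phi> n) (g n)" using t unfolding test_fn_C1 by blast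
    have c: "continuous_on UNIV (\<phi> n)" "continuous_on UNIV (g n)"
      using C1_fn_continuous[OF C1] C1 unfolding C1_fn_def by auto
    have e: "(\<integral>\<^sup>+x. ennreal (f x) \<partial>lborel) = ennreal (integral\<^sup>L ?M f)"
      if "continuous_on UNIV f" "\<And>x. x \<notin> K \<Longrightarrow> f x = 0" "\<And>x. 0 \<le> f x" for f
    proof -
      have "integral\<^sup>L ?M f = integral\<^sup>L lborel f"
        using that K by (intro integral_lebesgue_on_support(1) Us borel_measurable_continuous_onI) auto
      moreover have "(\<integral>\<^sup>+x. ennreal (f x) \<partial>lborel) = ennreal (integral\<^sup>L lborel f)"
        using that K by (intro nn_integral_eq_integral integrable_compact_support[OF _ K(1)]) auto
      ultimately show ?thesis by simp
    qed
    have a: "(\<integral>\<^sup>+x. ennreal ((\<phi> n x)\<^sup>2) \<partial>lborel) \<le> ennreal A"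
      by (subst e) (auto intro!: continuous_intros c A ennreal_leI simp: K)
    have b: "(\<integral>\<^sup>+x. ennreal ((norm (g n x))\<^sup>2) \<partial>lborel) \<le> ennreal B"
      by (subst e) (auto intro!: continuous_intros c B ennreal_leI simp: K)
    have "(\<integral>\<^sup>+x. ennreal ((\<phi> n x)^4) \<partial>?M) = (\<integral>\<^sup>+x. ennreal ((\<phi> n x)^4) \<partial>lborel)"
      using K by (intro nn_integral_lebesgue_on_support Us borel_measurable_continuous_onI continuous_intros c) auto
    also have "\<dots> \<le> 8 * (((\<integral>\<^sup>+x. ennreal ((\<phi> n x)\<^sup>2) \<partial>lborel) + (\<integral>\<^sup>+x. ennreal ((norm (g n x))\<^sup>2) \<partial>lborel)) * (\<integral>\<^sup>+x. ennreal ((norm (g n x))\<^sup>2) \<partial>lborel))"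
      by (rule ladyzhenskaya[OF C1 K(1,3)])
    also have "\<dots> \<le> C" unfolding C_def by (intro mult_left_mono mult_mono add_mono a b) auto
    finally show ?thesis .
  qed
  \<comment> \<open>\<open>L^2\<close> convergence yields pointwise convergence almost everywhere
    only along a subsequence, which is enough for Fatou's lemma.\<close>
  obtain r where r: "strict_mono r" and ae: "AE x in ?M. (\<lambda>n. (\<phi> (r n) x - u x)\<^sup>2) \<longlonglongrightarrow> 0"
  proof -
    have "\<exists>r. strict_mono r \<and> (AE x in ?M. (\<lambda>n. (\<phi> (r n) x - u x)\<^sup>2) \<longlonglongrightarrow> 0)"
      by (rule tendsto_L1_AE_subseq) (use l1 integrable_square_diff[OF tt(1) m(1) tt(3) m(2)] in auto)
    then show thesis using that by blast
  qed
  have ae4: "AE x in ?M. (\<lambda>n. ennreal ((\<phi> (r n) x)^4)) \<longlonglongrightarrow> ennreal ((u x)^4)"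
    using ae
  proof eventually_elim
    fix x assume "(\<lambda>n. (\<phi> (r n) x - u x)\<^sup>2) \<longlonglongrightarrow> 0"
    then have "(\<lambda>n. sqrt ((\<phi> (r n) x - u x)\<^sup>2)) \<longlonglongrightarrow> sqrt 0" by (rule tendsto_real_sqrt)
    then have "(\<lambda>n. \<phi> (r n) x - u x) \<longlonglongrightarrow> 0" by (simp add: tendsto_rabs_zero_iff)
    then have "(\<lambda>n. \<phi> (r n) x) \<longlonglongrightarrow> u x" by (rule LIM_zero_cancel)
    then show "(\<lambda>n. ennreal ((\<phi> (r n) x)^4)) \<longlonglongrightarrow> ennreal ((u x)^4)" by (intro tendsto_ennrealI tendsto_power)
  qed
  have "(\<integral>\<^sup>+x. ennreal ((u x)^4) \<partial>?M) = (\<integral>\<^sup>+x. liminf (\<lambda>n. ennreal ((\<phi> (r n) x)^4)) \<partial>?M)"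
  proof (rule nn_integral_cong_AE)
    show "AE x in ?M. ennreal ((u x)^4) = liminf (\<lambda>n. ennreal ((\<phi> (r n) x)^4))"
      using ae4 by eventually_elim (rule lim_imp_Liminf[OF trivial_limit_sequentially, symmetric])
  qed
  also have "\<dots> \<le> liminf (\<lambda>n. \<integral>\<^sup>+x. ennreal ((\<phi> (r n) x)^4) \<partial>?M)"
    using tt(1) by (intro nn_integral_liminf) simp
  also have "\<dots> \<le> limsup (\<lambda>n. \<integral>\<^sup>+x. ennreal ((\<phi> (r n) x)^4) \<partial>?M)" by (rule Liminf_le_Limsup) simp
  also have "\<dots> \<le> C" by (rule Limsup_bounded) (simp add: bound)
  finally have "(\<integral>\<^sup>+x. ennreal ((u x)^4) \<partial>?M) < \<infinity>" using Cfin by (simp add: le_less_trans)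
  then show ?thesis using m(1) by (intro integrableI_nonneg) auto
qed

section \<open>The energy gap\<close>

lemma weak_grad_cong:
  fixes u v :: "'a::euclidean_space \<Rightarrow> real"
  assumes u: "weak_grad U u G" and e: "\<And>x. x \<in> U \<Longrightarrow> u x = v x"
  shows "weak_grad U v G"
proof -
  have 1: "integrable (lebesgue_on K) u = integrable (lebesgue_on K) v" if "K \<subseteq> U" for K
    by (rule Bochner_Integration.integrable_cong) (use e that in auto)
  have 2: "integral\<^sup>L (lebesgue_on U) (\<lambda>x. v x * (g x \<bullet> b)) = integral\<^sup>L (lebesgue_on U) (\<lambda>x. u x * (g x \<bullet> b))"
    for g :: "'a \<Rightarrow> 'a" and b
    by (rule Bochner_Integration.integral_cong) (use e in auto)
  show ?thesis unfolding weak_grad_def 2 using u 1 unfolding weak_grad_def by blast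
qed

lemma W12_cong:
  fixes u v :: "'a::euclidean_space \<Rightarrow> real"
  assumes u: "W12 U u G" and e: "\<And>x. x \<in> U \<Longrightarrow> u x = v x"
  shows "W12 U v G"
proof -
  have "u \<in> borel_measurable (lebesgue_on U) \<longleftrightarrow> v \<in> borel_measurable (lebesgue_on U)"
    by (rule measurable_cong) (use e in auto)
  moreover have "integrable (lebesgue_on U) (\<lambda>x. (u x)\<^sup>2) = integrable (lebesgue_on U) (\<lambda>x. (v x)\<^sup>2)"
    by (rule Bochner_Integration.integrable_cong) (use e in auto)
  ultimately show ?thesis using u weak_grad_cong[of U u G v] e unfolding W12_def L2_def by auto
qed

lemma W0_cong:
  fixes u v :: "'a::euclidean_space \<Rightarrow> real"
  assumes u: "W0 U u" and e: "\<And>x. x \<in> U \<Longrightarrow> u x = v x"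
  shows "W0 U v"
proof -
  have eq: "integral\<^sup>L (lebesgue_on U) (\<lambda>x. (\<phi> x - v x)\<^sup>2) = integral\<^sup>L (lebesgue_on U) (\<lambda>x. (\<phi> x - u x)\<^sup>2)" for \<phi>
    by (rule Bochner_Integration.integral_cong) (use e in auto)
  have "W12 U v G" if "W12 U u G" for G by (rule W12_cong[OF that e])
  then show ?thesis using u unfolding W0_def eq by blast
qed

text \<open>The class \<open>S\<close> of square integrable functions contains the entries and,
  thanks to the fourth powers, their pairwise products. Cubic and quartic terms of the density are
  then products of two members of \<open>S\<close>.\<close>

lemma integrable_bulk:
  fixes Q :: "'a \<Rightarrow> real^3^3"
  assumes one: "integrable M (\<lambda>x. 1::real)" and m: "\<And>i j. (\<lambda>x. Q x $ i $ j) \<in> borel_measurable M"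
    and i4: "\<And>i j. integrable M (\<lambda>x. (Q x $ i $ j)^4)"
  shows "integrable M (\<lambda>x. bulk t (Q x))"
proof -
  define S where "S f \<longleftrightarrow> f \<in> borel_measurable M \<and> integrable M (\<lambda>x. (f x)\<^sup>2)" for f :: "'a \<Rightarrow> real"
  have Sm: "integrable M (\<lambda>x. f x * g x)" if "S f" "S g" for f g
    using that unfolding S_def by (intro integrable_mult_L2) auto
  have Sa: "S (\<lambda>x. f x + g x)" if "S f" "S g" for f g
  proof -
    have "(f x + g x)\<^sup>2 = (f x)\<^sup>2 + 2 * (f x * g x) + (g x)\<^sup>2" for x by (simp add: power2_eq_square algebra_simps)
    moreover have "(\<lambda>x. f x + g x) \<in> borel_measurable M" using that unfolding S_def by (intro borel_measurable_add) auto
    ultimately show ?thesis using that Sm[OF that] unfolding S_def by simp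
  qed
  have S2: "S (\<lambda>x. (Q x $ i $ j)\<^sup>2)" for i j
    unfolding S_def using i4[of i j] borel_measurable_power[OF m] by (simp add: power_mult[symmetric])
  have Sp: "S (\<lambda>x. Q x $ i $ j * Q x $ k $ l)" for i j k l
    using Sm[OF S2[of i j] S2[of k l]] borel_measurable_times[OF m m] unfolding S_def by (simp add: power_mult_distrib)
  have S1: "S (\<lambda>x. Q x $ i $ j)" for i j
  proof -
    have "S (\<lambda>x. 1)" unfolding S_def using one by simp
    from Sm[OF this S2[of i j]] show ?thesis unfolding S_def using m[of i j] by simp
  qed
  have Sf: "S (\<lambda>x. fnorm2 (Q x))" unfolding fnorm2_def sum3 by (intro Sa S2)
  have "S (\<lambda>x. 1)" unfolding S_def using one by simp
  then have if2: "integrable M (\<lambda>x. fnorm2 (Q x))" "integrable M (\<lambda>x. (fnorm2 (Q x))\<^sup>2)"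
    using Sm[OF _ Sf, of "\<lambda>x. 1"] Sf unfolding S_def by auto
  have itr: "integrable M (\<lambda>x. trace (Q x ** Q x ** Q x))"
    unfolding trace_def matrix_matrix_mult_def vec_lambda_beta
    by (intro Bochner_Integration.integrable_sum Sm S1) (unfold sum3, intro Sa Sp)
  have "bulk t (Q x) = t / 8 * (1 - 2 * fnorm2 (Q x) + (fnorm2 (Q x))\<^sup>2) + hplus t / 8 * (1 + 3 * (fnorm2 (Q x))\<^sup>2 - 4 * sqrt 6 * trace (Q x ** Q x ** Q x))" for x
    unfolding bulk_def by (simp add: power2_eq_square algebra_simps)
  then show ?thesis using one if2 itr by simp
qed

section \<open>The hedgehog as a competitor\<close>

lemma hedgehog_uniaxial: "hedgehog h x = uniaxial (sqrt (3/2) * h (norm x)) (x /\<^sub>R norm x)"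
proof -
  have e: "x $ i * x $ j / (norm x)\<^sup>2 = (x /\<^sub>R norm x) $ i * (x /\<^sub>R norm x) $ j" for i j
    by (simp add: divide_inverse power2_eq_square)
  show ?thesis unfolding hedgehog_def uniaxial_def e ..
qed

lemma hedgehog_hedge_poly:
  assumes "x \<noteq> 0"
  shows "hedgehog h x $ i $ j = sqrt (3/2) * h (norm x) / (norm x)\<^sup>2 * hedge_poly i j x"
  unfolding hedgehog_def hedge_poly_def using assms by (simp add: field_simps)

lemma Qb_hedgehog: "Qb = hedgehog (\<lambda>r. 1)"
  unfolding Qb_def[abs_def] hedgehog_def[abs_def] by simp

lemma LdG_density_bulk: "LdG_density t Q D = grad_norm2 D / 2 + bulk t Q"
  unfolding LdG_density_def bulk_def by simp

text \<open>This is the derivative of \<open>sqrt (3/2) * h r / r^2\<close>, the radial factor that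
  multiplies \<open>hedge_poly\<close> in the entries of the hedgehog.\<close>

definition hedge_profile' :: "(real \<Rightarrow> real) \<Rightarrow> (real \<Rightarrow> real) \<Rightarrow> real \<Rightarrow> real" where
  "hedge_profile' h k r = sqrt (3/2) * (k r / r\<^sup>2 - 2 * h r / r^3)"

definition hedgehog_grad :: "(real \<Rightarrow> real) \<Rightarrow> (real \<Rightarrow> real) \<Rightarrow> real^3 \<Rightarrow> real^3^3^3" where
  "hedgehog_grad h k x = (\<chi> i j. rgrad (\<lambda>r. sqrt (3/2) * h r / r\<^sup>2) (hedge_profile' h k) i j x)"

lemma hedge_profile_deriv:
  assumes "(h has_real_derivative k r) (at r)" "1 < r"
  shows "((\<lambda>r. sqrt (3/2) * h r / r\<^sup>2) has_real_derivative hedge_profile' h k r) (at r)"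
proof -
  have "((\<lambda>r. h r / r\<^sup>2) has_real_derivative k r / r\<^sup>2 - 2 * h r / r^3) (at r)"
    using assms by (auto intro!: derivative_eq_intros simp: field_simps power2_eq_square power3_eq_cube)
  from DERIV_cmult[OF this, of "sqrt (3/2)"] show ?thesis unfolding hedge_profile'_def by simp
qed

lemma hedge_profile'_deriv:
  assumes "(h has_real_derivative k r) (at r)" "(k has_real_derivative l) (at r)" "1 < r"
  shows "(hedge_profile' h k has_real_derivative sqrt (3/2) * (l / r\<^sup>2 - 4 * k r / r^3 + 6 * h r / r^4)) (at r)"
proof -
  have 1: "((\<lambda>r. k r / r\<^sup>2) has_real_derivative l / r\<^sup>2 - 2 * k r / r^3) (at r)"
    using assms by (auto intro!: derivative_eq_intros simp: field_simps power2_eq_square power3_eq_cube)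
  have 2: "((\<lambda>r. 2 * h r / r^3) has_real_derivative 2 * k r / r^3 - 6 * h r / r^4) (at r)"
    using assms by (auto intro!: derivative_eq_intros simp: field_simps power2_eq_square power3_eq_cube power4_eq_xxxx)
  from DERIV_cmult[OF DERIV_diff[OF 1 2], of "sqrt (3/2)"] show ?thesis unfolding hedge_profile'_def[abs_def] by (simp add: algebra_simps)
qed

lemma W12_hedgehog:
  assumes ch: "continuous_on {1..R} h" and ck: "continuous_on {1..R} k"
    and d: "\<And>r. 1 < r \<Longrightarrow> r < R \<Longrightarrow> (h has_real_derivative k r) (at r)"
  shows "W12 (shell_int R) (\<lambda>x. hedgehog h x $ i $ j) (\<lambda>x. hedgehog_grad h k x $ i $ j)"
proof -
  have c: "continuous_on {1..R} (\<lambda>r. sqrt (3/2) * h r / r\<^sup>2)" "continuous_on {1..R} (hedge_profile' h k)"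
    unfolding hedge_profile'_def[abs_def] by (intro continuous_intros ch ck; auto)+
  have "W12 (shell_int R) (\<lambda>x. sqrt (3/2) * h (norm x) / (norm x)\<^sup>2 * hedge_poly i j x) (rgrad (\<lambda>r. sqrt (3/2) * h r / r\<^sup>2) (hedge_profile' h k) i j)"
    by (rule W12_radial_hedge[OF hedge_profile_deriv[OF d] c])
  then show ?thesis unfolding hedgehog_grad_def
    using W12_cong[of "shell_int R" _ _ "\<lambda>x. hedgehog h x $ i $ j"] hedgehog_hedge_poly shell_int_D by simp
qed

text \<open>The difference to \<open>Qb\<close> is a radial multiple of \<open>hedge_poly\<close>
  with profile \<open>1 - h\<close>. This profile is 0 at both radii and, by the strict bound on
  \<open>h\<close>, positive between them, as \<open>W0_radial_hedge\<close> requires.\<close>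

lemma hedgehog_admissible:
  assumes R: "1 < R" and ch: "continuous_on {1..R} h" and ck: "continuous_on {1..R} k"
    and d: "\<And>r. 1 < r \<Longrightarrow> r < R \<Longrightarrow> (h has_real_derivative k r) (at r)"
    and hb: "h 1 = 1" "h R = 1" "\<And>r. 1 < r \<Longrightarrow> r < R \<Longrightarrow> h r < 1"
  shows "admissible R (hedgehog h) (hedgehog_grad h k)"
  unfolding admissible_def
proof (intro conjI allI)
  have "hedgehog h x \<in> S0" if "x \<in> shell R" for x
  proof -
    have "x \<noteq> 0" using that norm_image_shell(2) by blast
    then show ?thesis unfolding hedgehog_uniaxial by (intro uniaxial_S0) simp
  qed
  then show "AE x in lebesgue_on (shell R). hedgehog h x \<in> S0" by (intro AE_I2) simp
  show "W12 (shell_int R) (\<lambda>x. hedgehog h x $ i $ j) (\<lambda>x. hedgehog_grad h k x $ i $ j)" for i j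
    by (rule W12_hedgehog[OF ch ck d])
  show "W0 (shell_int R) (\<lambda>x. hedgehog h x $ i $ j - Qb x $ i $ j)" for i j
  proof (rule W0_cong)
    show "W0 (shell_int R) (\<lambda>x. - sqrt (3/2) * (1 - h (norm x)) / (norm x)\<^sup>2 * hedge_poly i j x)"
    proof (rule W0_radial_hedge[OF R, where s="\<lambda>r. 1 - h r" and s'="\<lambda>r. - k r"])
      show "((\<lambda>r. 1 - h r) has_real_derivative - k r) (at r)" if "1 < r" "r < R" for r
        using d[OF that] by (auto intro!: derivative_eq_intros)
    qed (use hb in \<open>auto intro!: continuous_intros ch ck\<close>)
    show "- sqrt (3/2) * (1 - h (norm x)) / (norm x)\<^sup>2 * hedge_poly i j x = hedgehog h x $ i $ j - Qb x $ i $ j" if "x \<in> shell_int R" for x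
      using shell_int_D[OF that] unfolding Qb_hedgehog by (simp add: hedgehog_hedge_poly field_simps)
  qed
qed

section \<open>Comparison of the energies\<close>

lemma grad_norm2_diff:
  "grad_norm2 D - grad_norm2 E = (\<Sum>i\<in>UNIV. \<Sum>j\<in>UNIV. (norm (D $ i $ j - E $ i $ j))\<^sup>2 + 2 * (E $ i $ j \<bullet> (D $ i $ j - E $ i $ j)))"
proof -
  have "(norm a)\<^sup>2 - (norm b)\<^sup>2 = (norm (a - b))\<^sup>2 + 2 * (b \<bullet> (a - b))" for a b :: "real^3"
    unfolding power2_norm_eq_inner by (simp add: inner_diff_left inner_diff_right inner_commute)
  then show ?thesis unfolding grad_norm2_def sum_subtractf[symmetric] by simp
qed

text \<open>The gap is bounded below by a multiple of the squared \<open>L^2\<close> distance to the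
  hedgehog, so the one estimate gives both minimality and uniqueness.\<close>

lemma energy_gap:
  assumes R: "1 < R" "R < 9/4" and t: "0 \<le> t" and ch: "continuous_on {1..R} h" and ck: "continuous_on {1..R} k"
    and cl: "continuous_on {1<..<R} l"
    and d: "\<And>r. 1 < r \<Longrightarrow> r < R \<Longrightarrow> (h has_real_derivative k r) (at r)"
    and d2: "\<And>r. 1 < r \<Longrightarrow> r < R \<Longrightarrow> (k has_real_derivative l r) (at r)"
    and ode: "\<And>r. 1 < r \<Longrightarrow> r < R \<Longrightarrow> r\<^sup>2 * l r + 2 * r * k r = 6 * h r + r\<^sup>2 * (h r * bulk_coeff t (h r))"
    and hb: "\<And>r. 1 < r \<Longrightarrow> r < R \<Longrightarrow> 2/3 \<le> h r" "\<And>r. 1 < r \<Longrightarrow> r < R \<Longrightarrow> h r \<le> 1"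
    and admH: "admissible R (hedgehog h) (hedgehog_grad h k)" and adm: "admissible R Q D"
  shows "LdG R t (hedgehog h) (hedgehog_grad h k)
      + 1 / (40 * R\<^sup>2) * (\<Sum>i\<in>UNIV. \<Sum>j\<in>UNIV. integral\<^sup>L (lebesgue_on (shell_int R)) (\<lambda>x. (Q x $ i $ j - hedgehog h x $ i $ j)\<^sup>2))
    \<le> LdG R t Q D"
    and "integrable (lebesgue_on (shell_int R)) (\<lambda>x. (Q x $ i $ j - hedgehog h x $ i $ j)\<^sup>2)"
proof -
  let ?U = "shell_int R" and ?M = "lebesgue_on (shell_int R)"
  let ?H = "hedgehog h" and ?E = "hedgehog_grad h k"
  define c where "c x = bulk_coeff t (h (norm x))" for x :: "real^3"
  define V where "V i j x = Q x $ i $ j - ?H x $ i $ j" for i j x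
  define W where "W i j x = D x $ i $ j - ?E x $ i $ j" for i j x
  have cb: "continuous_on {1..R} (\<lambda>r. bulk_coeff t (h r))" unfolding bulk_coeff_def by (intro continuous_intros ch) auto
  have cc: "continuous_on (shell R) c" unfolding c_def
    by (rule continuous_on_norm_compose[OF continuous_on_subset[OF cb norm_image_shell(1)]])
  have cm: "c \<in> borel_measurable ?M" by (rule measurable_continuous_shell_int[OF continuous_on_subset[OF cc shell_int_subset]])
  obtain B where B: "\<And>x. x \<in> shell R \<Longrightarrow> \<bar>c x\<bar> \<le> B"
    using compact_imp_bounded[OF compact_continuous_image[OF cc compact_shell]] unfolding bounded_iff by force
  then have cB: "AE x in ?M. \<bar>c x\<bar> \<le> B" using shell_int_subset by (intro AE_I2) auto
  have QW: "W12 ?U (\<lambda>x. Q x $ i $ j) (\<lambda>x. D x $ i $ j)" "W0 ?U (\<lambda>x. Q x $ i $ j - Qb x $ i $ j)" for i j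
    using adm unfolding admissible_def by auto
  have HW: "W12 ?U (\<lambda>x. ?H x $ i $ j) (\<lambda>x. ?E x $ i $ j)" "W0 ?U (\<lambda>x. ?H x $ i $ j - Qb x $ i $ j)" for i j
    using admH unfolding admissible_def by auto
  have V12: "W12 ?U (V i j) (W i j)" for i j
    using W12_diff[OF open_shell_int QW(1) HW(1), of i j i j] unfolding V_def W_def .
  have V0: "W0 ?U (V i j)" for i j
    using W0_diff[OF open_shell_int QW(2) HW(2), of i j i j] unfolding V_def by simp
  have mH: "L2 ?U (\<lambda>x. ?H x $ i $ j)" "L2vec ?U (\<lambda>x. ?E x $ i $ j)" for i j using HW(1) unfolding W12_def by auto
  have mQ: "L2 ?U (\<lambda>x. Q x $ i $ j)" "L2vec ?U (\<lambda>x. D x $ i $ j)" for i j using QW(1) unfolding W12_def by auto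
  have mV: "L2 ?U (V i j)" "L2vec ?U (W i j)" "weak_grad ?U (V i j) (W i j)" for i j using V12 unfolding W12_def by auto
  have cH: "continuous_on (shell R) (\<lambda>x. ?H x $ i $ j)" for i j
    unfolding hedgehog_def using norm_image_shell(2)
    by (auto intro!: continuous_intros continuous_on_norm_compose[OF continuous_on_subset[OF ch norm_image_shell(1)]])
  have iVV: "integrable ?M (\<lambda>x. (V i j x)\<^sup>2)" for i j using mV(1) unfolding L2_def by auto
  then show "integrable ?M (\<lambda>x. (Q x $ i $ j - ?H x $ i $ j)\<^sup>2)" unfolding V_def .
  \<comment> \<open>This is the weak form of \<open>\<Delta> H = c H\<close>, tested with an entry
    of \<open>V\<close>.\<close>
  have lin: "integral\<^sup>L ?M (\<lambda>x. ?E x $ i $ j \<bullet> W i j x) = - integral\<^sup>L ?M (\<lambda>x. (c x * ?H x $ i $ j) * V i j x)" for i j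
  proof (rule W0_linear_limit[OF open_shell_int V0 mV(3,2) mH(2)])
    have ccH: "continuous_on (shell R) (\<lambda>x. c x * ?H x $ i $ j)" by (intro continuous_on_mult cc cH)
    show "L2 ?U (\<lambda>x. c x * ?H x $ i $ j)" unfolding L2_def
      using measurable_continuous_shell_int[OF continuous_on_subset[OF ccH shell_int_subset]] integrable_continuous_shell[OF continuous_on_power[OF ccH]]
      by blast
    fix \<phi> g assume tf: "test_fn ?U \<phi> g"
    let ?f' = "hedge_profile' h k"
    define f'' where "f'' r = sqrt (3/2) * (l r / r\<^sup>2 - 4 * k r / r^3 + 6 * h r / r^4)" for r
    have sub: "{1<..<R} \<subseteq> {1..R}" by auto
    have "integral\<^sup>L ?M (\<lambda>x. rgrad (\<lambda>r. sqrt (3/2) * h r / r\<^sup>2) ?f' i j x \<bullet> g x)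
      = - integral\<^sup>L ?M (\<lambda>x. (f'' (norm x) + 6 * ?f' (norm x) / norm x) * hedge_poly i j x * \<phi> x)"
    proof (rule radial_hedge_laplacian[OF tf])
      show "continuous_on {1<..<R} f''" unfolding f''_def
        by (intro continuous_intros cl continuous_on_subset[OF ch sub] continuous_on_subset[OF ck sub]) auto
      show "((\<lambda>r. sqrt (3/2) * h r / r\<^sup>2) has_real_derivative ?f' r) (at r)" if "1 < r" "r < R" for r
        using hedge_profile_deriv[of h k r] d[OF that] that by blast
      show "(?f' has_real_derivative f'' r) (at r)" if "1 < r" "r < R" for r
        unfolding f''_def using hedge_profile'_deriv[of h k r "l r"] d[OF that] d2[OF that] that by blast
    qed
    also have "integral\<^sup>L ?M (\<lambda>x. (f'' (norm x) + 6 * ?f' (norm x) / norm x) * hedge_poly i j x * \<phi> x) = integral\<^sup>L ?M (\<lambda>x. c x * ?H x $ i $ j * \<phi> x)"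
    proof (rule Bochner_Integration.integral_cong[OF refl])
      fix x assume "x \<in> space ?M"
      then have r: "1 < norm x" "norm x < R" "x \<noteq> 0" using shell_int_D by auto
      define s where "s = norm x"
      have s: "1 < s" "s < R" unfolding s_def using r by auto
      \<comment> \<open>The profile \<open>f = sqrt (3/2) * h / r^2\<close> satisfies
        \<open>f'' + 6 f' / r = c f\<close>: the factor \<open>1 / r^2\<close> absorbs the term
        \<open>6 / r^2\<close> of the equation for \<open>h\<close>.\<close>
      have "f'' s + 6 * ?f' s / s = sqrt (3/2) * ((s\<^sup>2 * l s + 2 * s * k s - 6 * h s) / s^4)"
        unfolding f''_def hedge_profile'_def using s by (simp add: field_simps power2_eq_square power3_eq_cube power4_eq_xxxx)
      also have "\<dots> = sqrt (3/2) * (s\<^sup>2 * (h s * bulk_coeff t (h s)) / s^4)" using ode[OF s] by simp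
      also have "\<dots> = bulk_coeff t (h s) * (sqrt (3/2) * h s / s\<^sup>2)" using s by (simp add: power2_eq_square power4_eq_xxxx)
      finally show "(f'' (norm x) + 6 * ?f' (norm x) / norm x) * hedge_poly i j x * \<phi> x = c x * ?H x $ i $ j * \<phi> x"
        unfolding hedgehog_hedge_poly[OF r(3)] c_def s_def by simp
    qed
    finally show "integral\<^sup>L ?M (\<lambda>x. ?E x $ i $ j \<bullet> g x) = - integral\<^sup>L ?M (\<lambda>x. c x * ?H x $ i $ j * \<phi> x)"
      unfolding hedgehog_grad_def by simp
  qed
  have quad: "1 / (20 * R\<^sup>2) * integral\<^sup>L ?M (\<lambda>x. (V i j x)\<^sup>2) \<le> integral\<^sup>L ?M (\<lambda>x. (norm (W i j x))\<^sup>2) + integral\<^sup>L ?M (\<lambda>x. c x * (V i j x)\<^sup>2)" for i j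
  proof (rule W0_quadratic_limit[OF open_shell_int V0 mV(3,2) cm cB])
    fix \<phi> g assume tf: "test_fn ?U \<phi> g"
    show "1 / (20 * R\<^sup>2) * integral\<^sup>L ?M (\<lambda>x. (\<phi> x)\<^sup>2) \<le> integral\<^sup>L ?M (\<lambda>x. (norm (g x))\<^sup>2 + c x * (\<phi> x)\<^sup>2)"
      unfolding c_def
      by (rule second_variation_coercive[OF R tf d d2 cl ode hb]) (auto intro: continuous_on_subset[OF cb])
  qed
  have iW: "integrable ?M (\<lambda>x. (norm (W i j x))\<^sup>2)" for i j using mV(2) unfolding L2vec_def by auto
  have iEW: "integrable ?M (\<lambda>x. ?E x $ i $ j \<bullet> W i j x)" for i j
    using mV(2)[of i j] mH(2)[of i j] unfolding L2vec_def by (intro integral_inner_sum(1)) auto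
  have icHV: "integrable ?M (\<lambda>x. c x * ?H x $ i $ j * V i j x)" for i j
  proof -
    have "integrable ?M (\<lambda>x. ?H x $ i $ j * V i j x)"
      using mV(1)[of i j] mH(1)[of i j] unfolding L2_def by (intro integrable_mult_L2) auto
    from integrable_mult_bounded(2)[OF this cm cB] show ?thesis by (simp add: mult.assoc)
  qed
  have icVV: "integrable ?M (\<lambda>x. c x * (V i j x)\<^sup>2)" for i j by (rule integrable_mult_bounded(2)[OF iVV cm cB])
  have one: "integrable ?M (\<lambda>x. 1::real)" by (intro integrable_continuous_shell continuous_intros)
  have iH4: "integrable ?M (\<lambda>x. (?H x $ i $ j)^4)" for i j by (intro integrable_continuous_shell continuous_on_power cH)
  have iQ4: "integrable ?M (\<lambda>x. (Q x $ i $ j)^4)" for i j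
  proof (rule Bochner_Integration.integrable_bound)
    show "integrable ?M (\<lambda>x. 8 * (V i j x)^4 + 8 * (?H x $ i $ j)^4)" using W0_L4[OF open_shell_int V0] iH4 by simp
    show "(\<lambda>x. (Q x $ i $ j)^4) \<in> borel_measurable ?M" using mQ(1)[of i j] unfolding L2_def by (intro borel_measurable_power) auto
    have quartic: "(a + b)^4 \<le> 8 * a^4 + 8 * b^4" for a b :: real
    proof -
      have s: "(y + z)\<^sup>2 \<le> 2 * y\<^sup>2 + 2 * z\<^sup>2" for y z :: real using zero_le_power2[of "y - z"] by (simp add: power2_eq_square algebra_simps)
      have "(a + b)^4 = ((a + b)\<^sup>2)\<^sup>2" by (simp add: power_mult[symmetric])
      also have "\<dots> \<le> (2 * a\<^sup>2 + 2 * b\<^sup>2)\<^sup>2" by (intro power_mono s) simp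
      also have "\<dots> \<le> 2 * (2 * a\<^sup>2)\<^sup>2 + 2 * (2 * b\<^sup>2)\<^sup>2" by (rule s)
      also have "\<dots> = 8 * a^4 + 8 * b^4" by (simp add: power_mult_distrib power_mult[symmetric])
      finally show ?thesis .
    qed
    have "(Q x $ i $ j)^4 \<le> 8 * (V i j x)^4 + 8 * (?H x $ i $ j)^4" for x
      using quartic[of "V i j x" "?H x $ i $ j"] unfolding V_def by simp
    then show "AE x in ?M. norm ((Q x $ i $ j)^4) \<le> norm (8 * (V i j x)^4 + 8 * (?H x $ i $ j)^4)"
      by (intro AE_I2) simp
  qed
  have iDE: "integrable ?M (\<lambda>x. (norm (D x $ i $ j))\<^sup>2)" "integrable ?M (\<lambda>x. (norm (?E x $ i $ j))\<^sup>2)" for i j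
    using mQ(2)[of i j] mH(2)[of i j] unfolding L2vec_def by blast+
  have mQH: "(\<lambda>x. Q x $ i $ j) \<in> borel_measurable ?M" "(\<lambda>x. ?H x $ i $ j) \<in> borel_measurable ?M" for i j
    using mQ(1)[of i j] mH(1)[of i j] unfolding L2_def by blast+
  have iden: "integrable ?M (\<lambda>x. LdG_density t (Q x) (D x))" "integrable ?M (\<lambda>x. LdG_density t (?H x) (?E x))"
    unfolding LdG_density_bulk grad_norm2_def
    by (intro Bochner_Integration.integrable_add integrable_divide_zero Bochner_Integration.integrable_sum iDE
        integrable_bulk[OF one mQH(1) iQ4] integrable_bulk[OF one mQH(2) iH4])+
  \<comment> \<open>Summed over the entries, this bounds the difference of the two densities from
    below. By \<open>lin\<close> its two linear terms have opposite integrals, so only half of the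
    coercive quadratic form remains.\<close>
  define r where "r i j x = (norm (W i j x))\<^sup>2 / 2 + ?E x $ i $ j \<bullet> W i j x + c x * ?H x $ i $ j * V i j x + c x * (V i j x)\<^sup>2 / 2" for i j x
  have ir: "integrable ?M (r i j)" for i j unfolding r_def using iW[of i j] iEW[of i j] icHV[of i j] icVV[of i j] by simp
  have pt: "(\<Sum>i\<in>UNIV. \<Sum>j\<in>UNIV. r i j x) \<le> LdG_density t (Q x) (D x) - LdG_density t (?H x) (?E x)"
    if x: "x \<in> ?U" and Qx: "Q x \<in> S0" for x
  proof -
    have n: "norm (x /\<^sub>R norm x) = 1" using shell_int_D[OF x] by simp
    have HS: "?H x \<in> S0" unfolding hedgehog_uniaxial by (rule uniaxial_S0[OF n])
    have VS: "Q x - ?H x \<in> S0"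
      using Qx HS unfolding S0_def by (auto simp: transpose_def vec_eq_iff trace_sub)
    have "c x * frob (?H x) (Q x - ?H x) + c x / 2 * fnorm2 (Q x - ?H x) \<le> bulk t (?H x + (Q x - ?H x)) - bulk t (?H x)"
      unfolding hedgehog_uniaxial c_def using bulk_uniaxial_add_ge[OF n _ t] VS hb(1) shell_int_D[OF x]
      unfolding hedgehog_uniaxial by blast
    then have 1: "c x * frob (?H x) (Q x - ?H x) + c x / 2 * fnorm2 (Q x - ?H x) \<le> bulk t (Q x) - bulk t (?H x)" by simp
    have "(\<Sum>i\<in>UNIV. \<Sum>j\<in>UNIV. r i j x) = (grad_norm2 (D x) - grad_norm2 (?E x)) / 2 + (c x * frob (?H x) (Q x - ?H x) + c x / 2 * fnorm2 (Q x - ?H x))"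
      unfolding grad_norm2_diff frob_def fnorm2_def sum3 r_def V_def W_def by (simp add: field_simps)
    with 1 show ?thesis unfolding LdG_density_bulk by (simp add: field_simps)
  qed
  have aeS: "AE x in ?M. Q x \<in> S0" using adm lebesgue_on_shell(3)[of "\<lambda>x. Q x \<in> S0" R] unfolding admissible_def by blast
  have "integral\<^sup>L ?M (\<lambda>x. \<Sum>i\<in>UNIV. \<Sum>j\<in>UNIV. r i j x) \<le> integral\<^sup>L ?M (\<lambda>x. LdG_density t (Q x) (D x) - LdG_density t (?H x) (?E x))"
  proof (rule integral_mono_AE)
    show "integrable ?M (\<lambda>x. \<Sum>i\<in>UNIV. \<Sum>j\<in>UNIV. r i j x)" by (intro Bochner_Integration.integrable_sum ir)
    show "integrable ?M (\<lambda>x. LdG_density t (Q x) (D x) - LdG_density t (?H x) (?E x))" using iden by simp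
    have "AE x in ?M. x \<in> ?U" by (intro AE_I2) simp
    with aeS show "AE x in ?M. (\<Sum>i\<in>UNIV. \<Sum>j\<in>UNIV. r i j x) \<le> LdG_density t (Q x) (D x) - LdG_density t (?H x) (?E x)"
      by eventually_elim (rule pt)
  qed
  also have "\<dots> = LdG R t Q D - LdG R t ?H ?E"
    unfolding LdG_def lebesgue_on_shell(1) using iden by simp
  also have "integral\<^sup>L ?M (\<lambda>x. \<Sum>i\<in>UNIV. \<Sum>j\<in>UNIV. r i j x) = (\<Sum>i\<in>UNIV. \<Sum>j\<in>UNIV. integral\<^sup>L ?M (r i j))"
    by (simp add: Bochner_Integration.integral_sum ir)
  finally have le: "(\<Sum>i\<in>UNIV. \<Sum>j\<in>UNIV. integral\<^sup>L ?M (r i j)) \<le> LdG R t Q D - LdG R t ?H ?E" .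
  \<comment> \<open>The constant is half of the 1/20 in \<open>quad\<close>, because the quadratic
    form enters \<open>r i j\<close> with the factor 1/2.\<close>
  have rij: "1 / (40 * R\<^sup>2) * integral\<^sup>L ?M (\<lambda>x. (V i j x)\<^sup>2) \<le> integral\<^sup>L ?M (r i j)" for i j
  proof -
    have "integral\<^sup>L ?M (r i j) = integral\<^sup>L ?M (\<lambda>x. (norm (W i j x))\<^sup>2) / 2 + integral\<^sup>L ?M (\<lambda>x. ?E x $ i $ j \<bullet> W i j x)
        + integral\<^sup>L ?M (\<lambda>x. c x * ?H x $ i $ j * V i j x) + integral\<^sup>L ?M (\<lambda>x. c x * (V i j x)\<^sup>2) / 2"
      unfolding r_def using iW[of i j] iEW[of i j] icHV[of i j] icVV[of i j] by simp
    also have "\<dots> = (integral\<^sup>L ?M (\<lambda>x. (norm (W i j x))\<^sup>2) + integral\<^sup>L ?M (\<lambda>x. c x * (V i j x)\<^sup>2)) / 2"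
      unfolding lin by simp
    finally show ?thesis using quad[of i j] by simp
  qed
  have "1 / (40 * R\<^sup>2) * (\<Sum>i\<in>UNIV. \<Sum>j\<in>UNIV. integral\<^sup>L ?M (\<lambda>x. (V i j x)\<^sup>2)) \<le> (\<Sum>i\<in>UNIV. \<Sum>j\<in>UNIV. integral\<^sup>L ?M (r i j))"
    unfolding sum_distrib_left by (intro sum_mono rij)
  then show "LdG R t ?H ?E + 1 / (40 * R\<^sup>2) * (\<Sum>i\<in>UNIV. \<Sum>j\<in>UNIV. integral\<^sup>L ?M (\<lambda>x. (Q x $ i $ j - ?H x $ i $ j)\<^sup>2)) \<le> LdG R t Q D"
    using le unfolding V_def by simp
qed

lemma double_sum_zero:
  fixes f :: "'a::finite \<Rightarrow> 'b::finite \<Rightarrow> real"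
  assumes p: "0 < p" and le: "p * (\<Sum>i\<in>UNIV. \<Sum>j\<in>UNIV. f i j) \<le> 0" and f: "\<And>i j. 0 \<le> f i j"
  shows "f i j = 0"
proof -
  have "f i j \<le> (\<Sum>j\<in>UNIV. f i j)" by (rule member_le_sum) (use f in auto)
  also have "\<dots> \<le> (\<Sum>i\<in>UNIV. \<Sum>j\<in>UNIV. f i j)"
    by (rule member_le_sum[of i UNIV "\<lambda>i. \<Sum>j\<in>UNIV. f i j"]) (use f in \<open>auto intro: sum_nonneg\<close>)
  also have "\<dots> \<le> 0" using p le by (simp add: mult_le_0_iff)
  finally show ?thesis using f[of i j] by simp
qed

theorem theorem1:
  fixes R Rstar t :: real and h h' :: "real \<Rightarrow> real"
  assumes R_gt: "1 < R"
    and Rstar_gt: "1 < Rstar"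
    and Rstar_eta: "\<forall>R'. 1 < R' \<and> R' \<le> Rstar \<longrightarrow> (\<forall>r\<in>{1..R'}. eta R' r \<ge> 2/3)"
    and R_small: "R < min (exp (4 * pi\<^sup>2 / 23)) Rstar"
    and t_nonneg: "0 \<le> t"
    and h_adm: "Ah R h h'"
    and h_min: "\<forall>g g'. Ah R g g' \<longrightarrow> Eh R t h h' \<le> Eh R t g g'"
  shows "\<exists>DH. admissible R (hedgehog h) DH \<and>
           (\<forall>Q D. admissible R Q D \<longrightarrow>
              LdG R t (hedgehog h) DH \<le> LdG R t Q D \<and>
              (LdG R t Q D = LdG R t (hedgehog h) DH \<longrightarrow>
                 (AE x in lebesgue_on (shell R). Q x = hedgehog h x)))"
proof -
  have ch: "continuous_on {1..R} h" and h1: "h 1 = 1" "h R = 1" using h_adm unfolding Ah_def by auto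
  have min: "\<And>g g'. Ah R g g' \<Longrightarrow> Eh R t h h' \<le> Eh R t g g'" using h_min by blast
  obtain k l where ck: "continuous_on {1..R} k" and cl: "continuous_on {1<..<R} l"
    and d: "\<And>r. 1 < r \<Longrightarrow> r < R \<Longrightarrow> (h has_real_derivative k r) (at r)"
    and d2: "\<And>r. 1 < r \<Longrightarrow> r < R \<Longrightarrow> (k has_real_derivative l r) (at r)"
    and ode: "\<And>r. 1 < r \<Longrightarrow> r < R \<Longrightarrow> r\<^sup>2 * l r + 2 * r * k r = 6 * h r + r\<^sup>2 * (h r * bulk_coeff t (h r))"
    and ae: "AE r in lebesgue_on {1<..<R}. h' r = k r"
    using minimizer_C2[OF R_gt h_adm min] by blast
  have nn: "0 \<le> h r" if "1 < r" "r < R" for r by (rule minimizer_nonneg[OF R_gt t_nonneg h_adm min ck d ae that])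
  have bounds: "h r < 1" "eta R r < h r" if "1 < r" "r < R" for r
    by (rule minimizer_bounds[OF R_gt t_nonneg ch h1 d d2 ode nn]; (assumption | rule that))+
  \<comment> \<open>The condition on \<open>eta\<close> is applied with \<open>R' = R\<close>, which
    is allowed because \<open>R < Rstar\<close>.\<close>
  have "eta R r \<ge> 2/3" if "1 < r" "r < R" for r using Rstar_eta R_small R_gt that by auto
  then have hb: "2/3 \<le> h r" "h r \<le> 1" "h r < 1" if "1 < r" "r < R" for r
    using bounds[OF that] \<open>\<And>r. 1 < r \<Longrightarrow> r < R \<Longrightarrow> eta R r \<ge> 2/3\<close>[OF that] by auto
  have R94: "R < 9/4" using eta_constraint_bound[OF Rstar_eta] R_small by simp
  have admH: "admissible R (hedgehog h) (hedgehog_grad h k)" by (rule hedgehog_admissible[OF R_gt ch ck d h1 hb(3)])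
  let ?M = "lebesgue_on (shell_int R)"
  show ?thesis
  proof (intro exI[of _ "hedgehog_grad h k"] conjI allI impI)
    show "admissible R (hedgehog h) (hedgehog_grad h k)" by (rule admH)
  next
    fix Q D assume adm: "admissible R Q D"
    let ?I = "\<lambda>i j. integral\<^sup>L ?M (\<lambda>x. (Q x $ i $ j - hedgehog h x $ i $ j)\<^sup>2)"
    have gap: "LdG R t (hedgehog h) (hedgehog_grad h k) + 1 / (40 * R\<^sup>2) * (\<Sum>i\<in>UNIV. \<Sum>j\<in>UNIV. ?I i j) \<le> LdG R t Q D"
      "integrable ?M (\<lambda>x. (Q x $ i $ j - hedgehog h x $ i $ j)\<^sup>2)" for i j
      by (rule energy_gap[OF R_gt R94 t_nonneg ch ck cl d d2 ode hb(1,2) admH adm]; assumption)+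
    have I0: "0 \<le> ?I i j" for i j by (rule Bochner_Integration.integral_nonneg) simp
    have S0: "0 \<le> (\<Sum>i\<in>UNIV. \<Sum>j\<in>UNIV. ?I i j)" by (intro sum_nonneg I0)
    have p: "0 < 1 / (40 * R\<^sup>2)" using R_gt by simp
    show "LdG R t (hedgehog h) (hedgehog_grad h k) \<le> LdG R t Q D"
      using gap(1) mult_nonneg_nonneg[OF less_imp_le[OF p] S0] by linarith
    assume eq: "LdG R t Q D = LdG R t (hedgehog h) (hedgehog_grad h k)"
    \<comment> \<open>With equal energies the distance term in \<open>gap\<close> has nothing left
      to pay for it, so each entry of the difference has \<open>L^2\<close> norm 0.\<close>
    then have le: "1 / (40 * R\<^sup>2) * (\<Sum>i\<in>UNIV. \<Sum>j\<in>UNIV. ?I i j) \<le> 0" using gap(1) by linarith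
    have I: "?I i j = 0" for i j by (rule double_sum_zero[OF p le I0])
    have "AE x in ?M. (Q x $ i $ j - hedgehog h x $ i $ j)\<^sup>2 = 0" for i j
      by (rule iffD1[OF integral_nonneg_eq_0_iff_AE[OF gap(2)] I]) simp
    then have "AE x in ?M. \<forall>i\<in>UNIV. \<forall>j\<in>UNIV. (Q x $ i $ j - hedgehog h x $ i $ j)\<^sup>2 = 0"
      by (intro AE_finite_allI) auto
    then have "AE x in ?M. Q x = hedgehog h x" by eventually_elim (simp add: vec_eq_iff)
    then show "AE x in lebesgue_on (shell R). Q x = hedgehog h x" using lebesgue_on_shell(3)[of "\<lambda>x. Q x = hedgehog h x" R] by blast
  qed
qed

end
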